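(* Let $G$ be a discrete countable group and let $\mu$ be an admissible probability measure on $G$. Let $(X,d)$ be a separable complete $\mathrm{CAT}(0)$ space and let $G\curvearrowright (X,d)$ be an action by isometries such that $G$ contains two independent contracting elements. Then $$\mathbb P\big(\omega : Z_n(\omega)\text{ is a contracting isometry of }X\big)\underset{n\to\infty}{\longrightarrow}1.$$ If moreover $\mu$ has finite support, then there exist $c<1$ and $K>0$ such that for all $n$, $$\mathbb P\big(\omega : Z_n(\omega)\text{ is not contracting}\big)\le K c^n .$$
   Context: $\mu$ is admissible if its support generates $G$ as a semigroup. Let $\Omega=G^{\mathbb N}$, $\mathbb P=\mu^{\otimes\mathbb N}$; for $\omega=(\omega_i)\in\Omega$ the random walk generated by $\mu$ is $Z_n(\omega)=\omega_1\omega_2\cdots\omega_n$, $Z_0=\mathrm{id}$. An isometry $g$ of $X$ is axial if its displacement function $x\mapsto d(gx,x)$ attains a positive minimum; equivalently $g$ translates nontrivially along some geodesic line (an axis). A geodesic $\gamma$ is $C$-contracting ($C>0$) if for every metric ball $B$ disjoint from $\gamma$, the nearest-point projection $\pi_\gamma(B)$ has diameter at most $C$. An axial isometry is contracting if one of its axes is $C$-contracting for some $C>0$. Two axial isometries $g_1,g_2$ are independent if, for $o\in X$, the map $(m,n)\in\mathbb Z\times\mathbb Z\mapsto d(g_1^m o,g_2^n o)\in[0,\infty)$ is proper; for contracting isometries this amounts to their pairs of fixed points in the visual boundary $\partial_\infty X$ being disjoint. *)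

theory Defs
  imports "HOL-Probability.Probability" "HOL-Algebra.Group_Action"
begin

definition geodesic_segment :: "'a::metric_space \<Rightarrow> 'a \<Rightarrow> 'a set \<Rightarrow> bool" where
  "geodesic_segment x y S \<longleftrightarrow>
     (\<exists>\<gamma> :: real \<Rightarrow> 'a. \<gamma> 0 = x \<and> \<gamma> (dist x y) = y \<and>
        (\<forall>s\<in>{0..dist x y}. \<forall>t\<in>{0..dist x y}. dist (\<gamma> s) (\<gamma> t) = \<bar>s - t\<bar>) \<and>
        S = \<gamma> ` {0..dist x y})"

definition geodesic_space :: "'a::metric_space itself \<Rightarrow> bool" where
  "geodesic_space _ \<longleftrightarrow> (\<forall>x y :: 'a. \<exists>S. geodesic_segment x y S)"

text \<open>Geodesic triangles are no thicker than their comparison triangles in the Euclidean plane.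
  It suffices to compare points on the two sides issuing from \<open>p\<close>: the quantification over
  all labellings of the vertices covers every pair of sides, and two points on one and the same
  side have the same distance as their comparison points.\<close>

definition cat0_space :: "'a::metric_space itself \<Rightarrow> bool" where
  "cat0_space T \<longleftrightarrow> geodesic_space T \<and>
     (\<forall>(p::'a) q r Q R. geodesic_segment p q Q \<longrightarrow> geodesic_segment p r R \<longrightarrow>
        (\<forall>p' q' r' :: real^2.
           dist p' q' = dist p q \<longrightarrow> dist p' r' = dist p r \<longrightarrow> dist q' r' = dist q r \<longrightarrow>
           (\<forall>x\<in>Q. \<forall>y\<in>R. \<forall>x'\<in>closed_segment p' q'. \<forall>y'\<in>closed_segment p' r'.
              dist p' x' = dist p x \<longrightarrow> dist p' y' = dist p y \<longrightarrow> dist x y \<le> dist x' y')))"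

definition isometry :: "('a::metric_space \<Rightarrow> 'a) \<Rightarrow> bool" where
  "isometry f \<longleftrightarrow> surj f \<and> (\<forall>x y. dist (f x) (f y) = dist x y)"

definition geodesic_line :: "(real \<Rightarrow> 'a::metric_space) \<Rightarrow> bool" where
  "geodesic_line \<gamma> \<longleftrightarrow> (\<forall>s t. dist (\<gamma> s) (\<gamma> t) = \<bar>s - t\<bar>)"

definition axial :: "('a::metric_space \<Rightarrow> 'a) \<Rightarrow> bool" where
  "axial f \<longleftrightarrow> isometry f \<and> (\<exists>x. dist (f x) x > 0 \<and> (\<forall>y. dist (f x) x \<le> dist (f y) y))"

definition is_axis :: "('a::metric_space \<Rightarrow> 'a) \<Rightarrow> (real \<Rightarrow> 'a) \<Rightarrow> bool" where
  "is_axis f \<gamma> \<longleftrightarrow> geodesic_line \<gamma> \<and> (\<exists>t. t \<noteq> 0 \<and> (\<forall>s. f (\<gamma> s) = \<gamma> (s + t)))"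

definition nearest_points :: "'a::metric_space set \<Rightarrow> 'a set \<Rightarrow> 'a set" where
  "nearest_points A B = {p \<in> A. \<exists>x\<in>B. \<forall>a\<in>A. dist x p \<le> dist x a}"

text \<open>Boundedness is required explicitly because \<^const>\<open>diameter\<close> has no meaningful value on
  unbounded sets.\<close>

definition contracting_set :: "real \<Rightarrow> 'a::metric_space set \<Rightarrow> bool" where
  "contracting_set C A \<longleftrightarrow>
     (\<forall>x r. ball x r \<inter> A = {} \<longrightarrow>
        bounded (nearest_points A (ball x r)) \<and> diameter (nearest_points A (ball x r)) \<le> C)"

definition contracting :: "('a::metric_space \<Rightarrow> 'a) \<Rightarrow> bool" where
  "contracting f \<longleftrightarrow> axial f \<and> (\<exists>\<gamma>. is_axis f \<gamma> \<and> (\<exists>C>0. contracting_set C (range \<gamma>)))"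

definition isometric_action ::
  "('g, 'b) monoid_scheme \<Rightarrow> ('g \<Rightarrow> 'a::metric_space \<Rightarrow> 'a) \<Rightarrow> bool" where
  "isometric_action G \<phi> \<longleftrightarrow> group_action G UNIV \<phi> \<and> (\<forall>g\<in>carrier G. isometry (\<phi> g))"

definition independent_elements ::
  "('g, 'b) monoid_scheme \<Rightarrow> ('g \<Rightarrow> 'a::metric_space \<Rightarrow> 'a) \<Rightarrow> 'g \<Rightarrow> 'g \<Rightarrow> bool" where
  "independent_elements G \<phi> g h \<longleftrightarrow>
     (\<forall>x. proper_map (discrete_topology (UNIV :: (int \<times> int) set)) (top_of_set {0::real..})
            (\<lambda>(m, n). dist (\<phi> (g [^]\<^bsub>G\<^esub> m) x) (\<phi> (h [^]\<^bsub>G\<^esub> n) x)))"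

inductive_set semigroup_generated :: "('g, 'b) monoid_scheme \<Rightarrow> 'g set \<Rightarrow> 'g set"
  for G :: "('g, 'b) monoid_scheme" and S :: "'g set" where
  base: "s \<in> S \<Longrightarrow> s \<in> semigroup_generated G S"
| mult: "a \<in> semigroup_generated G S \<Longrightarrow> b \<in> semigroup_generated G S \<Longrightarrow>
           a \<otimes>\<^bsub>G\<^esub> b \<in> semigroup_generated G S"

text \<open>A probability measure on the discrete group is a measure on its full power set. Working on
  the carrier rather than on the ambient type keeps the finite powers of the sigma-algebra discrete,
  as the carrier is countable.\<close>

definition prob_measure_on :: "('g, 'b) monoid_scheme \<Rightarrow> 'g measure \<Rightarrow> bool" where
  "prob_measure_on G \<mu> \<longleftrightarrow> prob_space \<mu> \<and> sets \<mu> = Pow (carrier G)"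

definition measure_support :: "'g measure \<Rightarrow> 'g set" where
  "measure_support \<mu> = {g \<in> space \<mu>. measure \<mu> {g} > 0}"

definition admissible :: "('g, 'b) monoid_scheme \<Rightarrow> 'g measure \<Rightarrow> bool" where
  "admissible G \<mu> \<longleftrightarrow> semigroup_generated G (measure_support \<mu>) = carrier G"

definition walk_measure :: "'g measure \<Rightarrow> (nat \<Rightarrow> 'g) measure" where
  "walk_measure \<mu> = PiM UNIV (\<lambda>_. \<mu>)"

text \<open>\<open>Z\<^sub>n = \<omega>\<^sub>1 \<cdots> \<omega>\<^sub>n\<close>; the coordinate \<open>\<omega>\<^sub>0\<close> is not used.\<close>

fun walk :: "('g, 'b) monoid_scheme \<Rightarrow> nat \<Rightarrow> (nat \<Rightarrow> 'g) \<Rightarrow> 'g" where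
  "walk G 0 \<omega> = \<one>\<^bsub>G\<^esub>"
| "walk G (Suc n) \<omega> = walk G n \<omega> \<otimes>\<^bsub>G\<^esub> \<omega> (Suc n)"

end

theory Submission
  imports Defs
begin

text \<open>Idea. By CAT(0) geometry an isometry \<open>f\<close> that maps the complement of \<open>U\<close> into \<open>V\<close>, where all
  geodesics from \<open>U\<close> to \<open>V\<close> pass near one point \<open>p\<close> and \<open>p\<close> is far from both sets, is contracting:
  every sublevel set of its displacement function meets a fixed ball around \<open>p\<close>, so the minimum is
  attained, and the orbit of \<open>p\<close> controls the projection to the axis. The conjugates of \<open>h\<close> by powers
  of \<open>g\<close> provide 32 lines with bounded mutual projections, and large powers of the corresponding
  translations are a Schottky family of ping-pong type. Admissibility allows all of these powers to
  be realised by the same number of steps of the walk, so that \<open>Z\<^sub>n\<close> becomes a product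
  \<open>w\<^sub>0 a\<^sub>1 b\<^sub>1 w\<^sub>1 a\<^sub>2 b\<^sub>2 w\<^sub>2 \<dots>\<close> with independent uniform Schottky letters \<open>a\<^sub>i\<close>, \<open>b\<^sub>i\<close> and arbitrary
  \<open>w\<^sub>i\<close>. A pivoting argument in the style of Gouezel then applies. Reading the product from the left
  one keeps a stack of letters that are aligned with each other. A new slot is pushed unless it is
  badly placed, and the letters on the stack keep enough randomness for a failure to remove only few
  of them. The stack grows linearly up to exponentially small probability, and its two ends are used
  to close the word up cyclically.\<close>

section \<open>CAT(0) geometry\<close>

text \<open>X need not be proper, so minima of displacement come from completeness and convexity
  (\<open>nested_convex_point\<close>), and negative curvature enters as a bottleneck condition on
  geodesics (\<open>gate\<close>), derived from the contraction of finitely many lines. The height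
  of the stack is never treated as a random variable. It is encoded in the weight
  \<open>(1/2) ^ length fs\<close>: a bound of this shape for good stacks extends to all linked
  stacks up to the factor 4, and reading one slot improves it by 3/4. With N letters and at most one
  exception per choice, a slot costs N (N/2 + 8) out of N^2, which is at most 3/4 of N^2 exactly
  when N is at least 32. Nor is the walk decomposed by a coupling: the law of a block of steps
  dominates a multiple of the uniform law on slots, and the induction over blocks treats a block
  either as a slot or as a fixed word.\<close>

definition btw :: "'a::metric_space \<Rightarrow> 'a \<Rightarrow> 'a \<Rightarrow> bool" where
  "btw x z y \<longleftrightarrow> dist x z + dist z y = dist x y"

lemma dist_vector_2: "dist (vector [x, y] :: real^2) (vector [u, v]) = sqrt ((x - u)\<^sup>2 + (y - v)\<^sup>2)"
  by (simp add: dist_vec_def L2_set_def sum_2 dist_real_def)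

lemma comparison_triangle:
  assumes "0 \<le> a" "0 \<le> b" "0 \<le> c" "a \<le> b + c" "b \<le> a + c" "c \<le> a + b"
  shows "\<exists>p q r :: real^2. dist p q = a \<and> dist p r = b \<and> dist q r = c"
proof (cases "a = 0")
  case True
  then have "b = c" using assms by simp
  then have "dist (vector [0, 0] :: real^2) (vector [b, 0]) = b" "b = c"
    using assms by (simp_all add: dist_vector_2)
  then show ?thesis using True by (metis dist_self)
next
  case False
  then have a: "a > 0" using assms by simp
  \<comment> \<open>Law of cosines, with p at the origin and q at (a, 0). The triangle inequalities
    give |x| <= b, so the root defining y is real.\<close>
  define x where "x = (a\<^sup>2 + b\<^sup>2 - c\<^sup>2) / (2 * a)"
  define y where "y = sqrt (b\<^sup>2 - x\<^sup>2)"
  have ax: "2 * a * x = a\<^sup>2 + b\<^sup>2 - c\<^sup>2" using a by (simp add: x_def)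
  have "c\<^sup>2 \<le> (a + b)\<^sup>2" using assms by (intro power_mono) auto
  then have "a * (- x) \<le> a * b" using ax by (simp add: power2_eq_square algebra_simps)
  then have 1: "- x \<le> b" by (rule iffD1[OF mult_le_cancel_left_pos[OF a]])
  have "\<bar>a - b\<bar> \<le> c" using assms by linarith
  then have "(a - b)\<^sup>2 \<le> c\<^sup>2" by (metis abs_ge_zero power2_abs power_mono)
  then have "a * x \<le> a * b" using ax by (simp add: power2_eq_square algebra_simps)
  then have "x \<le> b" by (rule iffD1[OF mult_le_cancel_left_pos[OF a]])
  with 1 have "\<bar>x\<bar> \<le> b" by linarith
  then have "x\<^sup>2 \<le> b\<^sup>2" by (metis abs_ge_zero power2_abs power_mono)
  then have y2: "y\<^sup>2 = b\<^sup>2 - x\<^sup>2" by (simp add: y_def)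
  have "dist (vector [0, 0] :: real^2) (vector [a, 0]) = a" using a by (simp add: dist_vector_2)
  moreover have "dist (vector [0, 0] :: real^2) (vector [x, y]) = b"
    using assms by (simp add: dist_vector_2 y2)
  moreover have "(a - x)\<^sup>2 + y\<^sup>2 = c\<^sup>2" using ax y2 by (simp add: power2_eq_square algebra_simps)
  then have "dist (vector [a, 0] :: real^2) (vector [x, y]) = c"
    using assms by (simp add: dist_vector_2)
  ultimately show ?thesis by blast
qed

section \<open>Isometries and betweenness\<close>

lemma isometry_dist: "isometry f \<Longrightarrow> dist (f x) (f y) = dist x y"
  by (simp add: isometry_def)

lemma isometry_btw: "isometry f \<Longrightarrow> btw (f x) (f z) (f y) \<longleftrightarrow> btw x z y"
  by (simp add: btw_def isometry_dist)

lemma isometry_bij: assumes "isometry f" shows "bij f"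
proof -
  have "inj f" by (rule injI) (metis assms isometry_dist dist_eq_0_iff)
  then show ?thesis using assms by (simp add: isometry_def bij_def)
qed

lemma isometry_comp: "isometry f \<Longrightarrow> isometry g \<Longrightarrow> isometry (f \<circ> g)"
  using comp_surj[of g f] by (simp add: isometry_def o_def)

lemma isometry_id: "isometry id"
  by (simp add: isometry_def)

lemma isometry_inv: assumes "isometry f" shows "isometry (inv_into UNIV f)"
proof -
  have "bij (inv_into UNIV f)" using isometry_bij[OF assms] by (rule bij_imp_bij_inv)
  moreover have "dist (inv_into UNIV f x) (inv_into UNIV f y) = dist x y" for x y
    by (metis assms isometry_bij isometry_dist bij_inv_eq_iff)
  ultimately show ?thesis by (simp add: isometry_def bij_is_surj)
qed

lemma isometry_inv_simps:
  assumes "isometry f" shows "f (inv_into UNIV f x) = x" "inv_into UNIV f (f x) = x"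
  using isometry_bij[OF assms] by (simp_all add: bij_is_surj surj_f_inv_f bij_is_inj)

lemma isometry_funpow: "isometry f \<Longrightarrow> isometry (f ^^ n)"
  by (induction n) (auto simp: isometry_id isometry_comp)

lemma btw_sym: "btw x z y \<Longrightarrow> btw y z x"
  by (simp add: btw_def dist_commute)

lemma btw_left: "btw x z y \<Longrightarrow> btw x u z \<Longrightarrow> btw x u y \<and> btw u z y"
  using dist_triangle[of x y u] dist_triangle[of u y z] unfolding btw_def by linarith

lemma btw_right: "btw x z y \<Longrightarrow> btw z u y \<Longrightarrow> btw x u y \<and> btw x z u"
  using btw_left[of y z x u] by (auto dest: btw_sym)

lemma dist_near_btw:
  assumes "btw x z y" "dist z p \<le> D" shows "dist x y \<ge> dist x p + dist p y - 2 * D"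
  using assms dist_triangle[of x p z] dist_triangle[of p y z] unfolding btw_def
  by (simp add: dist_commute)

section \<open>Comparison inequalities\<close>

locale cat0 =
  fixes ty :: "'a::complete_space itself"
  assumes cat0: "cat0_space ty"
begin

lemma geodesic_path:
  obtains \<sigma> :: "real \<Rightarrow> 'a" where "\<sigma> 0 = x" "\<sigma> (dist x y) = y"
    "\<And>s t. s \<in> {0..dist x y} \<Longrightarrow> t \<in> {0..dist x y} \<Longrightarrow> dist (\<sigma> s) (\<sigma> t) = \<bar>s - t\<bar>"
proof -
  have "geodesic_space ty" using cat0 by (simp only: cat0_space_def)
  then obtain S where "geodesic_segment x y S" unfolding geodesic_space_def by blast
  then show ?thesis using that unfolding geodesic_segment_def by blast
qed

text \<open>The CAT(0) hypothesis speaks of segments, the arguments below of betweenness. Geodesics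
  from x to z and from z to y concatenate to a geodesic: a shortcut between the two halves would
  bring y nearer to x than dist x z + dist z y.\<close>

lemma btw_segment:
  fixes x y z :: 'a
  assumes "btw x z y"
  shows "\<exists>S. geodesic_segment x y S \<and> x \<in> S \<and> y \<in> S \<and> z \<in> S"
proof -
  obtain \<sigma> :: "real \<Rightarrow> 'a" where \<sigma>: "\<sigma> 0 = x" "\<sigma> (dist x z) = z"
    "\<And>s t. s \<in> {0..dist x z} \<Longrightarrow> t \<in> {0..dist x z} \<Longrightarrow> dist (\<sigma> s) (\<sigma> t) = \<bar>s - t\<bar>"
    using geodesic_path by metis
  obtain \<tau> :: "real \<Rightarrow> 'a" where \<tau>: "\<tau> 0 = z" "\<tau> (dist z y) = y"
    "\<And>s t. s \<in> {0..dist z y} \<Longrightarrow> t \<in> {0..dist z y} \<Longrightarrow> dist (\<tau> s) (\<tau> t) = \<bar>s - t\<bar>"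
    using geodesic_path by metis
  define d e where "d = dist x z" and "e = dist z y"
  have de: "d \<ge> 0" "e \<ge> 0" "dist x y = d + e" using assms by (simp_all add: d_def e_def btw_def)
  define \<rho> where "\<rho> s = (if s \<le> d then \<sigma> s else \<tau> (s - d))" for s
  have mix: "dist (\<rho> s) (\<rho> t) = t - s" if "0 \<le> s" "s \<le> d" "d < t" "t \<le> d + e" for s t
  proof -
    have a: "dist (\<rho> s) z = d - s" "dist x (\<rho> s) = s"
      using \<sigma>(3)[of s d] \<sigma>(3)[of 0 s] that \<sigma>(1,2) by (auto simp: \<rho>_def d_def)
    have b: "dist z (\<rho> t) = t - d" "dist (\<rho> t) y = d + e - t"
      using \<tau>(3)[of 0 "t - d"] \<tau>(3)[of "t - d" e] that \<tau>(1,2) by (auto simp: \<rho>_def e_def)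
    have "dist x y \<le> dist x (\<rho> s) + dist (\<rho> s) (\<rho> t) + dist (\<rho> t) y"
      by (meson add_right_mono dist_triangle order_trans)
    moreover have "dist (\<rho> s) (\<rho> t) \<le> dist (\<rho> s) z + dist z (\<rho> t)" by (rule dist_triangle)
    ultimately show ?thesis using a b de by simp
  qed
  have iso: "dist (\<rho> s) (\<rho> t) = \<bar>s - t\<bar>" if "s \<in> {0..d + e}" "t \<in> {0..d + e}" for s t
  proof -
    consider "s \<le> d" "t \<le> d" | "s \<le> d" "d < t" | "d < s" "t \<le> d" | "d < s" "d < t" by linarith
    then show ?thesis
    proof cases
      case 1 then show ?thesis using \<sigma>(3)[of s t] that by (simp add: \<rho>_def d_def)
    next
      case 2 then show ?thesis using mix[of s t] that by simp
    next
      case 3 then show ?thesis using mix[of t s] that by (simp add: dist_commute)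
    next
      case 4 then show ?thesis using \<tau>(3)[of "s - d" "t - d"] that by (simp add: \<rho>_def e_def)
    qed
  qed
  have end0: "\<rho> 0 = x" using \<sigma>(1) de by (simp add: \<rho>_def)
  have endz: "\<rho> d = z" using \<sigma>(2) by (simp add: \<rho>_def d_def)
  have endy: "\<rho> (dist x y) = y"
  proof (cases "e = 0")
    case True
    then have "z = y" by (simp add: e_def)
    then show ?thesis using endz True de by simp
  next
    case False
    then have "\<not> d + e \<le> d" using de by simp
    then show ?thesis using \<tau>(2) de by (simp add: \<rho>_def e_def)
  qed
  have "geodesic_segment x y (\<rho> ` {0..dist x y})"
    unfolding geodesic_segment_def
    by (rule exI[of _ \<rho>]) (use end0 endy iso de(3) in simp)
  moreover have "x \<in> \<rho> ` {0..dist x y}" using end0 by (rule image_eqI[OF sym]) simp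
  moreover have "y \<in> \<rho> ` {0..dist x y}" using endy by (rule image_eqI[OF sym]) simp
  moreover have "z \<in> \<rho> ` {0..dist x y}" using endz by (rule image_eqI[OF sym]) (use de in simp)
  ultimately show ?thesis by blast
qed

lemma comparison:
  fixes p q r x y :: 'a
  assumes "btw p x q" "btw p y r"
    and "dist p' q' = dist p q" "dist p' r' = dist p r" "dist q' r' = dist q r"
    and "x' \<in> closed_segment p' q'" "y' \<in> closed_segment p' r'"
    and "dist p' x' = dist p x" "dist p' y' = dist p y"
  shows "dist x y \<le> dist x' (y' :: real^2)"
proof -
  obtain Q R where "geodesic_segment p q Q" "x \<in> Q" "geodesic_segment p r R" "y \<in> R"
    using btw_segment assms(1,2) by metis
  then show ?thesis using cat0 assms(3-) unfolding cat0_space_def by blast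
qed

lemma comparison_points:
  fixes p q r :: 'a
  obtains p' q' r' :: "real^2"
  where "dist p' q' = dist p q" "dist p' r' = dist p r" "dist q' r' = dist q r"
  using comparison_triangle[of "dist p q" "dist p r" "dist q r"]
    dist_triangle[of p q r] dist_triangle[of p r q] dist_triangle[of q r p]
  by (metis dist_commute zero_le_dist add.commute)

text \<open>In the comparison triangle the two points are the images of q' and r' under the
  homothety with centre p' and ratio l.\<close>

lemma thales:
  fixes p q r x y :: 'a
  assumes "btw p x q" "btw p y r" "0 \<le> l" "l \<le> 1"
    and "dist p x = l * dist p q" "dist p y = l * dist p r"
  shows "dist x y \<le> l * dist q r"
proof -
  obtain p' q' r' :: "real^2"
    where c: "dist p' q' = dist p q" "dist p' r' = dist p r" "dist q' r' = dist q r"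
    using comparison_points by metis
  define x' y' where "x' = p' + l *\<^sub>R (q' - p')" and "y' = p' + l *\<^sub>R (r' - p')"
  have "x' = (1 - l) *\<^sub>R p' + l *\<^sub>R q'" "y' = (1 - l) *\<^sub>R p' + l *\<^sub>R r'"
    by (simp_all add: x'_def y'_def algebra_simps)
  then have "x' \<in> closed_segment p' q'" "y' \<in> closed_segment p' r'"
    using assms(3,4) by (auto simp: in_segment)
  moreover have "dist p' x' = dist p x" "dist p' y' = dist p y"
    using assms c by (simp_all add: x'_def y'_def dist_norm norm_minus_commute)
  ultimately have "dist x y \<le> dist x' y'"
    using comparison[OF assms(1,2) c] by blast
  also have "x' - y' = l *\<^sub>R (q' - r')" by (simp add: x'_def y'_def algebra_simps)
  then have "dist x' y' = l * dist q r" using assms(3) c(3) by (simp add: dist_norm)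
  finally show ?thesis .
qed

text \<open>The Bruhat-Tits inequality: m is compared with the midpoint of q' and r', for which the
  parallelogram law gives equality.\<close>

lemma CN:
  fixes p q r m :: 'a
  assumes "dist q m = dist q r / 2" "dist m r = dist q r / 2"
  shows "(dist p m)\<^sup>2 \<le> (dist p q)\<^sup>2 / 2 + (dist p r)\<^sup>2 / 2 - (dist q r)\<^sup>2 / 4"
proof -
  obtain q' r' p' :: "real^2"
    where c: "dist q' r' = dist q r" "dist q' p' = dist q p" "dist r' p' = dist r p"
    using comparison_points by metis
  define m' where "m' = midpoint q' r'"
  have "dist m p \<le> dist m' p'"
    by (rule comparison[of q m r p p, OF _ _ c])
      (use assms in \<open>auto simp: btw_def m'_def c dist_midpoint\<close>)
  then have "(dist p m)\<^sup>2 \<le> (dist m' p')\<^sup>2" by (simp add: dist_commute power_mono)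
  also have "(dist m' p')\<^sup>2 = (dist q' p')\<^sup>2 / 2 + (dist r' p')\<^sup>2 / 2 - (dist q' r')\<^sup>2 / 4"
    unfolding m'_def midpoint_def dist_norm power2_norm_eq_inner
    by (simp add: inner_simps field_simps inner_commute)
  finally show ?thesis using c by (simp add: dist_commute)
qed

lemma btw_point:
  fixes x y :: 'a
  assumes "0 \<le> t" "t \<le> dist x y"
  obtains z where "btw x z y" "dist x z = t" "dist z y = dist x y - t"
proof -
  obtain \<sigma> :: "real \<Rightarrow> 'a" where \<sigma>: "\<sigma> 0 = x" "\<sigma> (dist x y) = y"
    "\<And>s t. s \<in> {0..dist x y} \<Longrightarrow> t \<in> {0..dist x y} \<Longrightarrow> dist (\<sigma> s) (\<sigma> t) = \<bar>s - t\<bar>"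
    using geodesic_path by metis
  have "dist x (\<sigma> t) = t" "dist (\<sigma> t) y = dist x y - t"
    using \<sigma>(1,2) \<sigma>(3)[of 0 t] \<sigma>(3)[of t "dist x y"] assms by auto
  then show ?thesis using that[of "\<sigma> t"] by (simp add: btw_def)
qed

text \<open>The diagonal from x to f y cuts the quadrilateral x, y, f y, f x into two triangles.
  \<open>thales\<close> in each of them, with w dividing the diagonal as z divides its side, bounds
  dist z (f z) by a convex combination of the two end displacements.\<close>

lemma displacement_convex:
  fixes x y z :: 'a
  assumes f: "isometry f" and z: "btw x z y"
    and "dist x (f x) \<le> c" "dist y (f y) \<le> c"
  shows "dist z (f z) \<le> c"
proof (cases "x = y")
  case True
  then have "dist x z + dist x z = 0" using z by (simp add: btw_def dist_commute)
  then have "z = x" by auto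
  then show ?thesis using assms(3) by blast
next
  case False
  define l where "l = dist x z / dist x y"
  have "dist x z \<le> dist x y" using z zero_le_dist[of z y] unfolding btw_def by linarith
  then have l: "0 \<le> l" "l \<le> 1" and xz: "dist x z = l * dist x y"
    using False by (simp_all add: l_def divide_le_eq)
  obtain w where w: "btw x w (f y)" "dist x w = l * dist x (f y)"
    "dist w (f y) = dist x (f y) - l * dist x (f y)"
    by (rule btw_point[of "l * dist x (f y)" x "f y"]) (use l in \<open>auto simp: mult_left_le_one_le\<close>)
  have "dist z w \<le> l * dist y (f y)"
    using thales[OF z w(1) l xz w(2)] .
  moreover have "dist w (f z) \<le> (1 - l) * dist x (f x)"
  proof (rule thales[of "f y" w x "f z" "f x" "1 - l"])
    show "btw (f y) w x" using w(1) by (rule btw_sym)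
    show "btw (f y) (f z) (f x)" using z by (simp add: isometry_btw[OF f] btw_sym)
    have "dist (f y) w = dist w (f y)" "dist (f y) x = dist x (f y)" by (rule dist_commute)+
    then show "dist (f y) w = (1 - l) * dist (f y) x" using w(3) by (simp only: left_diff_distrib mult_1)
    have "dist (f y) (f z) = dist z y" "dist (f y) (f x) = dist x y"
      by (simp_all only: isometry_dist[OF f] dist_commute)
    moreover have "dist z y = (1 - l) * dist x y" using z xz by (simp only: btw_def left_diff_distrib mult_1)
    ultimately show "dist (f y) (f z) = (1 - l) * dist (f y) (f x)" by simp
  qed (use l in auto)
  moreover have "dist z (f z) \<le> dist z w + dist w (f z)" by (rule dist_triangle)
  ultimately have "dist z (f z) \<le> l * dist y (f y) + (1 - l) * dist x (f x)" by linarith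
  also have "\<dots> \<le> l * c + (1 - l) * c" using assms l by (intro add_mono mult_left_mono) auto
  finally show ?thesis by (simp add: algebra_simps)
qed

end

section \<open>Projections to contracting lines\<close>

text \<open>The parameter of the nearest point of the line \<open>\<gamma>\<close>; it is unique in a CAT(0) space.\<close>

definition coord :: "(real \<Rightarrow> 'a::metric_space) \<Rightarrow> 'a \<Rightarrow> real" where
  "coord \<gamma> x = (SOME s. \<forall>t. dist x (\<gamma> s) \<le> dist x (\<gamma> t))"

lemma geodesic_line_dist: "geodesic_line \<gamma> \<Longrightarrow> dist (\<gamma> s) (\<gamma> t) = \<bar>s - t\<bar>"
  by (simp add: geodesic_line_def)

lemma nearest_point_exists:
  fixes \<gamma> :: "real \<Rightarrow> 'a::metric_space"
  assumes \<gamma>: "geodesic_line \<gamma>"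
  shows "\<exists>s. \<forall>t. dist x (\<gamma> s) \<le> dist x (\<gamma> t)"
proof -
  \<comment> \<open>Beyond |t| = M the point \<open>\<gamma> t\<close> is farther from x than
    \<open>\<gamma> 0\<close>, so the minimum over a compact interval is global.\<close>
  define M where "M = 2 * dist x (\<gamma> 0)"
  have "\<bar>dist x (\<gamma> s) - dist x (\<gamma> t)\<bar> \<le> \<bar>s - t\<bar>" for s t
    using dist_triangle[of x "\<gamma> s" "\<gamma> t"] dist_triangle[of x "\<gamma> t" "\<gamma> s"]
      geodesic_line_dist[OF \<gamma>, of s t] by (simp add: dist_commute)
  then have "continuous_on {-M..M} (\<lambda>s. dist x (\<gamma> s))"
    unfolding continuous_on_iff dist_real_def by (meson le_less_trans)
  moreover have "M \<ge> 0" by (simp add: M_def)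
  ultimately obtain s where s: "s \<in> {-M..M}" "\<And>t. t \<in> {-M..M} \<Longrightarrow> dist x (\<gamma> s) \<le> dist x (\<gamma> t)"
    using continuous_attains_inf[of "{-M..M}" "\<lambda>s. dist x (\<gamma> s)"] by auto
  have "dist x (\<gamma> s) \<le> dist x (\<gamma> t)" for t
  proof (cases "t \<in> {-M..M}")
    case False
    have "\<bar>t\<bar> = dist (\<gamma> t) (\<gamma> 0)" using geodesic_line_dist[OF \<gamma>, of t 0] by simp
    also have "\<dots> \<le> dist x (\<gamma> t) + dist x (\<gamma> 0)" by (metis dist_commute dist_triangle)
    finally have "dist x (\<gamma> 0) \<le> dist x (\<gamma> t)" using False by (auto simp: M_def)
    then show ?thesis using s(2)[of 0] \<open>M \<ge> 0\<close> by auto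
  qed (use s in auto)
  then show ?thesis by blast
qed

lemma coord_le: "geodesic_line \<gamma> \<Longrightarrow> dist x (\<gamma> (coord \<gamma> x)) \<le> dist x (\<gamma> t)"
  unfolding coord_def using someI_ex[OF nearest_point_exists] by blast

lemma coord_close:
  assumes "geodesic_line \<gamma>" shows "\<bar>coord \<gamma> x - t\<bar> \<le> 2 * dist x (\<gamma> t)"
proof -
  have "\<bar>coord \<gamma> x - t\<bar> \<le> dist x (\<gamma> (coord \<gamma> x)) + dist x (\<gamma> t)"
    using geodesic_line_dist[OF assms, of "coord \<gamma> x" t] dist_triangle2[of "\<gamma> (coord \<gamma> x)" "\<gamma> t" x]
    by (simp add: dist_commute)
  then show ?thesis using coord_le[OF assms, of x t] by linarith
qed

definition contracting_line :: "real \<Rightarrow> (real \<Rightarrow> 'a::metric_space) \<Rightarrow> bool" where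
  "contracting_line C \<gamma> \<longleftrightarrow> geodesic_line \<gamma> \<and> 0 < C \<and> contracting_set C (range \<gamma>)"

text \<open>The open ball about x that touches the line is disjoint from it and contains y.\<close>

lemma contracting_line_ball:
  assumes \<gamma>: "contracting_line C \<gamma>" and xy: "dist x y < dist x (\<gamma> (coord \<gamma> x))"
  shows "\<bar>coord \<gamma> x - coord \<gamma> y\<bar> \<le> C"
proof -
  have g: "geodesic_line \<gamma>" using \<gamma> by (simp add: contracting_line_def)
  let ?r = "dist x (\<gamma> (coord \<gamma> x))" and ?N = "nearest_points (range \<gamma>) (ball x (dist x (\<gamma> (coord \<gamma> x))))"
  have "\<not> dist x (\<gamma> t) < ?r" for t using coord_le[OF g, of x t] by simp
  then have "ball x ?r \<inter> range \<gamma> = {}" by auto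
  then have "bounded ?N" "diameter ?N \<le> C"
    using \<gamma> by (auto simp: contracting_line_def contracting_set_def)
  moreover have "\<gamma> (coord \<gamma> z) \<in> ?N" if "dist x z < ?r" for z
    unfolding nearest_points_def using that coord_le[OF g, of z] by (auto intro!: bexI[of _ z])
  moreover have "dist x x < ?r" using xy by (metis dist_self le_less_trans zero_le_dist)
  ultimately have "dist (\<gamma> (coord \<gamma> x)) (\<gamma> (coord \<gamma> y)) \<le> C"
    using xy by (meson diameter_bounded_bound order_trans)
  then show ?thesis by (simp add: geodesic_line_dist[OF g])
qed

lemma geodesic_line_reverse: "geodesic_line \<gamma> \<Longrightarrow> geodesic_line (\<lambda>s. \<gamma> (- s))"
  by (auto simp: geodesic_line_def)

lemma range_reverse: "range (\<lambda>s. \<gamma> (- s)) = range (\<gamma> :: real \<Rightarrow> 'a)"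
proof -
  have "\<gamma> s \<in> range (\<lambda>s. \<gamma> (- s))" for s by (rule range_eqI[of _ _ "- s"]) simp
  then show ?thesis by auto
qed

lemma contracting_line_reverse: "contracting_line C \<gamma> \<Longrightarrow> contracting_line C (\<lambda>s. \<gamma> (- s))"
  by (simp add: contracting_line_def geodesic_line_reverse range_reverse)

context cat0
begin

text \<open>Comparison with the midpoint of \<open>\<gamma> s\<close> and \<open>\<gamma> t\<close>
  by \<open>CN\<close>. This strong convexity yields both the uniqueness of the nearest point and
  the continuity of the projection.\<close>

lemma coord_strong:
  fixes \<gamma> :: "real \<Rightarrow> 'a"
  assumes \<gamma>: "geodesic_line \<gamma>"
    and min: "\<And>u. dist x (\<gamma> s) \<le> dist x (\<gamma> u)"
  shows "(dist x (\<gamma> s))\<^sup>2 + (t - s)\<^sup>2 / 2 \<le> (dist x (\<gamma> t))\<^sup>2"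
proof -
  let ?m = "\<gamma> ((s + t) / 2)"
  have m: "dist (\<gamma> s) ?m = dist (\<gamma> s) (\<gamma> t) / 2" "dist ?m (\<gamma> t) = dist (\<gamma> s) (\<gamma> t) / 2"
    unfolding geodesic_line_dist[OF \<gamma>] by (simp_all add: field_simps abs_if)
  have "(dist x (\<gamma> s))\<^sup>2 \<le> (dist x ?m)\<^sup>2" using min by (simp add: power_mono)
  also have "\<dots> \<le> (dist x (\<gamma> s))\<^sup>2 / 2 + (dist x (\<gamma> t))\<^sup>2 / 2 - (dist (\<gamma> s) (\<gamma> t))\<^sup>2 / 4"
    by (rule CN[OF m])
  also have "(dist (\<gamma> s) (\<gamma> t))\<^sup>2 = (t - s)\<^sup>2"
    unfolding geodesic_line_dist[OF \<gamma>] by (simp add: power2_commute)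
  finally show ?thesis by simp
qed

lemma coord_unique:
  fixes \<gamma> :: "real \<Rightarrow> 'a"
  assumes \<gamma>: "geodesic_line \<gamma>" and min: "\<And>t. dist x (\<gamma> s) \<le> dist x (\<gamma> t)"
  shows "coord \<gamma> x = s"
proof -
  have "(dist x (\<gamma> s))\<^sup>2 + (coord \<gamma> x - s)\<^sup>2 / 2 \<le> (dist x (\<gamma> (coord \<gamma> x)))\<^sup>2"
    by (rule coord_strong[OF \<gamma> min])
  also have "\<dots> \<le> (dist x (\<gamma> s))\<^sup>2" using coord_le[OF \<gamma>] by (simp add: power_mono)
  finally show ?thesis by simp
qed

lemma coord_isometry:
  fixes \<gamma> :: "real \<Rightarrow> 'a"
  assumes "geodesic_line \<gamma>" "isometry f"
  shows "coord (f \<circ> \<gamma>) (f x) = coord \<gamma> x"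
  by (rule coord_unique) (use assms coord_le in \<open>auto simp: geodesic_line_def isometry_dist\<close>)

lemma coord_translation:
  fixes \<gamma> :: "real \<Rightarrow> 'a"
  assumes \<gamma>: "geodesic_line \<gamma>" and f: "isometry f" and t: "\<And>s. f (\<gamma> s) = \<gamma> (s + \<tau>)"
  shows "coord \<gamma> (f x) = coord \<gamma> x + \<tau>"
proof (rule coord_unique[OF \<gamma>])
  fix u
  have "dist (f x) (\<gamma> (coord \<gamma> x + \<tau>)) = dist x (\<gamma> (coord \<gamma> x))"
    by (simp add: t[symmetric] isometry_dist[OF f])
  also have "\<dots> \<le> dist x (\<gamma> (u - \<tau>))" by (rule coord_le[OF \<gamma>])
  also have "\<dots> = dist (f x) (\<gamma> u)" using t[of "u - \<tau>"] isometry_dist[OF f, of x "\<gamma> (u - \<tau>)"] by simp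
  finally show "dist (f x) (\<gamma> (coord \<gamma> x + \<tau>)) \<le> dist (f x) (\<gamma> u)" .
qed

lemma coord_reverse:
  fixes \<gamma> :: "real \<Rightarrow> 'a"
  assumes "geodesic_line \<gamma>" shows "coord (\<lambda>s. \<gamma> (- s)) x = - coord \<gamma> x"
  by (rule coord_unique[OF geodesic_line_reverse[OF assms]]) (simp add: coord_le[OF assms])

lemma coord_between:
  fixes \<gamma> :: "real \<Rightarrow> 'a"
  assumes \<gamma>: "geodesic_line \<gamma>" and "btw x u (\<gamma> (coord \<gamma> x))"
  shows "coord \<gamma> u = coord \<gamma> x"
proof (rule coord_unique[OF \<gamma>])
  fix t
  show "dist u (\<gamma> (coord \<gamma> x)) \<le> dist u (\<gamma> t)"
    using assms coord_le[OF \<gamma>, of x t] dist_triangle[of x "\<gamma> t" u] by (simp add: btw_def)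
qed

text \<open>The nearest point for y almost minimises the distance from x, so
  \<open>coord_strong\<close> bounds the square of the change of \<open>coord\<close> by a quantity
  that vanishes with dist y x. The intermediate value theorem in \<open>passes_near\<close> relies
  on this.\<close>

lemma coord_isCont:
  fixes \<gamma> :: "real \<Rightarrow> 'a"
  assumes \<gamma>: "geodesic_line \<gamma>" shows "isCont (coord \<gamma>) x"
proof -
  let ?a = "dist x (\<gamma> (coord \<gamma> x))"
  have est: "(coord \<gamma> y - coord \<gamma> x)\<^sup>2 \<le> 8 * dist y x * (dist y x + ?a)" for y
  proof -
    let ?d = "dist y x"
    have 1: "?a\<^sup>2 + (coord \<gamma> y - coord \<gamma> x)\<^sup>2 / 2 \<le> (dist x (\<gamma> (coord \<gamma> y)))\<^sup>2"
      by (rule coord_strong[OF \<gamma> coord_le[OF \<gamma>]])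
    have "dist x (\<gamma> (coord \<gamma> y)) \<le> ?d + dist y (\<gamma> (coord \<gamma> y))" by (metis dist_commute dist_triangle)
    also have "dist y (\<gamma> (coord \<gamma> y)) \<le> dist y (\<gamma> (coord \<gamma> x))" by (rule coord_le[OF \<gamma>])
    also have "\<dots> \<le> ?d + ?a" by (rule dist_triangle)
    finally have "(dist x (\<gamma> (coord \<gamma> y)))\<^sup>2 \<le> (?d + (?d + ?a))\<^sup>2" by (simp add: power_mono)
    have "B \<le> 2 * (T - A)" if "A + B / 2 \<le> S" "S \<le> T" for A B S T :: real
      using that by simp
    from this[OF 1 \<open>(dist x (\<gamma> (coord \<gamma> y)))\<^sup>2 \<le> (?d + (?d + ?a))\<^sup>2\<close>]
    have "(coord \<gamma> y - coord \<gamma> x)\<^sup>2 \<le> 2 * ((?d + (?d + ?a))\<^sup>2 - ?a\<^sup>2)" .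
    also have "\<dots> = 8 * ?d * (?d + ?a)" by (simp add: power2_eq_square algebra_simps)
    finally show ?thesis .
  qed
  have "((\<lambda>y. (coord \<gamma> y - coord \<gamma> x)\<^sup>2) \<longlongrightarrow> 0) (at x)"
  proof (rule tendsto_sandwich[OF _ _ tendsto_const])
    have "((\<lambda>y. 8 * dist y x * (dist y x + ?a)) \<longlongrightarrow> 8 * dist x x * (dist x x + ?a)) (at x)"
      by (intro tendsto_intros)
    then show "((\<lambda>y. 8 * dist y x * (dist y x + ?a)) \<longlongrightarrow> 0) (at x)" by simp
  qed (use est in auto)
  then have "((\<lambda>y. coord \<gamma> y - coord \<gamma> x) \<longlongrightarrow> 0) (at x)" by simp
  then show ?thesis by (simp add: isCont_def LIM_zero_iff)
qed

text \<open>Points just before y on the geodesic from x lie in the open ball, and continuity of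
  \<open>coord\<close> passes the bound on to y.\<close>

lemma contracting_line_cball:
  fixes \<gamma> :: "real \<Rightarrow> 'a"
  assumes \<gamma>: "contracting_line C \<gamma>" and xy: "dist x y \<le> dist x (\<gamma> (coord \<gamma> x))"
  shows "\<bar>coord \<gamma> x - coord \<gamma> y\<bar> \<le> C"
proof (rule ccontr)
  assume n: "\<not> ?thesis"
  have g: "geodesic_line \<gamma>" using \<gamma> by (simp add: contracting_line_def)
  have "x \<noteq> y" using n \<gamma> by (auto simp: contracting_line_def)
  have "\<bar>coord \<gamma> x - coord \<gamma> y\<bar> - C > 0" using n by simp
  then obtain d where d: "d > 0"
    "\<And>z. dist z y < d \<Longrightarrow> \<bar>coord \<gamma> z - coord \<gamma> y\<bar> < \<bar>coord \<gamma> x - coord \<gamma> y\<bar> - C"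
    using coord_isCont[OF g, of y] unfolding continuous_at_eps_delta by (metis dist_real_def)
  define e where "e = min (d / 2) (dist x y)"
  have e: "0 < e" "e < d" "e \<le> dist x y" using d \<open>x \<noteq> y\<close> by (auto simp: e_def)
  obtain z where "btw x z y" "dist x z = dist x y - e" "dist z y = dist x y - (dist x y - e)"
    using btw_point[of "dist x y - e" x y] e by auto
  then have "\<bar>coord \<gamma> x - coord \<gamma> z\<bar> \<le> C" "dist z y < d"
    using e xy contracting_line_ball[OF \<gamma>, of x z] by auto
  then show False using d(2)[of z] by linarith
qed

text \<open>Take points of the geodesic that project exactly to s and to s + 4C. The balls about
  them that touch the line move the projection by at most C, so the gap between z and w still
  projects to length at least 2C. The gap itself has length at most 4C, by the triangle inequality
  through the line. Since its projection exceeds C, z lies within 4C of its own projection, which is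
  within C of \<open>\<gamma> s\<close>.\<close>

lemma passes_near:
  fixes \<gamma> :: "real \<Rightarrow> 'a"
  assumes \<gamma>: "contracting_line C \<gamma>" and x: "coord \<gamma> x \<le> s" and y: "s + 4 * C \<le> coord \<gamma> y"
  obtains z where "btw x z y" "dist z (\<gamma> s) \<le> 5 * C"
proof -
  have g: "geodesic_line \<gamma>" and C: "C > 0" using \<gamma> by (simp_all add: contracting_line_def)
  define l where "l = dist x y"
  have l: "l \<ge> 0" by (simp add: l_def)
  obtain \<sigma> :: "real \<Rightarrow> 'a" where \<sigma>: "\<sigma> 0 = x" "\<sigma> l = y"
    and iso: "\<And>s t. s \<in> {0..l} \<Longrightarrow> t \<in> {0..l} \<Longrightarrow> dist (\<sigma> s) (\<sigma> t) = \<bar>s - t\<bar>"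
    using geodesic_path[of x y] unfolding l_def by metis
  have "continuous_on {0..l} \<sigma>"
    unfolding continuous_on_iff using iso by (metis dist_real_def)
  moreover have "continuous_on (\<sigma> ` {0..l}) (coord \<gamma>)"
    using coord_isCont[OF g] by (simp add: continuous_at_imp_continuous_on)
  ultimately have cont: "continuous_on {0..l} (\<lambda>t. coord \<gamma> (\<sigma> t))"
    using continuous_on_compose[of "{0..l}" \<sigma> "coord \<gamma>"] by (simp add: o_def)
  obtain u where u: "0 \<le> u" "u \<le> l" "coord \<gamma> (\<sigma> u) = s"
    using IVT'[of "\<lambda>t. coord \<gamma> (\<sigma> t)" 0 s l] cont x y \<sigma> l C by auto
  have "continuous_on {u..l} (\<lambda>t. coord \<gamma> (\<sigma> t))" using cont u by (auto intro: continuous_on_subset)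
  then obtain v where v: "u \<le> v" "v \<le> l" "coord \<gamma> (\<sigma> v) = s + 4 * C"
    using IVT'[of "\<lambda>t. coord \<gamma> (\<sigma> t)" u "s + 4 * C" l] u y \<sigma> C by auto
  define \<alpha> \<beta> where "\<alpha> = dist (\<sigma> u) (\<gamma> s)" and "\<beta> = dist (\<sigma> v) (\<gamma> (s + 4 * C))"
  have nonneg: "\<alpha> \<ge> 0" "\<beta> \<ge> 0" by (simp_all add: \<alpha>_def \<beta>_def)
  have near_u: "\<bar>s - coord \<gamma> (\<sigma> t)\<bar> \<le> C" if "u \<le> t" "t \<le> v" "t - u \<le> \<alpha>" for t
    using contracting_line_cball[OF \<gamma>, of "\<sigma> u" "\<sigma> t"] iso[of u t] that u v by (simp add: \<alpha>_def)
  have near_v: "\<bar>s + 4 * C - coord \<gamma> (\<sigma> t)\<bar> \<le> C" if "u \<le> t" "t \<le> v" "v - t \<le> \<beta>" for t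
    using contracting_line_cball[OF \<gamma>, of "\<sigma> v" "\<sigma> t"] iso[of v t] that u v by (simp add: \<beta>_def)
  have len: "v - u \<le> \<alpha> + 4 * C + \<beta>"
  proof -
    have "v - u = dist (\<sigma> u) (\<sigma> v)" using iso[of u v] u v by simp
    also have "\<dots> \<le> dist (\<sigma> u) (\<gamma> s) + (dist (\<gamma> s) (\<gamma> (s + 4 * C)) + dist (\<gamma> (s + 4 * C)) (\<sigma> v))"
      by (meson add_left_mono dist_triangle order_trans)
    finally show ?thesis using geodesic_line_dist[OF g, of s "s + 4 * C"] C
      by (simp add: \<alpha>_def \<beta>_def dist_commute)
  qed
  \<comment> \<open>The balls about the two ends that touch the line would otherwise cover the segment, and each of
    them projects to a set of diameter at most \<open>C\<close>.\<close>
  have far: "\<alpha> + \<beta> < v - u"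
  proof (rule ccontr)
    assume a: "\<not> ?thesis"
    define t where "t = min v (u + \<alpha>)"
    have "\<bar>s - coord \<gamma> (\<sigma> t)\<bar> \<le> C" "\<bar>s + 4 * C - coord \<gamma> (\<sigma> t)\<bar> \<le> C"
      using near_u[of t] near_v[of t] a v nonneg by (auto simp: t_def min_def split: if_splits)
    then show False using C by linarith
  qed
  define z w where "z = \<sigma> (u + \<alpha>)" and "w = \<sigma> (v - \<beta>)"
  have pz: "\<bar>s - coord \<gamma> z\<bar> \<le> C" using near_u[of "u + \<alpha>"] far nonneg by (simp add: z_def)
  have pw: "\<bar>s + 4 * C - coord \<gamma> w\<bar> \<le> C" using near_v[of "v - \<beta>"] far nonneg by (simp add: w_def)
  have "dist z w \<le> 4 * C"
    using iso[of "u + \<alpha>" "v - \<beta>"] len far nonneg u v by (simp add: z_def w_def)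
  then have "dist z (\<gamma> (coord \<gamma> z)) \<le> 4 * C"
    using contracting_line_cball[OF \<gamma>, of z w] pz pw C by (cases "dist z w \<le> dist z (\<gamma> (coord \<gamma> z))") auto
  moreover have "dist (\<gamma> (coord \<gamma> z)) (\<gamma> s) \<le> C" using pz by (simp add: geodesic_line_dist[OF g] abs_minus_commute)
  ultimately have "dist z (\<gamma> s) \<le> 5 * C" using dist_triangle[of z "\<gamma> s" "\<gamma> (coord \<gamma> z)"] by linarith
  moreover have "btw x z y"
    using iso[of 0 "u + \<alpha>"] iso[of "u + \<alpha>" l] \<sigma> far nonneg u v unfolding btw_def z_def l_def[symmetric] by auto
  ultimately show ?thesis using that by blast
qed

text \<open>A geodesic that dips below t passes within 5C of \<open>\<gamma> t\<close> on both sides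
  of z. The two passages are at most 10C apart, so z is within 15C of \<open>\<gamma> t\<close>, and
  \<open>coord_close\<close> doubles this.\<close>

lemma halfspace_quasiconvex:
  fixes \<gamma> :: "real \<Rightarrow> 'a"
  assumes \<gamma>: "contracting_line C \<gamma>" and "coord \<gamma> x \<ge> t + 4 * C" "coord \<gamma> y \<ge> t + 4 * C" and z: "btw x z y"
  shows "coord \<gamma> z \<ge> t - 30 * C"
proof (cases "coord \<gamma> z \<le> t")
  case True
  have g: "geodesic_line \<gamma>" and C: "C > 0" using \<gamma> by (simp_all add: contracting_line_def)
  obtain u where u: "btw z u x" "dist u (\<gamma> t) \<le> 5 * C" using passes_near[OF \<gamma> True assms(2)] .
  obtain w where w: "btw z w y" "dist w (\<gamma> t) \<le> 5 * C" using passes_near[OF \<gamma> True assms(3)] .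
  have "btw u z y" using btw_left[OF z btw_sym[OF u(1)]] by blast
  then have "btw u z w" using btw_right w(1) by blast
  then have "dist u z \<le> dist u w" using zero_le_dist[of z w] unfolding btw_def by linarith
  also have "\<dots> \<le> 10 * C" using dist_triangle2[of u w "\<gamma> t"] u w by linarith
  finally have "dist z (\<gamma> t) \<le> 15 * C" using dist_triangle[of z "\<gamma> t" u] u by (simp add: dist_commute)
  then show ?thesis using coord_close[OF g, of z t] by linarith
qed (use \<gamma> in \<open>auto simp: contracting_line_def\<close>)

text \<open>If a is not in the ball about u that touches the line, then u is within 5C of the line
  and a within 10C of the projection of u, and \<open>coord_close\<close> gives 20C.\<close>

lemma coord_coarse_lipschitz:
  fixes \<gamma> :: "real \<Rightarrow> 'a"
  assumes \<gamma>: "contracting_line C \<gamma>" and "dist u a \<le> 5 * C"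
  shows "\<bar>coord \<gamma> u - coord \<gamma> a\<bar> \<le> 20 * C"
proof (cases "dist u a \<le> dist u (\<gamma> (coord \<gamma> u))")
  case True
  then show ?thesis using contracting_line_cball[OF \<gamma> True] \<gamma> by (auto simp: contracting_line_def)
next
  case False
  have "geodesic_line \<gamma>" using \<gamma> by (simp add: contracting_line_def)
  then have "\<bar>coord \<gamma> a - coord \<gamma> u\<bar> \<le> 2 * dist a (\<gamma> (coord \<gamma> u))" by (rule coord_close)
  moreover have "dist a (\<gamma> (coord \<gamma> u)) \<le> dist u a + dist u (\<gamma> (coord \<gamma> u))" by (metis dist_commute dist_triangle)
  ultimately show ?thesis using False assms by linarith
qed

text \<open>Behrstock's inequality: a point cannot project far out on both lines. The geodesic from
  x to its projection on \<beta> starts far out on \<alpha> and ends where the coordinate on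
  \<alpha> is at most T, so it must pass near \<open>\<alpha> T\<close>.\<close>

lemma behrstock_pos:
  fixes \<alpha> \<beta> :: "real \<Rightarrow> 'a"
  assumes \<alpha>: "contracting_line C \<alpha>" and \<beta>: "contracting_line C \<beta>"
    and T: "\<And>s. \<bar>coord \<alpha> (\<beta> s)\<bar> \<le> T" "\<And>s. \<bar>coord \<beta> (\<alpha> s)\<bar> \<le> T" and x: "coord \<alpha> x \<ge> T + 4 * C"
  shows "\<bar>coord \<beta> x\<bar> \<le> T + 20 * C"
proof -
  have g: "geodesic_line \<beta>" using \<beta> by (simp add: contracting_line_def)
  have "coord \<alpha> (\<beta> (coord \<beta> x)) \<le> T" using T(1)[of "coord \<beta> x"] by linarith
  then obtain u where u: "btw (\<beta> (coord \<beta> x)) u x" "dist u (\<alpha> T) \<le> 5 * C"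
    using passes_near[OF \<alpha> _ x] by blast
  \<comment> \<open>\<open>u\<close> lies on the geodesic from \<open>x\<close> to its projection and is close to \<open>\<alpha>\<close>.\<close>
  have "coord \<beta> u = coord \<beta> x" using coord_between[OF g btw_sym[OF u(1)]] .
  then have "\<bar>coord \<beta> x - coord \<beta> (\<alpha> T)\<bar> \<le> 20 * C" using coord_coarse_lipschitz[OF \<beta> u(2)] by simp
  then show ?thesis using T(2)[of T] by linarith
qed

lemma behrstock:
  fixes \<alpha> \<beta> :: "real \<Rightarrow> 'a"
  assumes \<alpha>: "contracting_line C \<alpha>" and \<beta>: "contracting_line C \<beta>"
    and T: "\<And>s. \<bar>coord \<alpha> (\<beta> s)\<bar> \<le> T" "\<And>s. \<bar>coord \<beta> (\<alpha> s)\<bar> \<le> T" and x: "\<bar>coord \<alpha> x\<bar> \<ge> T + 4 * C"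
  shows "\<bar>coord \<beta> x\<bar> \<le> T + 20 * C"
proof (cases "coord \<alpha> x \<ge> 0")
  case True then show ?thesis using behrstock_pos[OF assms(1-4), of x] x by auto
next
  case False
  have g: "geodesic_line \<alpha>" using \<alpha> by (simp add: contracting_line_def)
  show ?thesis
    by (rule behrstock_pos[OF contracting_line_reverse[OF \<alpha>] \<beta>])
      (use T x False in \<open>auto simp: coord_reverse[OF g]\<close>)
qed

end

section \<open>A criterion for contracting isometries\<close>

text \<open>Isometries are plain functions here and not elements of a group. The link with integer
  powers in G is made in \<open>act_int_pow\<close>.\<close>

definition zpow :: "('a \<Rightarrow> 'a) \<Rightarrow> int \<Rightarrow> 'a \<Rightarrow> 'a" where
  "zpow f k = (if 0 \<le> k then f ^^ nat k else inv_into UNIV f ^^ nat (- k))"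

lemma zpow_0 [simp]: "zpow f 0 x = x"
  by (simp add: zpow_def)

lemma zpow_of_nat: "zpow f (int n) = f ^^ n"
  by (simp add: zpow_def)

lemma zpow_succ:
  assumes "isometry f" shows "zpow f (k + 1) x = f (zpow f k x)"
proof (cases "0 \<le> k")
  case True
  then have "nat (k + 1) = Suc (nat k)" by simp
  then show ?thesis using True by (simp add: zpow_def)
next
  case False
  then have n: "nat (- k) = Suc (nat (- (k + 1)))" by simp
  have "f (zpow f k x) = (inv_into UNIV f ^^ nat (- (k + 1))) x"
    using False by (simp only: zpow_def n) (simp add: isometry_inv_simps[OF assms])
  also have "\<dots> = zpow f (k + 1) x" using False by (cases "k = -1") (auto simp: zpow_def)
  finally show ?thesis by simp
qed

lemma zpow_pred:
  assumes "isometry f" shows "zpow f (k - 1) x = inv_into UNIV f (zpow f k x)"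
  using zpow_succ[OF assms, of "k - 1" x] by (simp add: isometry_inv_simps[OF assms])

lemma zpow_add:
  assumes "isometry f" shows "zpow f (j + k) x = zpow f j (zpow f k x)"
proof (induction j rule: int_induct[where k = 0])
  case (step1 i)
  have "zpow f (i + 1 + k) x = zpow f ((i + k) + 1) x" by (simp add: algebra_simps)
  then show ?case using step1 by (simp only: zpow_succ[OF assms])
next
  case (step2 i)
  have "zpow f (i - 1 + k) x = zpow f ((i + k) - 1) x" by (simp add: algebra_simps)
  then show ?case using step2 by (simp only: zpow_pred[OF assms])
qed simp

lemma zpow_1 [simp]: "isometry f \<Longrightarrow> zpow f 1 x = f x"
  using zpow_succ[of f 0 x] by simp

lemma isometry_zpow: "isometry f \<Longrightarrow> isometry (zpow f k)"
  by (simp add: zpow_def isometry_funpow isometry_inv)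

lemma zpow_commute: "isometry f \<Longrightarrow> zpow f k (f x) = f (zpow f k x)"
  using zpow_add[of f k 1 x] zpow_succ[of f k x] by simp

lemma inv_inv_isometry: "isometry f \<Longrightarrow> inv_into UNIV (inv_into UNIV f) = f"
  by (simp add: inv_inv_eq isometry_bij)

lemma zpow_inv:
  assumes "isometry f" shows "zpow (inv_into UNIV f) k = zpow f (- k)"
proof -
  have "0 \<le> - k \<Longrightarrow> \<not> 0 \<le> k \<or> k = 0" by linarith
  then show ?thesis by (auto simp: zpow_def inv_inv_isometry[OF assms])
qed

definition gate :: "real \<Rightarrow> 'a::metric_space \<Rightarrow> 'a set \<Rightarrow> 'a set \<Rightarrow> bool" where
  "gate D p U V \<longleftrightarrow> (\<forall>x\<in>U. \<forall>y\<in>V. \<exists>z. btw x z y \<and> dist z p \<le> D)"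

lemma gate_sym: "gate D p U V \<Longrightarrow> gate D p V U"
  unfolding gate_def using btw_sym by blast

section \<open>Minimal displacement and axes\<close>

context cat0
begin

lemma btw_unique:
  fixes p q x y :: 'a
  assumes "btw p x q" "btw p y q" "dist p x = dist p y"
  shows "x = y"
proof (cases "p = q")
  case True
  then have "dist p x + dist p x = 0" "dist p y + dist p y = 0"
    using assms(1,2) by (simp_all add: btw_def dist_commute)
  then show ?thesis by auto
next
  case False
  define l where "l = dist p x / dist p q"
  have "dist p x \<le> dist p q" using assms(1) zero_le_dist[of x q] unfolding btw_def by linarith
  then have "0 \<le> l" "l \<le> 1" "dist p x = l * dist p q"
    using False by (simp_all add: l_def divide_le_eq)
  then have "dist x y \<le> l * dist q q" using thales[OF assms(1,2)] assms(3) by simp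
  then show ?thesis by simp
qed

text \<open>Substitute for compactness of bounded sets. Points \<open>x n\<close> that nearly
  realise the distance from p to \<open>K n\<close> form a Cauchy sequence: these distances increase
  to a limit, and near-minimisers in a convex set are close together by \<open>CN\<close>.\<close>

lemma nested_convex_point:
  fixes K :: "nat \<Rightarrow> 'a set"
  assumes dec: "\<And>m n. m \<le> n \<Longrightarrow> K n \<subseteq> K m" and closed: "\<And>n. closed (K n)"
    and convex: "\<And>n x y z. x \<in> K n \<Longrightarrow> y \<in> K n \<Longrightarrow> btw x z y \<Longrightarrow> z \<in> K n"
    and near: "\<And>n. \<exists>z\<in>K n. dist p z \<le> D"
  shows "\<exists>z. \<forall>n. z \<in> K n"
proof -
  define r where "r n = infdist p (K n)" for n
  have ne: "K n \<noteq> {}" for n using near by auto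
  have rle: "r n \<le> dist p z" if "z \<in> K n" for n z unfolding r_def using that by (rule infdist_le)
  have r0: "0 \<le> r n" for n by (simp add: r_def infdist_nonneg)
  have rD: "r n \<le> D" for n using near[of n] rle by (meson order_trans)
  have "incseq r" unfolding incseq_def r_def using dec ne by (simp add: infdist_mono)
  then obtain R where R: "r \<longlonglongrightarrow> R" using rD incseq_convergent by blast
  have "\<exists>z\<in>K n. dist p z < r n + 1 / real (Suc n)" for n
  proof -
    have "(INF a\<in>K n. dist p a) < r n + 1 / real (Suc n)"
      using ne by (simp add: r_def infdist_def)
    then show ?thesis using cINF_less_iff[of "K n" "dist p"] ne by (auto intro!: bdd_belowI2[where m = 0])
  qed
  then obtain x where x: "\<And>n. x n \<in> K n" "\<And>n. dist p (x n) < r n + 1 / real (Suc n)" by metis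
  have d: "(\<lambda>n. dist p (x n)) \<longlonglongrightarrow> R"
  proof (rule tendsto_sandwich[where f = r])
    show "(\<lambda>n. r n + 1 / real (Suc n)) \<longlonglongrightarrow> R"
      using tendsto_add[OF R LIMSEQ_inverse_real_of_nat] by (simp add: inverse_eq_divide)
    show "\<forall>\<^sub>F n in sequentially. dist p (x n) \<le> r n + 1 / real (Suc n)"
      using x(2) by (intro always_eventually allI less_imp_le)
  qed (use R x rle in auto)
  have key: "(dist (x m) (x n))\<^sup>2 \<le> 2 * (dist p (x m))\<^sup>2 + 2 * (dist p (x n))\<^sup>2 - 4 * (r m)\<^sup>2"
    if "m \<le> n" for m n
  proof -
    \<comment> \<open>The midpoint lies in the convex set \<open>K m\<close>, so it is no nearer to
      p than \<open>r m\<close>.\<close>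
    obtain z where z: "btw (x m) z (x n)" "dist (x m) z = dist (x m) (x n) / 2"
      "dist z (x n) = dist (x m) (x n) - dist (x m) (x n) / 2"
      by (rule btw_point[of "dist (x m) (x n) / 2" "x m" "x n"]) auto
    have "x n \<in> K m" using dec that x by blast
    then have "r m \<le> dist p z" using convex[OF x(1) _ z(1)] rle by blast
    then have "(r m)\<^sup>2 \<le> (dist p z)\<^sup>2" using r0 by (rule power_mono)
    also have "\<dots> \<le> (dist p (x m))\<^sup>2 / 2 + (dist p (x n))\<^sup>2 / 2 - (dist (x m) (x n))\<^sup>2 / 4"
      by (rule CN) (use z in auto)
    finally show ?thesis by simp
  qed
  have "Cauchy x"
  proof (rule metric_CauchyI)
    fix e :: real assume "e > 0"
    then have e: "e\<^sup>2 / 8 > 0" by simp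
    have "(\<lambda>n. (dist p (x n))\<^sup>2) \<longlonglongrightarrow> R\<^sup>2" "(\<lambda>n. (r n)\<^sup>2) \<longlonglongrightarrow> R\<^sup>2" by (intro tendsto_intros d R)+
    then obtain N where N: "\<And>n. n \<ge> N \<Longrightarrow> \<bar>(dist p (x n))\<^sup>2 - R\<^sup>2\<bar> < e\<^sup>2 / 8"
      "\<And>n. n \<ge> N \<Longrightarrow> \<bar>(r n)\<^sup>2 - R\<^sup>2\<bar> < e\<^sup>2 / 8"
      using e unfolding lim_sequentially dist_real_def by (metis (no_types, lifting) max.boundedE nle_le)
    have *: "dist (x m) (x n) < e" if "N \<le> m" "m \<le> n" for m n
    proof -
      have "(dist (x m) (x n))\<^sup>2 < e\<^sup>2"
        using key[OF that(2)] N(1)[of m] N(1)[of n] N(2)[of m] that by linarith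
      then show ?thesis using \<open>e > 0\<close> by (simp add: power2_less_imp_less)
    qed
    show "\<exists>M. \<forall>m\<ge>M. \<forall>n\<ge>M. dist (x m) (x n) < e"
      using * by (metis dist_commute nle_le)
  qed
  then obtain z where z: "x \<longlonglongrightarrow> z" using Cauchy_convergent_iff convergent_def by blast
  have "z \<in> K m" for m
  proof (rule Lim_in_closed_set[OF closed _ _ z])
    show "\<forall>\<^sub>F n in sequentially. x n \<in> K m"
      using eventually_ge_at_top[of m] by eventually_elim (use x dec in blast)
  qed simp
  then show ?thesis by blast
qed

text \<open>With m the midpoint of y and f y, the points m and f m are the midpoints of the two
  sides issuing from f y in the triangle y, f y, f (f y).\<close>

lemma displacement_double:
  fixes f :: "'a \<Rightarrow> 'a"
  assumes f: "isometry f" and \<tau>: "\<And>y. \<tau> \<le> dist y (f y)"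
  shows "2 * \<tau> \<le> dist y (f (f y))"
proof -
  obtain m where m: "btw y m (f y)" "dist y m = dist y (f y) / 2" "dist m (f y) = dist y (f y) - dist y (f y) / 2"
    by (rule btw_point[of "dist y (f y) / 2" y "f y"]) auto
  have "dist m (f m) \<le> (1 / 2) * dist y (f (f y))"
  proof (rule thales)
    show "btw (f y) m y" using m(1) by (rule btw_sym)
    show "btw (f y) (f m) (f (f y))" using m(1) by (simp add: isometry_btw[OF f])
    show "dist (f y) m = 1 / 2 * dist (f y) y" using m(3) by (simp add: dist_commute)
    show "dist (f y) (f m) = 1 / 2 * dist (f y) (f (f y))" using m(2) by (simp add: isometry_dist[OF f])
  qed auto
  then show ?thesis using \<tau>[of m] by simp
qed

lemma displacement_power2:
  fixes f :: "'a \<Rightarrow> 'a"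
  assumes f: "isometry f" and \<tau>: "\<And>y. \<tau> \<le> dist y (f y)"
  shows "2 ^ k * \<tau> \<le> dist y ((f ^^ (2 ^ k)) y)"
proof (induction k arbitrary: y)
  case (Suc k)
  have "f ^^ 2 ^ Suc k = (f ^^ 2 ^ k) \<circ> (f ^^ 2 ^ k)" by (simp add: mult_2 funpow_add)
  then show ?case using displacement_double[OF isometry_funpow[OF f] Suc.IH, of y] by (simp add: mult.assoc)
qed (use \<tau> in simp)

lemma displacement_funpow_le:
  fixes f :: "'a \<Rightarrow> 'a"
  assumes f: "isometry f" shows "dist x ((f ^^ n) x) \<le> real n * dist x (f x)"
proof (induction n)
  case (Suc n)
  have "dist x ((f ^^ Suc n) x) \<le> dist x ((f ^^ n) x) + dist ((f ^^ n) x) ((f ^^ n) (f x))"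
    by (simp add: funpow_swap1 dist_triangle)
  also have "dist ((f ^^ n) x) ((f ^^ n) (f x)) = dist x (f x)" by (rule isometry_dist[OF isometry_funpow[OF f]])
  finally show ?case using Suc by (simp add: algebra_simps)
qed simp

text \<open>Doubling gives the lower bound only along powers of 2. For general n it is applied to N
  = 2^n: were the first n steps short, the remaining N - n steps could not make up for it.\<close>

lemma displacement_funpow:
  fixes f :: "'a \<Rightarrow> 'a"
  assumes f: "isometry f" and \<tau>: "\<And>y. dist x (f x) \<le> dist y (f y)"
  shows "dist x ((f ^^ n) x) = real n * dist x (f x)"
proof (rule antisym[OF displacement_funpow_le[OF f]])
  define N where "N = (2::nat) ^ n"
  have "n \<le> N" unfolding N_def by (rule less_imp_le[OF less_exp])
  then have N: "f ^^ N = (f ^^ n) \<circ> (f ^^ (N - n))" by (simp flip: funpow_add)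
  have "real N * dist x (f x) \<le> dist x ((f ^^ N) x)"
    using displacement_power2[OF f \<tau>, of n x] by (simp add: N_def)
  also have "\<dots> \<le> dist x ((f ^^ n) x) + dist ((f ^^ n) x) ((f ^^ n) ((f ^^ (N - n)) x))"
    by (simp add: N dist_triangle)
  also have "dist ((f ^^ n) x) ((f ^^ n) ((f ^^ (N - n)) x)) = dist x ((f ^^ (N - n)) x)"
    by (rule isometry_dist[OF isometry_funpow[OF f]])
  also have "\<dots> \<le> real (N - n) * dist x (f x)" by (rule displacement_funpow_le[OF f])
  finally show "real n * dist x (f x) \<le> dist x ((f ^^ n) x)"
    using \<open>n \<le> N\<close> by (simp add: of_nat_diff algebra_simps)
qed

text \<open>The segment from x to f x is translated by all powers of f. By
  \<open>displacement_funpow\<close> the distance of two orbit points equals the length of the path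
  between them, so the concatenation has no shortcut.\<close>

lemma axis_through_minimum:
  fixes f :: "'a \<Rightarrow> 'a"
  assumes f: "isometry f" and min: "\<And>y. dist x (f x) \<le> dist y (f y)" and pos: "dist x (f x) > 0"
  obtains \<gamma> where "geodesic_line \<gamma>" "\<And>s. f (\<gamma> s) = \<gamma> (s + dist x (f x))"
proof -
  define \<tau> where "\<tau> = dist x (f x)"
  have \<tau>: "\<tau> > 0" using pos by (simp add: \<tau>_def)
  obtain \<sigma> :: "real \<Rightarrow> 'a" where \<sigma>: "\<sigma> 0 = x" "\<sigma> \<tau> = f x"
    and iso: "\<And>s t. s \<in> {0..\<tau>} \<Longrightarrow> t \<in> {0..\<tau>} \<Longrightarrow> dist (\<sigma> s) (\<sigma> t) = \<bar>s - t\<bar>"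
    using geodesic_path[of x "f x"] unfolding \<tau>_def by metis
  define q where "q s = \<lfloor>s / \<tau>\<rfloor>" for s
  define \<rho> where "\<rho> s = s - \<tau> * q s" for s
  define \<gamma> where "\<gamma> s = zpow f (q s) (\<sigma> (\<rho> s))" for s
  have \<rho>: "0 \<le> \<rho> s" "\<rho> s < \<tau>" for s
  proof -
    have "real_of_int (q s) \<le> s / \<tau>" "s / \<tau> < real_of_int (q s) + 1" unfolding q_def by linarith+
    then have "real_of_int (q s) * \<tau> \<le> s" "s < (real_of_int (q s) + 1) * \<tau>"
      using \<tau> by (simp_all add: pos_le_divide_eq pos_divide_less_eq)
    then show "0 \<le> \<rho> s" "\<rho> s < \<tau>" by (simp_all add: \<rho>_def algebra_simps)
  qed
  have orbit: "dist (zpow f j x) (zpow f k x) = real_of_int (k - j) * \<tau>" if "j \<le> k" for j k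
  proof -
    have "zpow f k x = zpow f j (zpow f (k - j) x)" by (simp flip: zpow_add[OF f])
    then have "dist (zpow f j x) (zpow f k x) = dist x (zpow f (k - j) x)"
      by (simp add: isometry_dist[OF isometry_zpow[OF f]])
    also have "zpow f (k - j) = f ^^ nat (k - j)" using that by (simp add: zpow_def)
    also have "dist x ((f ^^ nat (k - j)) x) = real_of_int (k - j) * \<tau>"
      using displacement_funpow[OF f min, of "nat (k - j)"] that by (simp add: \<tau>_def)
    finally show ?thesis .
  qed
  have left: "dist (zpow f (q s) x) (\<gamma> s) = \<rho> s" for s
    using iso[of 0 "\<rho> s"] \<rho>[of s] \<sigma> \<tau> by (simp add: \<gamma>_def isometry_dist[OF isometry_zpow[OF f]])
  have right: "dist (\<gamma> s) (zpow f (q s + 1) x) = \<tau> - \<rho> s" for s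
    using iso[of "\<rho> s" \<tau>] \<rho>[of s] \<sigma> \<tau>
    by (simp add: \<gamma>_def zpow_succ[OF f] isometry_dist[OF isometry_zpow[OF f]] flip: zpow_commute[OF f])
  have le: "dist (\<gamma> s) (\<gamma> t) = t - s" if "s \<le> t" for s t
  proof (cases "q s = q t")
    case True
    then show ?thesis using iso[of "\<rho> s" "\<rho> t"] \<rho>[of s] \<rho>[of t] that
      by (simp add: \<gamma>_def isometry_dist[OF isometry_zpow[OF f]] \<rho>_def)
  next
    case False
    have "q s \<le> q t" unfolding q_def using that \<tau> by (simp add: floor_mono divide_right_mono)
    then have q: "q s + 1 \<le> q t" using False by simp
    have st: "s = \<rho> s + \<tau> * q s" "t = \<rho> t + \<tau> * q t" by (simp_all add: \<rho>_def)
    have "dist (\<gamma> s) (\<gamma> t) \<le> dist (\<gamma> s) (zpow f (q s + 1) x)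
        + (dist (zpow f (q s + 1) x) (zpow f (q t) x) + dist (zpow f (q t) x) (\<gamma> t))"
      by (meson add_left_mono dist_triangle order_trans)
    also have "\<dots> = t - s" unfolding right left orbit[OF q] by (subst (2) st(1), subst (2) st(2)) (simp add: algebra_simps)
    finally have 1: "dist (\<gamma> s) (\<gamma> t) \<le> t - s" .
    \<comment> \<open>Lower bound: the orbit points before \<open>\<gamma> s\<close> and after
      \<open>\<gamma> t\<close> enclose both, and their distance is known.\<close>
    have "dist (zpow f (q s) x) (zpow f (q t + 1) x) \<le> dist (zpow f (q s) x) (\<gamma> s)
        + (dist (\<gamma> s) (\<gamma> t) + dist (\<gamma> t) (zpow f (q t + 1) x))"
      by (meson add_left_mono dist_triangle order_trans)
    then have "real_of_int (q t + 1 - q s) * \<tau> \<le> \<rho> s + (dist (\<gamma> s) (\<gamma> t) + (\<tau> - \<rho> t))"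
      unfolding right left using orbit[of "q s" "q t + 1"] q by simp
    then have "t - s \<le> dist (\<gamma> s) (\<gamma> t)" by (subst st(1), subst st(2)) (simp add: algebra_simps)
    with 1 show ?thesis by simp
  qed
  have "geodesic_line \<gamma>"
    unfolding geodesic_line_def
  proof (intro allI)
    fix s t show "dist (\<gamma> s) (\<gamma> t) = \<bar>s - t\<bar>"
      using le[of s t] le[of t s] by (cases "s \<le> t") (simp_all add: dist_commute)
  qed
  moreover have "f (\<gamma> s) = \<gamma> (s + dist x (f x))" for s
  proof -
    have "q (s + \<tau>) = q s + 1" using \<tau> by (simp add: q_def add_divide_distrib)
    moreover from this have "\<rho> (s + \<tau>) = \<rho> s" by (simp add: \<rho>_def algebra_simps)
    ultimately show ?thesis by (simp add: \<gamma>_def zpow_succ[OF f] flip: \<tau>_def)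
  qed
  ultimately show ?thesis using that by blast
qed

end

lemma zpow_translation:
  fixes \<gamma> :: "real \<Rightarrow> 'a::metric_space"
  assumes f: "isometry f" and trans: "\<And>s. f (\<gamma> s) = \<gamma> (s + \<tau>)"
  shows "zpow f k (\<gamma> s) = \<gamma> (s + k * \<tau>)"
proof (induction k rule: int_induct[where k = 0])
  case (step1 i)
  have "s + real_of_int i * \<tau> + \<tau> = s + real_of_int (i + 1) * \<tau>" by (simp add: algebra_simps)
  then show ?case using step1 by (simp only: zpow_succ[OF f] trans)
next
  case (step2 i)
  have "inv_into UNIV f (\<gamma> s) = \<gamma> (s - \<tau>)" for s
    using trans[of "s - \<tau>"] isometry_inv_simps(2)[OF f, of "\<gamma> (s - \<tau>)"] by simp
  moreover have "s + real_of_int i * \<tau> - \<tau> = s + real_of_int (i - 1) * \<tau>" by (simp add: algebra_simps)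
  ultimately show ?case using step2 by (simp only: zpow_pred[OF f])
qed simp

lemma (in cat0) btw_line:
  fixes \<gamma> :: "real \<Rightarrow> 'a"
  assumes line: "geodesic_line \<gamma>" and ab: "a \<le> b" and z: "btw (\<gamma> a) z (\<gamma> b)"
  obtains r where "a \<le> r" "r \<le> b" "z = \<gamma> r"
proof -
  define r where "r = a + dist (\<gamma> a) z"
  have "dist (\<gamma> a) z \<le> dist (\<gamma> a) (\<gamma> b)"
    using z zero_le_dist[of z "\<gamma> b"] unfolding btw_def by linarith
  then have r: "a \<le> r" "r \<le> b" using ab by (simp_all add: r_def geodesic_line_dist[OF line])
  have "z = \<gamma> r"
  proof (rule btw_unique[OF z])
    show "btw (\<gamma> a) (\<gamma> r) (\<gamma> b)" using r by (simp add: btw_def geodesic_line_dist[OF line])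
    show "dist (\<gamma> a) z = dist (\<gamma> a) (\<gamma> r)" using r by (simp add: geodesic_line_dist[OF line]) (simp add: r_def)
  qed
  then show ?thesis using that r by blast
qed

text \<open>U is repelling and V attracting, with p at the bottleneck between them. Passing it loses
  at most 2D in the triangle inequality, so the margin 4D leaves a gain of 2D per step of the orbit
  of p.\<close>

locale north_south = cat0 ty for ty :: "'a::complete_space itself" +
  fixes f :: "'a \<Rightarrow> 'a" and p :: 'a and D :: real and U V :: "'a set"
  assumes f: "isometry f" and D: "D > 0" and gate: "gate D p U V"
    and farU: "x \<in> U \<Longrightarrow> dist p x > 4 * D" and farV: "x \<in> V \<Longrightarrow> dist p x > 4 * D"
    and map: "x \<notin> U \<Longrightarrow> f x \<in> V"
begin

lemma disjoint: "x \<in> U \<Longrightarrow> x \<notin> V"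
proof
  assume "x \<in> U" "x \<in> V"
  then obtain z where "btw x z x" "dist z p \<le> D" using gate unfolding gate_def by blast
  then have "dist z x + dist z x = 0" "dist z p \<le> D" by (simp_all add: btw_def dist_commute)
  then have "dist p x \<le> D" by (auto simp: dist_commute)
  then show False using farU[OF \<open>x \<in> U\<close>] D by linarith
qed

lemma inverse: "north_south ty (inv_into UNIV f) p D V U"
proof
  show "isometry (inv_into UNIV f)" by (rule isometry_inv[OF f])
  show "gate D p V U" by (rule gate_sym[OF gate])
  show "inv_into UNIV f x \<in> U" if "x \<notin> V" for x
    using map[of "inv_into UNIV f x"] that by (auto simp: isometry_inv_simps[OF f])
qed (use D farU farV in auto)

lemma p_notin: "p \<notin> U" "p \<notin> V"
  using farU[of p] farV[of p] D by auto

lemma forward_V: "x \<notin> U \<Longrightarrow> 0 < n \<Longrightarrow> (f ^^ n) x \<in> V"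
proof (induction n)
  case (Suc n)
  then have "(f ^^ n) x \<notin> U" using disjoint by (cases "n = 0") auto
  then show ?case using map by simp
qed simp

lemma zpow_V: "x \<notin> U \<Longrightarrow> 0 < k \<Longrightarrow> zpow f k x \<in> V"
  using forward_V[of x "nat k"] by (simp add: zpow_def)

lemma zpow_U: "x \<notin> V \<Longrightarrow> k < 0 \<Longrightarrow> zpow f k x \<in> U"
  using north_south.zpow_V[OF inverse, of x "- k"] by (simp add: zpow_inv[OF f])

text \<open>Translate by the power -k of f: the middle point becomes p, and the outer points land in
  U and V.\<close>

lemma orbit_superadditive:
  assumes "j < k" "k < l"
  shows "dist (zpow f j p) (zpow f k p) + dist (zpow f k p) (zpow f l p) - 2 * D
    \<le> dist (zpow f j p) (zpow f l p)"
proof -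
  have "zpow f (j - k) p \<in> U" "zpow f (l - k) p \<in> V"
    using zpow_U zpow_V p_notin assms by auto
  then obtain z where z: "btw (zpow f (j - k) p) z (zpow f (l - k) p)" "dist z p \<le> D"
    using gate unfolding gate_def by blast
  have shift: "dist (zpow f i p) (zpow f i' p) = dist (zpow f (i - k) p) (zpow f (i' - k) p)" for i i'
  proof -
    have "zpow f i p = zpow f k (zpow f (i - k) p)" for i by (simp flip: zpow_add[OF f])
    then show ?thesis by (metis isometry_dist isometry_zpow f)
  qed
  show ?thesis using dist_near_btw[OF z] unfolding shift[of j] shift[of k l] by simp
qed

lemma orbit_growth: "dist p ((f ^^ n) p) \<ge> 2 * D * real n"
proof (induction n)
  case (Suc n)
  have fp: "dist p (f p) > 4 * D" using farV[OF map[OF p_notin(1)]] .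
  show ?case
  proof (cases "n = 0")
    case True then show ?thesis using fp D by simp
  next
    case False
    have "dist p ((f ^^ n) p) + dist ((f ^^ n) p) ((f ^^ n) (f p)) - 2 * D \<le> dist p ((f ^^ n) (f p))"
      using orbit_superadditive[of 0 "int n" "int (Suc n)"] False
      unfolding zpow_of_nat by (simp add: funpow_swap1)
    moreover have "dist ((f ^^ n) p) ((f ^^ n) (f p)) = dist p (f p)"
      by (rule isometry_dist[OF isometry_funpow[OF f]])
    ultimately show ?thesis using Suc fp by (simp add: funpow_swap1 algebra_simps)
  qed
qed simp

text \<open>The orbits of x and of p stay at constant distance, and the latter escapes at speed at
  least 2D.\<close>

lemma displacement_ge: "dist x (f x) \<ge> 2 * D"
proof (rule ccontr)
  assume "\<not> ?thesis"
  then have "2 * D - dist x (f x) > 0" by simp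
  then obtain n :: nat where n: "real n * (2 * D - dist x (f x)) > 2 * dist p x"
    using reals_Archimedean3 by blast
  have "2 * D * real n \<le> dist p x + (dist x ((f ^^ n) x) + dist ((f ^^ n) x) ((f ^^ n) p))"
    using orbit_growth[of n] by (meson add_left_mono dist_triangle order_trans)
  also have "dist ((f ^^ n) x) ((f ^^ n) p) = dist p x"
    by (simp add: isometry_dist[OF isometry_funpow[OF f]] dist_commute)
  finally show False using displacement_funpow_le[OF f, of x n] n by (simp add: algebra_simps)
qed

text \<open>If the orbit of x stayed in U, the geodesic from \<open>(f ^^ n) x\<close> to
  \<open>(f ^^ n) p\<close>, whose length does not depend on n, would always cross the bottleneck.
  This keeps \<open>(f ^^ n) p\<close> at bounded distance from p.\<close>

lemma eventually_V: "\<exists>N. \<forall>n\<ge>N. (f ^^ n) x \<in> V"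
proof -
  have "\<exists>n. (f ^^ n) x \<notin> U"
  proof (rule ccontr)
    assume "\<not> ?thesis"
    then have U: "(f ^^ n) x \<in> U" for n by blast
    obtain n :: nat where n: "2 * D * real n > dist p x + D" using D
      by (metis mult.commute mult_pos_pos reals_Archimedean3 zero_less_numeral)
    then have "n > 0" using D zero_le_dist[of p x] by (cases "n = 0") auto
    then have "(f ^^ n) p \<in> V" using forward_V p_notin by blast
    then obtain z where z: "btw ((f ^^ n) x) z ((f ^^ n) p)" "dist z p \<le> D"
      using U gate unfolding gate_def by blast
    have "dist ((f ^^ n) p) p \<le> dist ((f ^^ n) p) z + dist z p" by (rule dist_triangle)
    also have "dist ((f ^^ n) p) z \<le> dist ((f ^^ n) x) ((f ^^ n) p)"
      using z(1) zero_le_dist[of "(f ^^ n) x" z] dist_commute[of z "(f ^^ n) p"]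
      unfolding btw_def by linarith
    finally have "dist p ((f ^^ n) p) \<le> dist p x + D"
      using z by (simp add: isometry_dist[OF isometry_funpow[OF f]] dist_commute)
    then show False using orbit_growth[of n] n by linarith
  qed
  then obtain N where N: "(f ^^ N) x \<notin> U" by blast
  have "(f ^^ n) x \<in> V" if "n \<ge> Suc N" for n
  proof -
    have "(f ^^ n) x = (f ^^ (n - N)) ((f ^^ N) x)" using that by (simp flip: funpow_add o_apply[of "f ^^ _"])
    then show ?thesis using forward_V[OF N, of "n - N"] that by simp
  qed
  then show ?thesis by blast
qed

lemma eventually_V_U: "\<exists>n>0. (f ^^ n) x \<in> V \<and> zpow f (- int n) y \<in> U"
proof -
  obtain N where N: "\<And>n. n \<ge> N \<Longrightarrow> (f ^^ n) x \<in> V" using eventually_V by blast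
  obtain M where M: "\<And>n. n \<ge> M \<Longrightarrow> (inv_into UNIV f ^^ n) y \<in> U"
    using north_south.eventually_V[OF inverse] by blast
  have "zpow f (- int n) = inv_into UNIV f ^^ n" for n
    using zpow_inv[OF f, of "int n"] by (simp add: zpow_of_nat)
  then show ?thesis using N[of "max (max N M) 1"] M[of "max (max N M) 1"]
    by (intro exI[of _ "max (max N M) 1"]) simp
qed

text \<open>The points \<open>zpow f (- int n) x\<close> and \<open>(f ^^ n) x\<close> have the same
  displacement as x, and for suitable n they are separated by the bottleneck. A point near p on the
  geodesic between them inherits the bound by convexity.\<close>

lemma displacement_near:
  assumes "dist x (f x) \<le> c" shows "\<exists>z. dist z (f z) \<le> c \<and> dist p z \<le> D"
proof -
  obtain n where n: "(f ^^ n) x \<in> V" "zpow f (- int n) x \<in> U" using eventually_V_U by blast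
  then obtain z where z: "btw (zpow f (- int n) x) z ((f ^^ n) x)" "dist z p \<le> D"
    using gate unfolding gate_def by blast
  have "dist (zpow f k x) (f (zpow f k x)) = dist x (f x)" for k
    by (simp add: isometry_dist[OF isometry_zpow[OF f]] flip: zpow_commute[OF f])
  from this[of "- int n"] this[of "int n"] have "dist z (f z) \<le> c"
    using displacement_convex[OF f z(1)] assms by (simp add: zpow_of_nat)
  then show ?thesis using z by (auto simp: dist_commute)
qed

lemma displacement_attained: "\<exists>x. \<forall>y. dist x (f x) \<le> dist y (f y)"
proof -
  define \<tau> where "\<tau> = (INF x. dist x (f x))"
  have bdd: "bdd_below (range (\<lambda>x. dist x (f x)))" by (rule bdd_belowI2[where m = 0]) simp
  define K where "K n = {z. dist z (f z) \<le> \<tau> + 1 / real (Suc n)}" for n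
  have cf: "continuous_on UNIV f"
    using isometry_dist[OF f] by (auto simp: continuous_on_iff)
  have "\<exists>z. \<forall>n. z \<in> K n"
  proof (rule nested_convex_point)
    show "K n \<subseteq> K m" if "m \<le> n" for m n
    proof -
      have "1 / real (Suc n) \<le> 1 / real (Suc m)" using that by (intro frac_le) auto
      then show ?thesis by (auto simp: K_def simp del: of_nat_Suc)
    qed
    show "closed (K n)" for n
      unfolding K_def by (intro closed_Collect_le continuous_intros cf)
    show "z \<in> K n" if "x \<in> K n" "y \<in> K n" "btw x z y" for n x y z
      using that displacement_convex[OF f] by (auto simp: K_def)
    show "\<exists>z\<in>K n. dist p z \<le> D" for n
    proof -
      have "(INF x. dist x (f x)) < \<tau> + 1 / real (Suc n)" by (simp add: \<tau>_def)
      then obtain x where "dist x (f x) < \<tau> + 1 / real (Suc n)"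
        using cINF_less_iff[OF _ bdd] by auto
      then show ?thesis using displacement_near[of x] by (auto simp: K_def)
    qed
  qed
  then obtain z where z: "\<And>n. dist z (f z) \<le> \<tau> + 1 / real (Suc n)" by (auto simp: K_def)
  have "(\<lambda>n. \<tau> + 1 / real (Suc n)) \<longlonglongrightarrow> \<tau> + 0"
    by (intro tendsto_intros LIMSEQ_Suc lim_1_over_n)
  then have "dist z (f z) \<le> \<tau>"
    using z LIMSEQ_le_const by fastforce
  moreover have "\<tau> \<le> dist y (f y)" for y unfolding \<tau>_def by (rule cINF_lower[OF bdd]) simp
  ultimately show ?thesis by (meson order_trans)
qed

end

section \<open>Projection to the axis\<close>

locale north_south_axis = north_south ty f p D U V
  for ty :: "'a::complete_space itself" and f p D U V +
  fixes \<gamma> :: "real \<Rightarrow> 'a" and \<tau> c :: real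
  assumes line: "geodesic_line \<gamma>" and trans: "f (\<gamma> s) = \<gamma> (s + \<tau>)" and \<tau>: "\<tau> > 0"
    and c: "dist (\<gamma> c) p \<le> D"
begin

lemma zpow_axis: "zpow f k (\<gamma> s) = \<gamma> (s + k * \<tau>)"
  by (rule zpow_translation[where \<gamma> = \<gamma>, OF f trans])

lemma coord_zpow: "coord \<gamma> (zpow f k x) = coord \<gamma> x + k * \<tau>"
  by (rule coord_translation[OF line isometry_zpow[OF f] zpow_axis])

lemma near_c: "dist z p \<le> D \<Longrightarrow> dist z (\<gamma> c) \<le> 2 * D"
  using dist_triangle2[of z "\<gamma> c" p] c by linarith

text \<open>Otherwise \<open>\<gamma> (t + \<tau>)\<close> is in V while some earlier point of the
  axis is in U, so the part of the axis up to t + \<tau> would come within 2D of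
  \<open>\<gamma> c\<close>.\<close>

lemma line_U: assumes "t + \<tau> + 2 * D < c" shows "\<gamma> t \<in> U"
proof (rule ccontr)
  assume "\<gamma> t \<notin> U"
  then have "\<gamma> (t + \<tau>) \<in> V" using map trans by metis
  moreover obtain n where n: "n > 0" "zpow f (- int n) (\<gamma> t) \<in> U" using eventually_V_U by blast
  ultimately obtain z where z: "btw (zpow f (- int n) (\<gamma> t)) z (\<gamma> (t + \<tau>))" "dist z p \<le> D"
    using gate unfolding gate_def by blast
  define a where "a = t - real n * \<tau>"
  have a: "zpow f (- int n) (\<gamma> t) = \<gamma> a" by (simp add: zpow_axis a_def)
  have "0 \<le> real n * \<tau>" using \<tau> by simp
  then have "a \<le> t + \<tau>" using \<tau> unfolding a_def by linarith
  then obtain r where r: "r \<le> t + \<tau>" "z = \<gamma> r" using btw_line[OF line _ z(1)[unfolded a]] by blast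
  then have "\<bar>r - c\<bar> \<le> 2 * D" using near_c[OF z(2)] by (simp add: geodesic_line_dist[OF line])
  then show False using r assms by linarith
qed

text \<open>Otherwise f x is in V while its projection \<open>\<gamma> ?a\<close> is in U. A
  geodesic to the nearest point that passes within 2D of \<open>\<gamma> c\<close> forces this
  nearest point to be within 4D of \<open>\<gamma> c\<close>.\<close>

lemma proj_U: assumes "coord \<gamma> x + 2 * \<tau> + 4 * D < c" shows "x \<in> U"
proof (rule ccontr)
  assume "x \<notin> U"
  then have "f x \<in> V" by (rule map)
  let ?a = "coord \<gamma> x + \<tau>"
  have a: "coord \<gamma> (f x) = ?a" by (rule coord_translation[OF line f trans])
  have "\<gamma> ?a \<in> U" by (rule line_U) (use assms D in simp)
  with \<open>f x \<in> V\<close> obtain z where z: "btw (\<gamma> ?a) z (f x)" "dist z p \<le> D"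
    using gate unfolding gate_def by blast
  have "dist (\<gamma> ?a) (f x) \<ge> dist (\<gamma> ?a) (\<gamma> c) + dist (\<gamma> c) (f x) - 2 * (2 * D)"
    by (rule dist_near_btw[OF z(1) near_c[OF z(2)]])
  moreover have "dist (f x) (\<gamma> ?a) \<le> dist (f x) (\<gamma> c)" using coord_le[OF line, of "f x" c] by (simp add: a)
  ultimately have "\<bar>?a - c\<bar> \<le> 4 * D" by (simp add: geodesic_line_dist[OF line] dist_commute)
  then show False using assms \<tau> by linarith
qed

lemma inverse_axis: "north_south_axis ty (inv_into UNIV f) p D V U (\<lambda>s. \<gamma> (- s)) \<tau> (- c)"
proof -
  interpret inv: north_south ty "inv_into UNIV f" p D V U by (rule inverse)
  show ?thesis
  proof
    show "inv_into UNIV f (\<gamma> (- s)) = \<gamma> (- (s + \<tau>))" for s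
      using zpow_pred[OF f, of 0 "\<gamma> (- s)"] zpow_axis[of "-1" "- s"] by simp
  qed (use geodesic_line_reverse[OF line] c \<tau> in auto)
qed

lemma proj_V: assumes "coord \<gamma> x > c + 2 * \<tau> + 4 * D" shows "x \<in> V"
  using north_south_axis.proj_U[OF inverse_axis, of x] assms by (simp add: coord_reverse[OF line])

text \<open>A geodesic that crosses the bottleneck has by then used up the radius of the ball
  touching the axis, except for 2D. Hence the translate of y ends near \<open>\<gamma> c\<close> and
  cannot project far beyond it.\<close>

lemma proj_ball_right:
  assumes "dist x y < dist x (\<gamma> (coord \<gamma> x))"
  shows "coord \<gamma> y \<le> coord \<gamma> x + 12 * D + 5 * \<tau>"
proof (rule ccontr)
  assume n: "\<not> ?thesis"
  \<comment> \<open>The least power that brings x into the range of \<open>proj_U\<close>, so that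
    x' has coordinate at least c - 3\<tau> - 4D. The constant 12D + 5\<tau> is this 3\<tau> + 4D
    plus the 2\<tau> + 8D that put y' into V and more than 8D beyond c.\<close>
  define k where "k = \<lfloor>(coord \<gamma> x + 2 * \<tau> + 4 * D - c) / \<tau>\<rfloor> + 1"
  define x' y' where "x' = zpow f (- k) x" and "y' = zpow f (- k) y"
  have "real_of_int k - 1 \<le> (coord \<gamma> x + 2 * \<tau> + 4 * D - c) / \<tau>"
    "(coord \<gamma> x + 2 * \<tau> + 4 * D - c) / \<tau> < real_of_int k" unfolding k_def by linarith+
  then have k: "(real_of_int k - 1) * \<tau> \<le> coord \<gamma> x + 2 * \<tau> + 4 * D - c"
    "coord \<gamma> x + 2 * \<tau> + 4 * D - c < real_of_int k * \<tau>"
    using \<tau> by (simp_all add: pos_le_divide_eq pos_divide_less_eq)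
  have pr': "coord \<gamma> x' = coord \<gamma> x - k * \<tau>" "coord \<gamma> y' = coord \<gamma> y - k * \<tau>"
    by (simp_all add: x'_def y'_def coord_zpow)
  have "x' \<in> U" by (rule proj_U) (use k pr' in simp)
  moreover have "y' \<in> V"
    by (rule proj_V) (use k pr' n D in \<open>simp add: algebra_simps\<close>)
  ultimately obtain z where z: "btw x' z y'" "dist z p \<le> D"
    using gate unfolding gate_def by blast
  have "dist x y = dist x' y'" by (simp add: x'_def y'_def isometry_dist[OF isometry_zpow[OF f]])
  moreover have "dist x (\<gamma> (coord \<gamma> x)) = dist x' (\<gamma> (coord \<gamma> x'))"
  proof -
    have "\<gamma> (coord \<gamma> x') = zpow f (- k) (\<gamma> (coord \<gamma> x))" by (simp add: pr' zpow_axis)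
    then show ?thesis by (simp add: x'_def isometry_dist[OF isometry_zpow[OF f]])
  qed
  moreover have "dist x' (\<gamma> (coord \<gamma> x')) \<le> dist x' (\<gamma> c)" by (rule coord_le[OF line])
  moreover have "dist x' (\<gamma> c) \<le> dist x' z + 2 * D"
    using dist_triangle[of x' "\<gamma> c" z] near_c[OF z(2)] by linarith
  ultimately have "dist z y' < 2 * D" using assms z(1) unfolding btw_def by linarith
  then have "dist y' (\<gamma> c) < 4 * D"
    using dist_triangle[of y' "\<gamma> c" z] near_c[OF z(2)] by (simp add: dist_commute)
  then have "coord \<gamma> y' - c < 8 * D" using coord_close[OF line, of y' c] by linarith
  then show False using k pr' n by (simp add: algebra_simps)
qed

lemma proj_ball_left:
  assumes "dist x y < dist x (\<gamma> (coord \<gamma> x))"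
  shows "coord \<gamma> y \<ge> coord \<gamma> x - (12 * D + 5 * \<tau>)"
  using north_south_axis.proj_ball_right[OF inverse_axis, of x y] assms
  by (simp add: coord_reverse[OF line])

lemma contracting_axis: "contracting_set (2 * (12 * D + 5 * \<tau>)) (range \<gamma>)"
  unfolding contracting_set_def
proof (intro allI impI)
  fix x r assume r: "ball x r \<inter> range \<gamma> = {}"
  let ?L = "12 * D + 5 * \<tau>" and ?N = "nearest_points (range \<gamma>) (ball x r)"
  have L: "?L \<ge> 0" using D \<tau> by simp
  have N: "\<exists>s. q = \<gamma> s \<and> \<bar>s - coord \<gamma> x\<bar> \<le> ?L" if "q \<in> ?N" for q
  proof -
    obtain s y where q: "q = \<gamma> s" "y \<in> ball x r" "\<And>t. dist y (\<gamma> s) \<le> dist y (\<gamma> t)"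
      using \<open>q \<in> ?N\<close> by (auto simp: nearest_points_def)
    have s: "coord \<gamma> y = s" by (rule coord_unique[OF line q(3)])
    have "\<gamma> (coord \<gamma> x) \<notin> ball x r" using r by blast
    then have "dist x y < dist x (\<gamma> (coord \<gamma> x))" using q(2) by simp
    then show ?thesis using proj_ball_left[of x y] proj_ball_right[of x y] q(1) s
      by (intro exI[of _ s]) auto
  qed
  have d: "dist q q' \<le> 2 * ?L" if "q \<in> ?N" "q' \<in> ?N" for q q'
    using N[OF that(1)] N[OF that(2)] by (auto simp: geodesic_line_dist[OF line])
  show "bounded ?N \<and> diameter ?N \<le> 2 * ?L"
  proof
    show "bounded ?N" unfolding bounded_two_points using d by blast
    show "diameter ?N \<le> 2 * ?L"
      using d L unfolding diameter_def by (auto intro!: cSUP_least)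
  qed
qed

end

lemma (in north_south) contracting_f: "contracting f"
proof -
  obtain x where x: "\<And>y. dist x (f x) \<le> dist y (f y)" using displacement_attained by blast
  have pos: "dist x (f x) > 0" using displacement_ge[of x] D by linarith
  obtain \<gamma> where \<gamma>: "geodesic_line \<gamma>" "\<And>s. f (\<gamma> s) = \<gamma> (s + dist x (f x))"
    using axis_through_minimum[OF f x pos] by blast
  let ?\<tau> = "dist x (f x)"
  have z: "zpow f k (\<gamma> s) = \<gamma> (s + k * ?\<tau>)" for k s by (rule zpow_translation[where \<gamma> = \<gamma>, OF f \<gamma>(2)])
  \<comment> \<open>A piece of the axis between two iterates of \<open>\<gamma> 0\<close> is the
    geodesic from a point of U to a point of V, so it meets the gate.\<close>
  have "\<exists>c. dist (\<gamma> c) p \<le> D"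
  proof -
    obtain n where n: "(f ^^ n) (\<gamma> 0) \<in> V" "zpow f (- int n) (\<gamma> 0) \<in> U" using eventually_V_U by blast
    then obtain w where w: "btw (zpow f (- int n) (\<gamma> 0)) w ((f ^^ n) (\<gamma> 0))" "dist w p \<le> D"
      using gate unfolding gate_def by blast
    define a where "a = real n * ?\<tau>"
    have "a \<ge> 0" by (simp add: a_def)
    have w1: "btw (\<gamma> (- a)) w (\<gamma> a)"
      using w(1) z[of "- int n" 0] z[of "int n" 0] by (simp add: a_def zpow_of_nat)
    obtain r where "w = \<gamma> r" by (rule btw_line[OF \<gamma>(1) _ w1]) (use \<open>a \<ge> 0\<close> in auto)
    then show ?thesis using w(2) by blast
  qed
  then obtain c where c: "dist (\<gamma> c) p \<le> D" by blast
  interpret north_south_axis ty f p D U V \<gamma> ?\<tau> c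
    by unfold_locales (use \<gamma> pos c in auto)
  have "axial f" unfolding axial_def using f x pos by (metis dist_commute)
  moreover have "is_axis f \<gamma>" unfolding is_axis_def using \<gamma> pos by (metis less_irrefl)
  moreover have "2 * (12 * D + 5 * ?\<tau>) > 0" using D pos by (intro mult_pos_pos add_pos_pos) auto
  ultimately show ?thesis unfolding contracting_def using contracting_axis by blast
qed

section \<open>Pivoting for Schottky families\<close>

text \<open>The shape of the estimates for averages over letters: one exceptional letter gets the
  trivial bound.\<close>

lemma sum_le_one_exception:
  fixes g :: "'i \<Rightarrow> real" and p q :: real
  assumes "finite S" "card {a \<in> S. P a} \<le> 1" "q \<ge> 0"
    and "\<And>a. a \<in> S \<Longrightarrow> \<not> P a \<Longrightarrow> g a \<le> p" "\<And>a. a \<in> S \<Longrightarrow> P a \<Longrightarrow> g a \<le> p + q"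
  shows "sum g S \<le> card S * p + q"
proof -
  have "sum g S \<le> (\<Sum>a\<in>S. p + (if P a then q else 0))"
    by (rule sum_mono) (use assms in auto)
  also have "\<dots> = card S * p + card {a \<in> S. P a} * q"
    using assms(1) by (simp add: sum.distrib sum.If_cases Int_def)
  also have "card {a \<in> S. P a} * q \<le> 1 * q"
    using assms(2,3) by (intro mult_right_mono) auto
  finally show ?thesis by simp
qed

text \<open>\<open>R i\<close> is the repelling and \<open>A i\<close> the attracting set of
  \<open>F i\<close>. The probability estimates rest on \<open>exceptional\<close>: for all but one
  s, the word v sends all but at most one \<open>A a\<close> off \<open>R s\<close>. The predicate
  \<open>good_map\<close> stands for being contracting; it enters through \<open>pong\<close> and
  through the invariance under rotation \<open>conj\<close>.\<close>

locale schottky =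
  fixes I :: "nat set" and F :: "nat \<Rightarrow> 'a::metric_space \<Rightarrow> 'a" and A R :: "nat \<Rightarrow> 'a set"
    and good_map :: "('a \<Rightarrow> 'a) \<Rightarrow> bool"
  assumes finI: "finite I" and cardI: "card I \<ge> 32"
    and iso: "i \<in> I \<Longrightarrow> isometry (F i)"
    and ping: "i \<in> I \<Longrightarrow> x \<notin> R i \<Longrightarrow> F i x \<in> A i"
    and disj: "i \<in> I \<Longrightarrow> j \<in> I \<Longrightarrow> A i \<inter> R j = {}"
    and exceptional: "isometry v \<Longrightarrow>
      card {s \<in> I. \<not> card {a \<in> I. v ` A a \<inter> R s \<noteq> {}} \<le> 1} \<le> 1"
    and pong: "isometry f \<Longrightarrow> i \<in> I \<Longrightarrow> j \<in> I \<Longrightarrow> (\<And>x. x \<notin> R i \<Longrightarrow> f x \<in> A j) \<Longrightarrow> good_map f"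
    and conj: "isometry f \<Longrightarrow> isometry g \<Longrightarrow> good_map (f \<circ> g) \<Longrightarrow> good_map (g \<circ> f)"
begin

text \<open>A stack is a list of frames \<open>(v, G, b)\<close> with the most recent frame at the head. Together with a
  current word \<open>y\<close> it stands for the random map
  \<open>v\<^sub>1 \<circ> F a\<^sub>1 \<circ> F b\<^sub>1 \<circ> \<dots> \<circ> v\<^sub>k \<circ> F a\<^sub>k \<circ> F b\<^sub>k \<circ> y\<close>, where the \<open>a\<^sub>i\<close> are independent and uniform in \<open>G\<^sub>i\<close>;
  \<open>stack_avg\<close> is the expectation of \<open>\<phi>\<close>.\<close>

primrec stack_avg :: "(('a \<Rightarrow> 'a) \<times> nat set \<times> nat) list \<Rightarrow> (('a \<Rightarrow> 'a) \<Rightarrow> real) \<Rightarrow> ('a \<Rightarrow> 'a) \<Rightarrow> real" where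
  "stack_avg [] \<phi> = \<phi>"
| "stack_avg (fr # fs) \<phi> = (case fr of (v, G, b) \<Rightarrow>
     (\<lambda>y. (\<Sum>a\<in>G. stack_avg fs \<phi> (v \<circ> F a \<circ> F b \<circ> y)) / card G))"

fun free :: "(('a \<Rightarrow> 'a) \<times> nat set \<times> nat) list \<Rightarrow> 'a set \<Rightarrow> bool" where
  "free [] Y = True"
| "free ((v, G, b) # fs) Y = (Y \<inter> R b = {})"

fun linked :: "(('a \<Rightarrow> 'a) \<times> nat set \<times> nat) list \<Rightarrow> bool" where
  "linked [] = True"
| "linked ((v, G, b) # fs) = (isometry v \<and> G \<subseteq> I \<and> card I \<le> card G + 1 \<and> b \<in> I \<and>
     (\<forall>a\<in>G. free fs (v ` A a)) \<and> linked fs)"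

text \<open>The link condition ensures that any choice of the letters gives a ping-pong chain. It is stable
  under changes of the \<open>a\<^sub>i\<close>, as the \<open>b\<^sub>i\<close> are fixed. \<open>good\<close> says that nearly every letter may be
  pushed next.\<close>

definition good :: "(('a \<Rightarrow> 'a) \<times> nat set \<times> nat) list \<Rightarrow> ('a \<Rightarrow> 'a) \<Rightarrow> bool" where
  "good fs y \<longleftrightarrow> card {a \<in> I. \<not> free fs (y ` A a)} \<le> 1"

lemma free_mono: "free fs Y \<Longrightarrow> Z \<subseteq> Y \<Longrightarrow> free fs Z"
  by (cases "(fs, Y)" rule: free.cases) auto

lemma linked_card: "linked ((v, G, b) # fs) \<Longrightarrow> finite G \<and> card G \<ge> 31"
  using finI cardI by (auto intro: finite_subset)

lemma linked_frame_isometry: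
  "linked ((v, G, b) # fs) \<Longrightarrow> a \<in> G \<Longrightarrow> isometry y \<Longrightarrow> isometry (v \<circ> F a \<circ> F b \<circ> y)"
  using iso by (auto intro!: isometry_comp)

lemma linked_appendD: "linked (fs @ gs) \<Longrightarrow> linked gs"
  by (induction fs rule: linked.induct) auto

lemma free_append: "free (fs @ gs) Y \<Longrightarrow> free fs Y"
  by (cases "(fs, Y)" rule: free.cases) auto

lemma linked_append1: "linked (fs @ gs) \<Longrightarrow> linked fs"
  by (induction fs rule: linked.induct) (auto intro: free_append)

lemma stack_avg_append_map: "stack_avg fs (\<lambda>x. \<phi> (x \<circ> z)) y = stack_avg fs \<phi> (y \<circ> z)"
  by (induction fs arbitrary: y) (auto simp: comp_assoc)

lemma stack_avg_sum: "stack_avg fs (\<lambda>x. \<Sum>i\<in>S. \<phi> i x) y = (\<Sum>i\<in>S. stack_avg fs (\<phi> i) y)"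
proof (induction fs arbitrary: y)
  case (Cons fr fs)
  obtain v G b where "fr = (v, G, b)" by (cases fr)
  then show ?case using Cons by (simp add: sum_divide_distrib sum.swap[of _ G] del: comp_apply)
qed simp

lemma stack_avg_divide: "stack_avg fs (\<lambda>x. \<phi> x / c) y = stack_avg fs \<phi> y / c"
proof (induction fs arbitrary: y)
  case (Cons fr fs)
  obtain v G b where "fr = (v, G, b)" by (cases fr)
  then show ?case using Cons by (simp add: sum_divide_distrib mult.commute del: comp_apply)
qed simp

lemma stack_avg_cong:
  "linked fs \<Longrightarrow> isometry y \<Longrightarrow> (\<And>x. isometry x \<Longrightarrow> \<phi> x = \<psi> x) \<Longrightarrow> stack_avg fs \<phi> y = stack_avg fs \<psi> y"
proof (induction fs arbitrary: y)
  case (Cons fr fs)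
  obtain v G b where fr: "fr = (v, G, b)" by (cases fr)
  have "stack_avg fs \<phi> (v \<circ> F a \<circ> F b \<circ> y) = stack_avg fs \<psi> (v \<circ> F a \<circ> F b \<circ> y)" if "a \<in> G" for a
  proof (rule Cons.IH)
    show "isometry (v \<circ> F a \<circ> F b \<circ> y)"
      using Cons.prems linked_frame_isometry[of v G b fs a y] that by (simp add: fr del: comp_apply)
  qed (use Cons.prems in \<open>auto simp: fr\<close>)
  then show ?case by (simp add: fr)
qed simp

lemma stack_avg_snoc:
  "stack_avg (fs @ [(v, G, b)]) \<phi> y = (\<Sum>a\<in>G. stack_avg fs (\<lambda>x. \<phi> (v \<circ> F a \<circ> F b \<circ> x)) y) / card G"
proof (induction fs arbitrary: y)
  case (Cons fr fs)
  obtain v' G' b' where "fr = (v', G', b')" by (cases fr)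
  then show ?case using Cons by (simp add: sum_divide_distrib sum.swap[of _ G] mult.commute del: comp_apply)
qed simp

lemma stack_avg_le:
  "linked fs \<Longrightarrow> (\<And>x. \<phi> x \<le> 1) \<Longrightarrow> stack_avg fs \<phi> y \<le> 1"
proof (induction fs arbitrary: y)
  case (Cons fr fs)
  obtain v G b where fr: "fr = (v, G, b)" by (cases fr)
  have "(\<Sum>a\<in>G. stack_avg fs \<phi> (v \<circ> F a \<circ> F b \<circ> y)) \<le> real (card G) * 1"
    using Cons by (intro sum_bounded_above) (simp add: fr)
  moreover have "card G > 0" using linked_card[of v G b fs] Cons.prems fr by simp
  ultimately show ?case by (simp add: fr divide_le_eq)
qed simp

text \<open>The word \<open>F b \<circ> y\<close> sends almost every \<open>A a'\<close> off
  \<open>R a\<close>, hence \<open>F a\<close> sends the result into \<open>A a\<close>, and the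
  link condition says that the image of \<open>A a\<close> under v fits on the frames below.\<close>

lemma good_pop:
  assumes l: "linked ((v, G, b) # fs)" and a: "a \<in> G"
    and ne: "card {a' \<in> I. (F b \<circ> y) ` A a' \<inter> R a \<noteq> {}} \<le> 1"
  shows "good fs (v \<circ> F a \<circ> F b \<circ> y)"
proof -
  have "free fs ((v \<circ> F a \<circ> F b \<circ> y) ` A a')" if "(F b \<circ> y) ` A a' \<inter> R a = {}" for a'
  proof (rule free_mono)
    show "free fs (v ` A a)" using l a by simp
    have "a \<in> I" using l a by auto
    then show "(v \<circ> F a \<circ> F b \<circ> y) ` A a' \<subseteq> v ` A a" using ping[of a] that by auto
  qed
  then have "{a' \<in> I. \<not> free fs ((v \<circ> F a \<circ> F b \<circ> y) ` A a')}
      \<subseteq> {a' \<in> I. (F b \<circ> y) ` A a' \<inter> R a \<noteq> {}}" by blast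
  then have "card {a' \<in> I. \<not> free fs ((v \<circ> F a \<circ> F b \<circ> y) ` A a')}
      \<le> card {a' \<in> I. (F b \<circ> y) ` A a' \<inter> R a \<noteq> {}}" using finI by (intro card_mono) auto
  then show ?thesis using ne by (simp add: good_def)
qed

lemma exceptional_subset:
  assumes "isometry v" "G \<subseteq> I"
  shows "card {s \<in> G. \<not> card {a \<in> I. v ` A a \<inter> R s \<noteq> {}} \<le> 1} \<le> 1"
proof -
  have "card {s \<in> G. \<not> card {a \<in> I. v ` A a \<inter> R s \<noteq> {}} \<le> 1}
      \<le> card {s \<in> I. \<not> card {a \<in> I. v ` A a \<inter> R s \<noteq> {}} \<le> 1}"
    using assms finI by (intro card_mono) auto
  then show ?thesis using exceptional[OF assms(1)] by linarith
qed

text \<open>If the top of the stack is not good, its letter \<open>a\<close> is revealed and the frame is merged into the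
  current word. The new top is good for all but one value of \<open>a\<close>, so that the number of removed
  frames has a geometric tail.\<close>

lemma stack_avg_pop:
  assumes H: "\<And>fs y. linked fs \<Longrightarrow> isometry y \<Longrightarrow> good fs y \<Longrightarrow> stack_avg fs \<phi> y \<le> M * (1 / 2) ^ length fs"
    and M: "M \<ge> 0"
  shows "linked fs \<Longrightarrow> isometry y \<Longrightarrow> stack_avg fs \<phi> y \<le> 4 * M * (1 / 2) ^ length fs"
proof (induction fs arbitrary: y)
  case Nil
  then show ?case using H[of "[]" y] M by (simp add: good_def)
next
  case (Cons fr fs)
  obtain v G b where fr: "fr = (v, G, b)" by (cases fr)
  have l: "linked ((v, G, b) # fs)" using Cons.prems fr by simp
  then have l': "linked fs" "G \<subseteq> I" "b \<in> I" by auto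
  let ?m = "M * (1 / 2) ^ length fs"
  have G: "finite G" "card G \<ge> 31" using linked_card[OF l] by auto
  have m: "?m \<ge> 0" using M by simp
  have "(\<Sum>a\<in>G. stack_avg fs \<phi> (v \<circ> F a \<circ> F b \<circ> y)) \<le> card G * ?m + 4 * ?m"
  proof (rule sum_le_one_exception)
    show "card {s \<in> G. \<not> card {a \<in> I. (F b \<circ> y) ` A a \<inter> R s \<noteq> {}} \<le> 1} \<le> 1"
      using l' iso Cons.prems by (intro exceptional_subset isometry_comp) auto
    show "stack_avg fs \<phi> (v \<circ> F a \<circ> F b \<circ> y) \<le> ?m"
      if "a \<in> G" "\<not> \<not> card {a' \<in> I. (F b \<circ> y) ` A a' \<inter> R a \<noteq> {}} \<le> 1" for a
      using that by (intro H l' linked_frame_isometry[OF l] Cons.prems good_pop[OF l]) auto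
    show "stack_avg fs \<phi> (v \<circ> F a \<circ> F b \<circ> y) \<le> ?m + 4 * ?m" if "a \<in> G" for a
      using Cons.IH[OF l'(1) linked_frame_isometry[OF l that Cons.prems(2)]] m
      by (simp add: mult.assoc del: comp_apply)
  qed (use G M in auto)
  \<comment> \<open>The exceptional letter costs \<open>4 * ?m\<close> against at least 31 letters.
    The resulting bound \<open>2 * ?m\<close> is 4 M times the weight of a stack with one more
    frame, so the constant 4 reproduces itself.\<close>
  also have "\<dots> \<le> card G * (2 * ?m)"
  proof -
    have "4 * ?m \<le> card G * ?m" using G M by (intro mult_right_mono) auto
    then show ?thesis by linarith
  qed
  finally have "stack_avg (fr # fs) \<phi> y \<le> 2 * ?m" using G by (simp add: fr divide_le_eq mult_ac)
  then show ?case by simp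
qed

text \<open>Apart from one b and one a the slot can be pushed, which halves the weight. An
  exceptional choice is paid for with the factor 4 of \<open>stack_avg_pop\<close>. In units of M
  times the weight, the sum over all pairs is at most N (N/2 + 4) + 4 N.\<close>

lemma stack_avg_push:
  assumes H: "\<And>fs y. linked fs \<Longrightarrow> isometry y \<Longrightarrow> good fs y \<Longrightarrow> stack_avg fs \<phi> y \<le> M * (1 / 2) ^ length fs"
    and M: "M \<ge> 0" and fs: "linked fs" "isometry y" "good fs y" and w: "isometry w"
  shows "stack_avg fs (\<lambda>x. (\<Sum>b\<in>I. \<Sum>a\<in>I. \<phi> (x \<circ> F a \<circ> F b \<circ> w)) / (card I)\<^sup>2) y
    \<le> 3 / 4 * M * (1 / 2) ^ length fs"
proof -
  define N where "N = real (card I)"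
  have N: "N \<ge> 32" using cardI by (simp add: N_def)
  let ?m = "M * (1 / 2) ^ length fs"
  have m: "?m \<ge> 0" using M by simp
  define T where "T a b = stack_avg fs \<phi> (y \<circ> F a \<circ> F b \<circ> w)" for a b
  have T4: "T a b \<le> 4 * ?m" if "a \<in> I" "b \<in> I" for a b
    unfolding T_def using stack_avg_pop[OF H M fs(1), of "y \<circ> F a \<circ> F b \<circ> w"] that iso fs w
    by (simp add: isometry_comp)
  \<comment> \<open>The new frame keeps a uniform in the set of letters that fit on the current
    stack. Goodness of y says that at most one letter is lost.\<close>
  define G where "G = {a \<in> I. free fs (y ` A a)}"
  have B: "card {a \<in> I. \<not> free fs (y ` A a)} \<le> 1" using fs(3) by (simp add: good_def)
  have IG: "I - G = {a \<in> I. \<not> free fs (y ` A a)}" by (auto simp: G_def)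
  have GI: "G \<subseteq> I" "finite G" using finI by (auto simp: G_def)
  have cG: "card I \<le> card G + 1"
    using card_Diff_subset[OF GI(2,1)] card_mono[OF finI GI(1)] B unfolding IG[symmetric] by linarith
  \<comment> \<open>For such b the word w is good on the stack with the new frame on top.\<close>
  have row: "(\<Sum>a\<in>I. T a b) \<le> N * (?m / 2) + 4 * ?m"
    if b: "b \<in> I" and g: "card {a \<in> I. w ` A a \<inter> R b \<noteq> {}} \<le> 1" for b
  proof -
    have "stack_avg ((y, G, b) # fs) \<phi> w \<le> M * (1 / 2) ^ length ((y, G, b) # fs)"
      using fs GI cG b w g by (intro H) (auto simp: good_def G_def)
    then have "(\<Sum>a\<in>G. T a b) / card G \<le> ?m / 2" by (simp add: T_def)
    moreover have "card G > 0" using cG cardI by linarith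
    ultimately have "(\<Sum>a\<in>G. T a b) \<le> card G * (?m / 2)" by (simp add: divide_le_eq mult_ac)
    also have "\<dots> \<le> N * (?m / 2)" unfolding N_def
      using m card_mono[OF finI GI(1)] by (intro mult_right_mono) auto
    finally have 1: "(\<Sum>a\<in>G. T a b) \<le> N * (?m / 2)" .
    have "(\<Sum>a\<in>I - G. T a b) \<le> card (I - G) * (4 * ?m)"
      by (rule sum_bounded_above) (use T4 b in auto)
    also have "\<dots> \<le> 1 * (4 * ?m)" using B m IG by (intro mult_right_mono) auto
    finally show ?thesis using 1 sum.subset_diff[OF GI(1) finI, of "\<lambda>a. T a b"] by simp
  qed
  have "(\<Sum>b\<in>I. \<Sum>a\<in>I. T a b) \<le> card I * (N * (?m / 2) + 4 * ?m) + N * (4 * ?m)"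
  proof (rule sum_le_one_exception[OF finI exceptional[OF w]])
    show "(\<Sum>a\<in>I. T a b) \<le> N * (?m / 2) + 4 * ?m + N * (4 * ?m)" if "b \<in> I" for b
    proof -
      have "(\<Sum>a\<in>I. T a b) \<le> card I * (4 * ?m)" by (rule sum_bounded_above) (use T4 that in auto)
      moreover have "N * (?m / 2) \<ge> 0" using m N by (intro mult_nonneg_nonneg) auto
      ultimately show ?thesis using m unfolding N_def by linarith
    qed
  qed (use row m N in auto)
  also have "\<dots> = N * (N / 2 + 8) * ?m" by (simp add: N_def algebra_simps)
  also have "\<dots> \<le> N * (3 / 4 * N) * ?m" using N m by (intro mult_right_mono mult_left_mono) auto
  finally have "(\<Sum>b\<in>I. \<Sum>a\<in>I. T a b) \<le> (3 / 4 * ?m) * N\<^sup>2" by (simp add: power2_eq_square mult_ac)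
  then have "(\<Sum>b\<in>I. \<Sum>a\<in>I. T a b) / N\<^sup>2 \<le> 3 / 4 * ?m" using N by (simp add: divide_le_eq)
  moreover have "stack_avg fs (\<lambda>x. (\<Sum>b\<in>I. \<Sum>a\<in>I. \<phi> (x \<circ> F a \<circ> F b \<circ> w)) / (card I)\<^sup>2) y
      = (\<Sum>b\<in>I. \<Sum>a\<in>I. T a b) / N\<^sup>2"
    by (simp add: stack_avg_divide stack_avg_sum T_def N_def comp_assoc stack_avg_append_map)
  ultimately show ?thesis by (simp add: mult.assoc)
qed

section \<open>Closing the word up cyclically\<close>

definition bad :: "('a \<Rightarrow> 'a) \<Rightarrow> real" where
  "bad f = (if good_map f then 0 else 1)"

lemma bad_rotate: "isometry f \<Longrightarrow> isometry g \<Longrightarrow> bad (f \<circ> g) = bad (g \<circ> f)"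
  using conj by (auto simp: bad_def)

text \<open>The prefix g is rotated to the right end of the word, where
  \<open>stack_avg_append_map\<close> merges it into the current word y.\<close>

lemma stack_avg_bad_rotate:
  assumes "linked fs" "isometry y" "isometry g" "isometry h"
  shows "stack_avg fs (\<lambda>x. bad (g \<circ> h \<circ> x)) y = stack_avg fs (\<lambda>x. bad (h \<circ> x)) (y \<circ> g)"
proof -
  have "stack_avg fs (\<lambda>x. bad (g \<circ> h \<circ> x)) y = stack_avg fs (\<lambda>x. bad (h \<circ> (x \<circ> g))) y"
    using assms bad_rotate[of g] by (intro stack_avg_cong) (auto simp: comp_assoc isometry_comp)
  then show ?thesis using stack_avg_append_map[of fs "\<lambda>x. bad (h \<circ> x)" g y] by simp
qed

text \<open>A ping-pong chain from the top of the stack: the image of Y misses \<open>R b\<close>,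
  so \<open>F b\<close> sends it into \<open>A b\<close>, by \<open>disj\<close> then
  \<open>F a\<close> sends it into \<open>A a\<close>, and the link condition carries it to the next
  frame. The bottom frame is not averaged; its \<open>R b\<^sub>1\<close> is what the chain has to
  miss at the end.\<close>

lemma stack_avg_chain_0:
  assumes \<phi>: "\<And>x. isometry x \<Longrightarrow> x ` Y \<inter> R b\<^sub>1 = {} \<Longrightarrow> \<phi> x = 0"
  shows "linked (fs @ [(v\<^sub>1, G\<^sub>1, b\<^sub>1)]) \<Longrightarrow> isometry z \<Longrightarrow> free (fs @ [(v\<^sub>1, G\<^sub>1, b\<^sub>1)]) (z ` Y) \<Longrightarrow>
    stack_avg fs \<phi> z = 0"
proof (induction fs arbitrary: z)
  case Nil then show ?case by (simp add: \<phi>)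
next
  case (Cons fr fs)
  obtain v G b where fr: "fr = (v, G, b)" by (cases fr)
  let ?fs = "fs @ [(v\<^sub>1, G\<^sub>1, b\<^sub>1)]"
  have l: "linked ((v, G, b) # ?fs)" using Cons.prems(1) by (simp add: fr)
  have z: "z ` Y \<inter> R b = {}" using Cons.prems(3) by (simp add: fr)
  have "stack_avg fs \<phi> (v \<circ> F a \<circ> F b \<circ> z) = 0" if a: "a \<in> G" for a
  proof (rule Cons.IH)
    show "linked ?fs" using l by simp
    show "isometry (v \<circ> F a \<circ> F b \<circ> z)" by (rule linked_frame_isometry[OF l a Cons.prems(2)])
    have I: "a \<in> I" "b \<in> I" using l a by auto
    show "free ?fs ((v \<circ> F a \<circ> F b \<circ> z) ` Y)"
    proof (rule free_mono)
      show "free ?fs (v ` A a)" using l a by simp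
      have "F a (F b x) \<in> A a" if "x \<in> z ` Y" for x
        using ping[OF I(2), of x] ping[OF I(1), of "F b x"] disj[OF I(2,1)] z that by blast
      then show "(v \<circ> F a \<circ> F b \<circ> z) ` Y \<subseteq> v ` A a" by auto
    qed
  qed
  then show ?case by (simp add: fr)
qed

text \<open>The word closes up to a cyclic ping-pong chain if the letters of the first and the last frame fit
  together. Otherwise both frames are moved into the current word by a cyclic rotation, and the next
  pair of frames gets an independent chance.\<close>

lemma stack_avg_bad_closing:
  "linked fs \<Longrightarrow> isometry y \<Longrightarrow> stack_avg fs bad y \<le> (1 / 4) ^ (length fs div 2)"
proof (induction "length fs" arbitrary: fs y rule: less_induct)
  case less
  show ?case
  proof (cases "length fs < 2")
    case True
    then have "length fs div 2 = 0" by simp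
    then show ?thesis using stack_avg_le[OF less.prems(1), of bad] by (simp add: bad_def)
  next
    case False
    then obtain fr fs' where fs': "fs = fr # fs'" "fs' \<noteq> []" by (cases fs) auto
    obtain mid fr' where mid: "fs' = mid @ [fr']" using fs'(2) by (metis rev_exhaust)
    obtain v G b where fr: "fr = (v, G, b)" by (cases fr)
    obtain v\<^sub>1 G\<^sub>1 b\<^sub>1 where fr': "fr' = (v\<^sub>1, G\<^sub>1, b\<^sub>1)" by (cases fr')
    have fs: "fs = (v, G, b) # mid @ [(v\<^sub>1, G\<^sub>1, b\<^sub>1)]" using fs' mid fr fr' by simp
    have l: "linked ((v, G, b) # mid @ [(v\<^sub>1, G\<^sub>1, b\<^sub>1)])" using less.prems(1) fs by simp
    then have lmid: "linked (mid @ [(v\<^sub>1, G\<^sub>1, b\<^sub>1)])" by simp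
    have l1: "linked [(v\<^sub>1, G\<^sub>1, b\<^sub>1)]" using linked_appendD[OF lmid] .
    have isos: "isometry v" "isometry v\<^sub>1" "isometry (F b)" "isometry (F b\<^sub>1)" "b \<in> I" "b\<^sub>1 \<in> I"
      "G \<subseteq> I" "G\<^sub>1 \<subseteq> I" using l l1 iso by auto
    have isoG: "isometry (F a)" if "a \<in> G \<union> G\<^sub>1" for a using that isos iso by auto
    have G: "finite G" "card G \<ge> 31" "finite G\<^sub>1" "card G\<^sub>1 \<ge> 31"
      using linked_card[OF l] linked_card[OF l1] by auto
    define q where "q = (1 / 4 :: real) ^ (length mid div 2)"
    have q: "q \<ge> 0" by (simp add: q_def)
    define z where "z a = v \<circ> F a \<circ> F b \<circ> y" for a
    have z: "isometry (z a)" if "a \<in> G" for a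
      unfolding z_def by (rule linked_frame_isometry[OF l that less.prems(2)])
    \<comment> \<open>Failure probability once the letters of the top and the bottom frame are
      fixed.\<close>
    define t where "t a a\<^sub>1 = stack_avg mid (\<lambda>x. bad (v\<^sub>1 \<circ> F a\<^sub>1 \<circ> F b\<^sub>1 \<circ> x)) (z a)" for a a\<^sub>1
    have tq: "t a a\<^sub>1 \<le> q" if "a \<in> G" "a\<^sub>1 \<in> G\<^sub>1" for a a\<^sub>1
    proof -
      have "t a a\<^sub>1 = stack_avg mid bad (z a \<circ> (v\<^sub>1 \<circ> F a\<^sub>1 \<circ> F b\<^sub>1))"
        unfolding t_def using stack_avg_bad_rotate[of mid "z a" "v\<^sub>1 \<circ> F a\<^sub>1 \<circ> F b\<^sub>1" id]
          linked_append1[OF lmid] z that isoG isos by (simp add: isometry_comp isometry_id)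
      also have "\<dots> \<le> q" unfolding q_def
        using fs linked_append1[OF lmid] z that isoG isos by (intro less.hyps isometry_comp) auto
      finally show ?thesis .
    qed
    \<comment> \<open>Here the word is cut between \<open>F a\<^sub>1\<close> and
      \<open>F b\<^sub>1\<close>, so that it starts with \<open>F b\<^sub>1\<close> and ends with
      \<open>F a\<^sub>1\<close>. A chain started off \<open>R a\<^sub>1\<close> then ends in
      \<open>A b\<^sub>1\<close>, as \<open>pong\<close> requires.\<close>
    have t0: "t a a\<^sub>1 = 0"
      if a: "a \<in> G" "a\<^sub>1 \<in> G\<^sub>1" and ok: "(F b \<circ> y \<circ> v\<^sub>1) ` A a\<^sub>1 \<inter> R a = {}" for a a\<^sub>1
    proof -
      have aI: "a \<in> I" "a\<^sub>1 \<in> I" using a isos by auto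
      have "t a a\<^sub>1 = stack_avg mid (\<lambda>x. bad (F b\<^sub>1 \<circ> x)) (z a \<circ> (v\<^sub>1 \<circ> F a\<^sub>1))"
        unfolding t_def using stack_avg_bad_rotate[of mid "z a" "v\<^sub>1 \<circ> F a\<^sub>1" "F b\<^sub>1"]
          linked_append1[OF lmid] z a isoG isos by (simp add: isometry_comp)
      also have "\<dots> = 0"
      proof (rule stack_avg_chain_0[OF _ lmid, where Y = "- R a\<^sub>1"])
        show "bad (F b\<^sub>1 \<circ> x) = 0" if x: "isometry x" "x ` (- R a\<^sub>1) \<inter> R b\<^sub>1 = {}" for x
        proof -
          have "good_map (F b\<^sub>1 \<circ> x)"
            by (rule pong[of _ a\<^sub>1 b\<^sub>1]) (use x aI isos ping[of b\<^sub>1] in \<open>auto simp: isometry_comp\<close>)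
          then show ?thesis by (simp add: bad_def)
        qed
        show "isometry (z a \<circ> (v\<^sub>1 \<circ> F a\<^sub>1))" using z a isoG isos by (auto intro!: isometry_comp)
        show "free (mid @ [(v\<^sub>1, G\<^sub>1, b\<^sub>1)]) ((z a \<circ> (v\<^sub>1 \<circ> F a\<^sub>1)) ` (- R a\<^sub>1))"
        proof (rule free_mono)
          show "free (mid @ [(v\<^sub>1, G\<^sub>1, b\<^sub>1)]) (v ` A a)" using l a by simp
          have "F a (F b (y (v\<^sub>1 (F a\<^sub>1 x)))) \<in> A a" if "x \<notin> R a\<^sub>1" for x
            using ok by (intro ping aI) (use ping[OF aI(2) that] in auto)
          then show "(z a \<circ> (v\<^sub>1 \<circ> F a\<^sub>1)) ` (- R a\<^sub>1) \<subseteq> v ` A a" by (auto simp: z_def)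
        qed
      qed
      finally show ?thesis .
    qed
    have "(\<Sum>a\<in>G. \<Sum>a\<^sub>1\<in>G\<^sub>1. t a a\<^sub>1) \<le> card G * q + card G\<^sub>1 * q"
    proof (rule sum_le_one_exception)
      show "card {s \<in> G. \<not> card {a\<^sub>1 \<in> I. (F b \<circ> y \<circ> v\<^sub>1) ` A a\<^sub>1 \<inter> R s \<noteq> {}} \<le> 1} \<le> 1"
        using isos less.prems by (intro exceptional_subset isometry_comp) auto
      show "(\<Sum>a\<^sub>1\<in>G\<^sub>1. t a a\<^sub>1) \<le> q"
        if a: "a \<in> G" and "\<not> \<not> card {a\<^sub>1 \<in> I. (F b \<circ> y \<circ> v\<^sub>1) ` A a\<^sub>1 \<inter> R a \<noteq> {}} \<le> 1" for a
      proof -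
        have "card {a\<^sub>1 \<in> G\<^sub>1. (F b \<circ> y \<circ> v\<^sub>1) ` A a\<^sub>1 \<inter> R a \<noteq> {}}
            \<le> card {a\<^sub>1 \<in> I. (F b \<circ> y \<circ> v\<^sub>1) ` A a\<^sub>1 \<inter> R a \<noteq> {}}"
          using isos finI by (intro card_mono) auto
        then have "(\<Sum>a\<^sub>1\<in>G\<^sub>1. t a a\<^sub>1) \<le> real (card G\<^sub>1) * 0 + q"
          using that tq t0 G q by (intro sum_le_one_exception[where
              P = "\<lambda>a\<^sub>1. (F b \<circ> y \<circ> v\<^sub>1) ` A a\<^sub>1 \<inter> R a \<noteq> {}"]) auto
        then show ?thesis by simp
      qed
      show "(\<Sum>a\<^sub>1\<in>G\<^sub>1. t a a\<^sub>1) \<le> q + card G\<^sub>1 * q" if "a \<in> G" for a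
      proof -
        have "(\<Sum>a\<^sub>1\<in>G\<^sub>1. t a a\<^sub>1) \<le> card G\<^sub>1 * q" by (rule sum_bounded_above) (use tq that in auto)
        then show ?thesis using q by linarith
      qed
    qed (use G q in auto)
    also have "\<dots> = (real (card G) + card G\<^sub>1) * q" by (simp add: algebra_simps)
    \<comment> \<open>At most card G + card \<open>G\<^sub>1\<close> pairs of letters are
      incompatible. Both cardinals are at least 31, and 2/31 is below 1/4.\<close>
    also have "\<dots> \<le> (1 / 4 * (real (card G\<^sub>1) * card G)) * q"
    proof (rule mult_right_mono[OF _ q])
      have "31 * real (card G) \<le> card G\<^sub>1 * real (card G)" "31 * real (card G\<^sub>1) \<le> card G * real (card G\<^sub>1)"
        using G by (intro mult_right_mono; simp)+
      then show "real (card G) + card G\<^sub>1 \<le> 1 / 4 * (real (card G\<^sub>1) * card G)"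
        by (simp add: mult.commute)
    qed
    finally have "(\<Sum>a\<in>G. \<Sum>a\<^sub>1\<in>G\<^sub>1. t a a\<^sub>1) / (real (card G\<^sub>1) * card G) \<le> q / 4"
      using G by (simp add: divide_le_eq mult_ac)
    moreover have "stack_avg fs bad y = (\<Sum>a\<in>G. \<Sum>a\<^sub>1\<in>G\<^sub>1. t a a\<^sub>1) / (real (card G\<^sub>1) * card G)"
      unfolding fs by (simp add: stack_avg_snoc t_def z_def flip: sum_divide_distrib)
    moreover have "length fs div 2 = Suc (length mid div 2)" using fs by simp
    ultimately show ?thesis by (simp add: q_def)
  qed
qed

lemma stack_avg_bad: assumes "linked fs" "isometry y" shows "stack_avg fs bad y \<le> 2 * (1 / 2) ^ length fs"
proof -
  have "(1 / 4 :: real) ^ (length fs div 2) = (1 / 2) ^ (2 * (length fs div 2))"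
    by (simp add: power_mult power2_eq_square)
  \<comment> \<open>The factor 2 pays for the frame left over when the length is odd.\<close>
  also have "\<dots> \<le> 2 * (1 / 2) ^ length fs"
    by (cases "even (length fs)") (auto elim!: oddE evenE)
  finally show ?thesis using stack_avg_bad_closing[OF assms] by linarith
qed

text \<open>The part of the product not yet read: uniform slots separated by arbitrary isometries w.
  It extends words on the right, whereas \<open>stack_avg\<close> extends them on the left.\<close>

primrec slots_avg :: "('a \<Rightarrow> 'a) list \<Rightarrow> (('a \<Rightarrow> 'a) \<Rightarrow> real) \<Rightarrow> ('a \<Rightarrow> 'a) \<Rightarrow> real" where
  "slots_avg [] \<phi> = \<phi>"
| "slots_avg (w # ws) \<phi> = (\<lambda>x. (\<Sum>b\<in>I. \<Sum>a\<in>I. slots_avg ws \<phi> (x \<circ> F a \<circ> F b \<circ> w)) / (card I)\<^sup>2)"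

text \<open>\<open>stack_avg_push\<close> is applied with \<phi> the average over the remaining
  slots and M = 2 (3/4)^n, where n is their number.\<close>

lemma stack_avg_Ext_bad:
  "\<forall>w\<in>set ws. isometry w \<Longrightarrow> linked fs \<Longrightarrow> isometry y \<Longrightarrow> good fs y \<Longrightarrow>
    stack_avg fs (slots_avg ws bad) y \<le> 2 * (3 / 4) ^ length ws * (1 / 2) ^ length fs"
proof (induction ws arbitrary: fs y)
  case Nil
  then show ?case using stack_avg_bad[OF Nil(2,3)] by simp
next
  case (Cons w ws)
  then show ?case
    using stack_avg_push[of "slots_avg ws bad" "2 * (3 / 4) ^ length ws" fs y w] Cons by (simp add: mult_ac)
qed

lemma slots_avg_bad:
  "\<forall>w\<in>set ws. isometry w \<Longrightarrow> isometry y \<Longrightarrow> slots_avg ws bad y \<le> 2 * (3 / 4) ^ length ws"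
  using stack_avg_Ext_bad[of ws "[]" y] by (simp add: good_def)

end

section \<open>Schottky families from independent contracting isometries\<close>

lemma dist_comp_inv:
  assumes "isometry h" shows "dist (h x) y = dist x (inv_into UNIV h y)"
  using isometry_dist[OF assms, of x "inv_into UNIV h y"] by (simp add: isometry_inv_simps[OF assms])

lemma contracting_set_image:
  assumes h: "isometry h" and A: "contracting_set C A"
  shows "contracting_set C (h ` A)"
  unfolding contracting_set_def
proof (intro allI impI)
  fix x r assume d: "ball x r \<inter> h ` A = {}"
  let ?x = "inv_into UNIV h x"
  have ball: "ball x r = h ` ball ?x r"
  proof
    show "ball x r \<subseteq> h ` ball ?x r"
    proof
      fix y assume "y \<in> ball x r"
      then have "inv_into UNIV h y \<in> ball ?x r" by (simp add: isometry_dist[OF isometry_inv[OF h]])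
      then show "y \<in> h ` ball ?x r" using isometry_inv_simps(1)[OF h, of y] by (metis imageI)
    qed
  qed (auto simp: dist_comp_inv[OF h] dist_commute[of x] dist_commute[of ?x])
  have "ball ?x r \<inter> A = {}" using d unfolding ball by auto
  then have N: "bounded (nearest_points A (ball ?x r))" "diameter (nearest_points A (ball ?x r)) \<le> C"
    using A by (auto simp: contracting_set_def)
  have img: "nearest_points (h ` A) (ball x r) = h ` nearest_points A (ball ?x r)"
  proof -
    have "{q \<in> h ` A. Q q} = h ` {q \<in> A. Q (h q)}" for Q by blast
    then show ?thesis unfolding ball nearest_points_def by (simp add: isometry_dist[OF h])
  qed
  have "diameter (h ` S) = diameter S" for S
  proof -
    have "(\<lambda>(x, y). dist x y) ` (h ` S \<times> h ` S) = (\<lambda>(x, y). dist x y) ` (S \<times> S)"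
      using isometry_dist[OF h] by (force simp: image_iff)
    then show ?thesis by (simp add: diameter_def)
  qed
  moreover have "bounded (h ` S)" if "bounded S" for S
    using that unfolding bounded_two_points by (auto simp: isometry_dist[OF h])
  ultimately show "bounded (nearest_points (h ` A) (ball x r)) \<and> diameter (nearest_points (h ` A) (ball x r)) \<le> C"
    unfolding img using N by simp
qed

lemma contracting_conjugate:
  assumes h: "isometry h" and c: "contracting f"
  shows "contracting (h \<circ> f \<circ> inv_into UNIV h)"
proof -
  have f: "isometry f" using c by (simp add: contracting_def axial_def)
  let ?k = "h \<circ> f \<circ> inv_into UNIV h"
  have k: "isometry ?k" by (intro isometry_comp h f isometry_inv)
  obtain x where x: "dist (f x) x > 0" "\<And>y. dist (f x) x \<le> dist (f y) y"
    using c by (auto simp: contracting_def axial_def)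
  obtain \<gamma> C t where g: "geodesic_line \<gamma>" "t \<noteq> 0" "\<And>s. f (\<gamma> s) = \<gamma> (s + t)" "C > 0" "contracting_set C (range \<gamma>)"
    using c by (auto simp: contracting_def is_axis_def)
  have disp: "dist (?k y) y = dist (f (inv_into UNIV h y)) (inv_into UNIV h y)" for y
    by (simp add: dist_comp_inv[OF h])
  have "axial ?k" unfolding axial_def
  proof (intro conjI k exI[of _ "h x"] allI)
    show "0 < dist (?k (h x)) (h x)" using x unfolding disp by (simp add: isometry_inv_simps[OF h])
    show "dist (?k (h x)) (h x) \<le> dist (?k y) y" for y using x(2) unfolding disp by (simp add: isometry_inv_simps[OF h])
  qed
  moreover have "is_axis ?k (h \<circ> \<gamma>)"
    unfolding is_axis_def geodesic_line_def
    using g by (auto simp: isometry_dist[OF h] isometry_inv_simps[OF h] geodesic_line_def)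
  moreover have "contracting_set C (range (h \<circ> \<gamma>))"
    using contracting_set_image[OF h g(5)] by (simp add: image_comp)
  ultimately show ?thesis using g(4) unfolding contracting_def by blast
qed

lemma contracting_rotate:
  assumes f: "isometry f" and g: "isometry g" and "contracting (f \<circ> g)"
  shows "contracting (g \<circ> f)"
proof -
  have "g \<circ> (f \<circ> g) \<circ> inv_into UNIV g = g \<circ> f" by (rule ext) (simp add: isometry_inv_simps[OF g])
  then show ?thesis using contracting_conjugate[OF g assms(3)] by simp
qed

lemma contracting_line_mono:
  "contracting_line C \<gamma> \<Longrightarrow> C \<le> C' \<Longrightarrow> contracting_line C' \<gamma>"
  unfolding contracting_line_def contracting_set_def by (meson less_le_trans order_trans)

lemma contracting_axisE:
  assumes "contracting f"
  obtains \<gamma> \<tau> C where "contracting_line C \<gamma>" "\<tau> > 0" "\<And>s. f (\<gamma> s) = \<gamma> (s + \<tau>)"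
proof -
  obtain \<gamma> C t where g: "geodesic_line \<gamma>" "t \<noteq> 0" "\<And>s. f (\<gamma> s) = \<gamma> (s + t)" "C > 0" "contracting_set C (range \<gamma>)"
    using assms by (auto simp: contracting_def is_axis_def)
  then have l: "contracting_line C \<gamma>" by (simp add: contracting_line_def)
  show ?thesis
  proof (cases "t > 0")
    case True then show ?thesis using that[OF l] g by blast
  next
    case False
    then show ?thesis using that[OF contracting_line_reverse[OF l], of "- t"] g by simp
  qed
qed

lemma translation_funpow:
  fixes \<gamma> :: "real \<Rightarrow> 'a::metric_space"
  assumes "isometry f" "\<And>s. f (\<gamma> s) = \<gamma> (s + \<tau>)"
  shows "(f ^^ n) (\<gamma> s) = \<gamma> (s + real n * \<tau>)"
  using zpow_translation[where \<gamma> = \<gamma> and k = "int n", OF assms] by (simp add: zpow_of_nat)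

context cat0
begin

lemma orbit_line_near:
  fixes \<alpha> \<beta> :: "real \<Rightarrow> 'a"
  assumes \<alpha>: "contracting_line C \<alpha>" and \<beta>: "geodesic_line \<beta>"
    and u: "coord \<alpha> (\<beta> 0) \<le> u" "u + 4 * C \<le> coord \<alpha> (\<beta> s)"
  obtains r where "dist (\<alpha> u) (\<beta> r) \<le> 5 * C"
proof -
  obtain z where z: "btw (\<beta> 0) z (\<beta> s)" "dist z (\<alpha> u) \<le> 5 * C" using passes_near[OF \<alpha> u] .
  obtain r where "z = \<beta> r"
  proof (cases "0 \<le> s")
    case True then show ?thesis using btw_line[OF \<beta> _ z(1)] that by blast
  next
    case False then show ?thesis using btw_line[OF \<beta> _ btw_sym[OF z(1)]] that by (metis linear)
  qed
  then show ?thesis using that[of r] z by (simp add: dist_commute)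
qed

text \<open>If \<beta> projected far out on \<alpha>, it would pass within 5C of an orbit point of
  \<alpha> with index beyond B. Rounding on \<beta> to the orbit of h gives a pair of orbit points
  at distance at most K, which finiteness confines to indices up to B.\<close>

lemma bounded_projection:
  fixes \<alpha> \<beta> :: "real \<Rightarrow> 'a"
  assumes \<alpha>: "contracting_line C \<alpha>" "\<tau> > 0" "isometry g" "\<And>s. g (\<alpha> s) = \<alpha> (s + \<tau>)"
    and \<beta>: "geodesic_line \<beta>" "\<sigma> > 0" "isometry h" "\<And>s. h (\<beta> s) = \<beta> (s + \<sigma>)"
    and fin: "\<And>K. finite {(m, n). dist (zpow g m (\<alpha> 0)) (zpow h n (\<alpha> 0)) \<le> K}"
  obtains T where "\<And>s. \<bar>coord \<alpha> (\<beta> s)\<bar> \<le> T"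
proof -
  have ga: "geodesic_line \<alpha>" using \<alpha>(1) by (simp add: contracting_line_def)
  define c where "c = coord \<alpha> (\<beta> 0)"
  \<comment> \<open>5C from \<open>passes_near\<close>, \<sigma> for rounding to an orbit point on
    \<beta>, and the distance between the base points of the two lines.\<close>
  define K where "K = 5 * C + \<sigma> + dist (\<alpha> 0) (\<beta> 0)"
  let ?S = "{(m, n). dist (zpow g m (\<alpha> 0)) (zpow h n (\<alpha> 0)) \<le> K}"
  have close: "\<exists>n. (k, n) \<in> ?S" if "dist (\<alpha> (real_of_int k * \<tau>)) (\<beta> r) \<le> 5 * C" for k r
  proof -
    define n where "n = \<lfloor>r / \<sigma>\<rfloor>"
    have "real_of_int n \<le> r / \<sigma>" "r / \<sigma> < real_of_int n + 1" unfolding n_def by linarith+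
    then have "real_of_int n * \<sigma> \<le> r" "r < (real_of_int n + 1) * \<sigma>"
      using \<beta>(2) by (simp_all add: pos_le_divide_eq pos_divide_less_eq)
    then have r: "dist (\<beta> r) (\<beta> (real_of_int n * \<sigma>)) \<le> \<sigma>"
      by (simp add: geodesic_line_dist[OF \<beta>(1)] algebra_simps)
    have a: "zpow g k (\<alpha> 0) = \<alpha> (real_of_int k * \<tau>)"
      using zpow_translation[where \<gamma> = \<alpha>, OF \<alpha>(3,4)] by simp
    have b: "zpow h n (\<beta> 0) = \<beta> (real_of_int n * \<sigma>)"
      using zpow_translation[where \<gamma> = \<beta>, OF \<beta>(3,4)] by simp
    have "dist (zpow h n (\<beta> 0)) (zpow h n (\<alpha> 0)) = dist (\<alpha> 0) (\<beta> 0)"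
      by (simp add: isometry_dist[OF isometry_zpow[OF \<beta>(3)]] dist_commute)
    moreover have "dist (zpow g k (\<alpha> 0)) (zpow h n (\<alpha> 0)) \<le> dist (zpow g k (\<alpha> 0)) (\<beta> r)
        + (dist (\<beta> r) (zpow h n (\<beta> 0)) + dist (zpow h n (\<beta> 0)) (zpow h n (\<alpha> 0)))"
      by (meson add_left_mono dist_triangle order_trans)
    ultimately have "dist (zpow g k (\<alpha> 0)) (zpow h n (\<alpha> 0)) \<le> K" using that r unfolding a b K_def by linarith
    then show ?thesis by blast
  qed
  have "finite ((\<lambda>(m, n). \<bar>m\<bar>) ` ?S)" using fin by blast
  then obtain B where B: "\<And>m n. (m, n) \<in> ?S \<Longrightarrow> \<bar>m\<bar> \<le> B"
    by (metis (mono_tags, lifting) case_prod_conv finite_has_maximal bdd_above.E bdd_above_finite image_eqI)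
  \<comment> \<open>Beyond B no pair is left, and j \<tau> is at least |c|, so
    \<open>\<beta> 0\<close> projects between -j \<tau> and j \<tau>.\<close>
  define j where "j = max (B + 1) (max 1 \<lceil>\<bar>c\<bar> / \<tau>\<rceil>)"
  have "\<bar>c\<bar> / \<tau> \<le> real_of_int j" unfolding j_def by linarith
  then have jc: "\<bar>c\<bar> \<le> real_of_int j * \<tau>" using \<alpha>(2) by (simp add: pos_divide_le_eq)
  have jB: "B < j" "0 < j" unfolding j_def by linarith+
  have "coord \<alpha> (\<beta> s) \<le> real_of_int j * \<tau> + 4 * C" for s
  proof (rule ccontr)
    assume "\<not> ?thesis"
    then have "real_of_int j * \<tau> + 4 * C \<le> coord \<alpha> (\<beta> s)" "coord \<alpha> (\<beta> 0) \<le> real_of_int j * \<tau>"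
      using jc by (simp_all add: c_def)
    then obtain r where "dist (\<alpha> (real_of_int j * \<tau>)) (\<beta> r) \<le> 5 * C"
      using orbit_line_near[OF \<alpha>(1) \<beta>(1)] by blast
    then show False using close B jB by fastforce
  qed
  moreover have "coord \<alpha> (\<beta> s) \<ge> - (real_of_int j * \<tau> + 4 * C)" for s
  proof (rule ccontr)
    assume "\<not> ?thesis"
    then have "real_of_int j * \<tau> + 4 * C \<le> coord (\<lambda>s. \<alpha> (- s)) (\<beta> s)" "coord (\<lambda>s. \<alpha> (- s)) (\<beta> 0) \<le> real_of_int j * \<tau>"
      using jc by (simp_all add: c_def coord_reverse[OF ga])
    then obtain r where "dist (\<alpha> (- (real_of_int j * \<tau>))) (\<beta> r) \<le> 5 * C"
      using orbit_line_near[OF contracting_line_reverse[OF \<alpha>(1)] \<beta>(1)] by blast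
    then have "dist (\<alpha> (real_of_int (- j) * \<tau>)) (\<beta> r) \<le> 5 * C" by simp
    then show False using close[of "- j" r] B jB by fastforce
  qed
  ultimately have "\<bar>coord \<alpha> (\<beta> s)\<bar> \<le> real_of_int j * \<tau> + 4 * C" for s
    by (simp add: abs_le_iff) (smt (verit))
  then show ?thesis using that by blast
qed

end

section \<open>Half spaces of independent lines\<close>

locale independent_lines = cat0 ty for ty :: "'a::complete_space itself" +
  fixes I :: "nat set" and L :: "nat \<Rightarrow> real \<Rightarrow> 'a" and C T :: real and p :: 'a
  assumes finI: "finite I" and T: "T \<ge> 0"
    and contr: "i \<in> I \<Longrightarrow> contracting_line C (L i)" and C: "C > 0"
    and proj: "i \<in> I \<Longrightarrow> j \<in> I \<Longrightarrow> i \<noteq> j \<Longrightarrow> \<bar>coord (L i) (L j s)\<bar> \<le> T"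
begin

text \<open>\<open>D\<close> does not depend on \<open>t\<close>, which may therefore be chosen large compared to \<open>D\<close>.\<close>

definition "T' = T + 20 * C"
definition "D = 5 * C + (\<Sum>i\<in>I. dist p (L i T') + dist p (L i (- T')))"
definition "E = (\<Sum>i\<in>I. dist p (L i 0))"
definition "t = T' + 38 * C + 8 * D + 2 * E + 1"

lemma line: "i \<in> I \<Longrightarrow> geodesic_line (L i)"
  using contr by (simp add: contracting_line_def)

lemma D_bounds: "i \<in> I \<Longrightarrow> 5 * C + dist p (L i T') \<le> D" "i \<in> I \<Longrightarrow> 5 * C + dist p (L i (- T')) \<le> D" "D > 0"
proof -
  have "dist p (L i T') + dist p (L i (- T')) \<le> (\<Sum>i\<in>I. dist p (L i T') + dist p (L i (- T')))" if "i \<in> I" for i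
    using finI that by (intro member_le_sum) auto
  moreover have "0 \<le> dist p (L i T')" "0 \<le> dist p (L i (- T'))" for i by auto
  ultimately show "i \<in> I \<Longrightarrow> 5 * C + dist p (L i T') \<le> D" "i \<in> I \<Longrightarrow> 5 * C + dist p (L i (- T')) \<le> D"
    unfolding D_def by (smt (verit))+
  show "D > 0" unfolding D_def using C by (intro add_pos_nonneg sum_nonneg) auto
qed

lemma E_bound: "i \<in> I \<Longrightarrow> dist p (L i 0) \<le> E" "E \<ge> 0"
  unfolding E_def using finI by (auto intro!: member_le_sum sum_nonneg)

text \<open>Points beyond t are far out in the sense of \<open>only_one_far\<close>, even after the
  loss 34C of quasiconvexity. The last two bounds contradict closeness to p in
  \<open>few_exceptional\<close> and give the margin 4D of \<open>north_south\<close>.\<close>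

lemma t_bounds: "t \<ge> T' + 4 * C" "t > 0" "t - 34 * C \<ge> T' + 4 * C" "t - 34 * C > 6 * D + 2 * E" "t > 8 * D + 2 * E"
  unfolding t_def using D_bounds(3) E_bound(2) C T by (simp_all add: T'_def)

lemma gate_pos:
  assumes i: "i \<in> I" and "coord (L i) y \<le> T'" "T' + 4 * C \<le> coord (L i) x"
  shows "\<exists>z. btw y z x \<and> dist z p \<le> D"
proof -
  obtain z where z: "btw y z x" "dist z (L i T') \<le> 5 * C" using passes_near[OF contr[OF i] assms(2,3)] .
  have "dist z p \<le> D"
    using dist_triangle2[of z p "L i T'"] z(2) D_bounds(1)[OF i] by linarith
  then show ?thesis using z(1) by blast
qed

lemma gate_neg:
  assumes i: "i \<in> I" and "coord (L i) y \<ge> - T'" "coord (L i) x \<le> - (T' + 4 * C)"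
  shows "\<exists>z. btw y z x \<and> dist z p \<le> D"
proof -
  have "coord (\<lambda>s. L i (- s)) y \<le> T'" "T' + 4 * C \<le> coord (\<lambda>s. L i (- s)) x"
    using assms by (simp_all add: coord_reverse[OF line[OF i]])
  then obtain z where z: "btw y z x" "dist z (L i (- T')) \<le> 5 * C"
    using passes_near[OF contracting_line_reverse[OF contr[OF i]]] by blast
  have "dist z p \<le> D"
    using dist_triangle2[of z p "L i (- T')"] z(2) D_bounds(2)[OF i] by linarith
  then show ?thesis using z(1) by blast
qed

lemma only_one_far:
  assumes "i \<in> I" "j \<in> I" "i \<noteq> j" "\<bar>coord (L i) x\<bar> \<ge> T' + 4 * C"
  shows "\<bar>coord (L j) x\<bar> \<le> T'"
  unfolding T'_def
  by (rule behrstock[OF contr[OF assms(1)] contr[OF assms(2)]])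
    (use assms proj C in \<open>auto simp: T'_def\<close>)

text \<open>By Behrstock's inequality y projects close to the origin of \<open>L i\<close>, whereas
  x projects far out, so the geodesic passes near \<open>L i T'\<close> or
  \<open>L i (- T')\<close>, hence near p.\<close>

lemma gate_far:
  assumes ij: "i \<in> I" "j \<in> I" "i \<noteq> j" and x: "\<bar>coord (L i) x\<bar> \<ge> T' + 4 * C" and y: "\<bar>coord (L j) y\<bar> \<ge> T' + 4 * C"
  shows "\<exists>z. btw y z x \<and> dist z p \<le> D"
proof -
  have "\<bar>coord (L i) y\<bar> \<le> T'" using only_one_far[of j i y] ij y by blast
  then show ?thesis using gate_pos[OF ij(1), of y x] gate_neg[OF ij(1), of y x] x by (cases "coord (L i) x \<ge> 0") auto
qed

lemma coord_dist: assumes "i \<in> I" shows "\<bar>coord (L i) x\<bar> \<le> 2 * dist p x + 2 * E"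
proof -
  have "\<bar>coord (L i) x\<bar> \<le> 2 * dist x (L i 0)" using coord_close[OF line[OF assms], of x 0] by simp
  also have "\<dots> \<le> 2 * (dist p x + dist p (L i 0))"
    using dist_triangle3[of x "L i 0" p] by simp
  also have "\<dots> \<le> 2 * dist p x + 2 * E" using E_bound(1)[OF assms] by simp
  finally show ?thesis .
qed

text \<open>Half spaces at the two ends of \<open>L i\<close>, attracting and repelling for a
  translation along the line by more than 2t.\<close>

definition "A i = {x. coord (L i) x > t}"
definition "R i = {x. coord (L i) x < - t}"

lemma gate_RA: assumes "i \<in> I" "j \<in> I" shows "gate D p (R i) (A j)"
  unfolding gate_def
proof (intro ballI)
  fix x y assume x: "x \<in> R i" and y: "y \<in> A j"
  have T'0: "T' \<ge> 0" using T C by (simp add: T'_def)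
  show "\<exists>z. btw x z y \<and> dist z p \<le> D"
  proof (cases "i = j")
    case True
    then show ?thesis using x y t_bounds(1,2) T'0 by (intro gate_pos[OF assms(2)]) (auto simp: A_def R_def)
  next
    case False
    then show ?thesis using x y t_bounds(1,2) assms by (intro gate_far[of j i]) (auto simp: A_def R_def)
  qed
qed

lemma A_R_disjoint: assumes "i \<in> I" "j \<in> I" shows "A i \<inter> R j = {}"
proof (cases "i = j")
  case False
  have "x \<notin> R j" if "x \<in> A i" for x
    using only_one_far[OF assms False, of x] that t_bounds(1,2) C by (auto simp: A_def R_def)
  then show ?thesis by blast
qed (use t_bounds in \<open>auto simp: A_def R_def\<close>)

lemma not_card_le_1:
  assumes "finite S" "\<not> card S \<le> 1" shows "\<exists>a\<in>S. \<exists>b\<in>S. a \<noteq> b"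
  using assms card_le_Suc0_iff_eq[of S] by auto

text \<open>Geodesics between \<open>A a\<close> and \<open>A b\<close> pass near \<open>p\<close> and half spaces are quasiconvex, so \<open>v p\<close> is close to
  \<open>R s\<close> if \<open>R s\<close> meets both \<open>v ` A a\<close> and \<open>v ` A b\<close>; this cannot happen for two values of \<open>s\<close>.\<close>

lemma exceptional_near:
  assumes v: "isometry v" and s: "s \<in> I" "\<not> card {a \<in> I. v ` A a \<inter> R s \<noteq> {}} \<le> 1"
  shows "\<exists>q. dist q (v p) \<le> D \<and> coord (L s) q \<le> - (t - 34 * C)"
proof -
  obtain a b where ab: "a \<in> I" "b \<in> I" "a \<noteq> b" "v ` A a \<inter> R s \<noteq> {}" "v ` A b \<inter> R s \<noteq> {}"
    using not_card_le_1[OF _ s(2)] finI by fastforce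
  then obtain x y where xy: "x \<in> A a" "v x \<in> R s" "y \<in> A b" "v y \<in> R s" by blast
  then obtain z where z: "btw x z y" "dist z p \<le> D"
    using gate_far[of b a y x] ab t_bounds(1,2) by (auto simp: A_def)
  have "coord (\<lambda>u. L s (- u)) (v z) \<ge> (t - 4 * C) - 30 * C"
  proof (rule halfspace_quasiconvex[OF contracting_line_reverse[OF contr[OF s(1)]]])
    show "btw (v x) (v z) (v y)" using z(1) by (simp add: isometry_btw[OF v])
  qed (use xy in \<open>auto simp: coord_reverse[OF line[OF s(1)]] R_def\<close>)
  then have "coord (L s) (v z) \<le> - (t - 34 * C)" by (simp add: coord_reverse[OF line[OF s(1)]])
  moreover have "dist (v z) (v p) \<le> D" using z(2) by (simp add: isometry_dist[OF v])
  ultimately show ?thesis by blast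
qed

text \<open>Two exceptional letters give points q and q' near v p and far out on different lines.
  The geodesic between them is short and passes near p, so q is within 3D of p, against
  \<open>t_bounds\<close>.\<close>

lemma few_exceptional:
  assumes v: "isometry v"
  shows "card {s \<in> I. \<not> card {a \<in> I. v ` A a \<inter> R s \<noteq> {}} \<le> 1} \<le> 1"
proof (rule ccontr)
  assume "\<not> ?thesis"
  then obtain s s' where s: "s \<in> I" "s' \<in> I" "s \<noteq> s'"
    "\<not> card {a \<in> I. v ` A a \<inter> R s \<noteq> {}} \<le> 1" "\<not> card {a \<in> I. v ` A a \<inter> R s' \<noteq> {}} \<le> 1"
    using not_card_le_1[of "{s \<in> I. \<not> card {a \<in> I. v ` A a \<inter> R s \<noteq> {}} \<le> 1}"] finI by fastforce
  obtain q where q: "dist q (v p) \<le> D" "coord (L s) q \<le> - (t - 34 * C)"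
    using exceptional_near[OF v s(1,4)] by blast
  obtain q' where q': "dist q' (v p) \<le> D" "coord (L s') q' \<le> - (t - 34 * C)"
    using exceptional_near[OF v s(2,5)] by blast
  have "\<bar>coord (L s) q\<bar> \<ge> T' + 4 * C" "\<bar>coord (L s') q'\<bar> \<ge> T' + 4 * C"
    using q(2) q'(2) t_bounds(3) by linarith+
  then obtain z where z: "btw q' z q" "dist z p \<le> D" using gate_far[OF s(1-3)] by blast
  have "dist z q \<le> dist q' q" using z(1) zero_le_dist[of q' z] unfolding btw_def by linarith
  moreover have "dist q' q \<le> 2 * D" using dist_triangle2[of q' q "v p"] q(1) q'(1) by linarith
  moreover have "dist p q \<le> dist z p + dist z q" by (rule dist_triangle3)
  ultimately have "dist p q \<le> 3 * D" using z(2) by linarith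
  then have "\<bar>coord (L s) q\<bar> \<le> 6 * D + 2 * E" using coord_dist[OF s(1), of q] by linarith
  then show False using q(2) t_bounds(4) by linarith
qed

lemma contracting_pong:
  assumes f: "isometry f" and ij: "i \<in> I" "j \<in> I" and map: "\<And>x. x \<notin> R i \<Longrightarrow> f x \<in> A j"
  shows "contracting f"
proof -
  have far: "dist p x > 4 * D" if "\<bar>coord (L i) x\<bar> > t" "i \<in> I" for x i
    using coord_dist[OF that(2), of x] that(1) t_bounds(5) by linarith
  interpret north_south ty f p D "R i" "A j"
  proof
    show "dist p x > 4 * D" if "x \<in> R i" for x
      by (rule far[OF _ ij(1)]) (use that t_bounds(2) in \<open>simp add: R_def\<close>)
    show "dist p x > 4 * D" if "x \<in> A j" for x
      by (rule far[OF _ ij(2)]) (use that t_bounds(2) in \<open>simp add: A_def\<close>)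
  qed (use f map D_bounds gate_RA[OF ij] in auto)
  show ?thesis by (rule contracting_f)
qed

text \<open>A translation by more than 2t carries every coordinate that is at least -t beyond t. The
  exponents may depend on i, so that the numbers of walk steps can be equalised later.\<close>

lemma schottky_powers:
  assumes card: "card I \<ge> 32"
    and k: "\<And>i. i \<in> I \<Longrightarrow> isometry (k i)" "\<And>i s. i \<in> I \<Longrightarrow> k i (L i s) = L i (s + \<tau>)" "\<tau> > 0"
    and n: "\<And>i. i \<in> I \<Longrightarrow> real (n i) * \<tau> > 2 * t"
  shows "schottky I (\<lambda>i. k i ^^ n i) A R contracting"
proof
  show "(k i ^^ n i) x \<in> A i" if i: "i \<in> I" "x \<notin> R i" for i x
  proof -
    have "coord (L i) ((k i ^^ n i) x) = coord (L i) x + real (n i) * \<tau>"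
      by (rule coord_translation[OF line[OF i(1)] isometry_funpow[OF k(1)[OF i(1)]]])
        (rule translation_funpow[where \<gamma> = "L i", OF k(1)[OF i(1)] k(2)[OF i(1)]])
    then show ?thesis using i n[OF i(1)] by (simp add: A_def R_def)
  qed
  show "isometry (k i ^^ n i)" if "i \<in> I" for i by (rule isometry_funpow[OF k(1)[OF that]])
qed (use finI card A_R_disjoint few_exceptional contracting_pong contracting_rotate in auto)

end

lemma (in cat0) schottky_exists:
  fixes g h :: "'a \<Rightarrow> 'a"
  assumes g: "contracting g" and h: "contracting h"
    and fin: "\<And>x K. finite {(m, n). dist (zpow g m x) (zpow h n x) \<le> K}"
    and card: "finite I" "card I \<ge> 32"
  shows "\<exists>m n\<^sub>0 A R. \<forall>n. (\<forall>i\<in>I. n\<^sub>0 \<le> n i) \<longrightarrow> schottky I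
      (\<lambda>i. (zpow g (int (i * m)) \<circ> h \<circ> inv_into UNIV (zpow g (int (i * m)))) ^^ n i) A R contracting"
proof -
  have ig: "isometry g" and ih: "isometry h" using g h by (simp_all add: contracting_def axial_def)
  obtain \<alpha> \<tau> C1 where \<alpha>: "contracting_line C1 \<alpha>" "\<tau> > 0" "\<And>s. g (\<alpha> s) = \<alpha> (s + \<tau>)"
    using contracting_axisE[OF g] by metis
  obtain \<beta> \<sigma> C2 where \<beta>: "contracting_line C2 \<beta>" "\<sigma> > 0" "\<And>s. h (\<beta> s) = \<beta> (s + \<sigma>)"
    using contracting_axisE[OF h] by metis
  define C where "C = max C1 C2"
  have c: "contracting_line C \<alpha>" "contracting_line C \<beta>" "C > 0"
    using contracting_line_mono[OF \<alpha>(1), of C] contracting_line_mono[OF \<beta>(1), of C]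
    by (auto simp: C_def) (auto simp: contracting_line_def)
  have ga: "geodesic_line \<alpha>" and gb: "geodesic_line \<beta>" using c by (simp_all add: contracting_line_def)
  obtain T1 where T1: "\<And>s. \<bar>coord \<alpha> (\<beta> s)\<bar> \<le> T1"
    using bounded_projection[OF c(1) \<alpha>(2) ig \<alpha>(3) gb \<beta>(2) ih \<beta>(3) fin] by metis
  have fin': "finite {(m, n). dist (zpow h m x) (zpow g n x) \<le> K}" for x K
  proof -
    have "{(m, n). dist (zpow h m x) (zpow g n x) \<le> K} = prod.swap ` {(m, n). dist (zpow g m x) (zpow h n x) \<le> K}"
      by (auto simp: dist_commute image_iff)
    then show ?thesis using fin by simp
  qed
  obtain T2 where T2: "\<And>s. \<bar>coord \<beta> (\<alpha> s)\<bar> \<le> T2"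
    using bounded_projection[OF c(2) \<beta>(2) ih \<beta>(3) ga \<alpha>(2) ig \<alpha>(3) fin'] by metis
  define T where "T = max T1 T2"
  have T: "\<And>s. \<bar>coord \<alpha> (\<beta> s)\<bar> \<le> T" "\<And>s. \<bar>coord \<beta> (\<alpha> s)\<bar> \<le> T" "T \<ge> 0"
    using T1 T2 unfolding T_def by (auto simp: le_max_iff_disj intro: order_trans[OF abs_ge_zero])
  \<comment> \<open>A shift by a nonzero multiple of m moves the projection of \<beta> to \<alpha>,
    which lies in [-T, T], beyond T + 4C on one side. Then \<open>behrstock\<close> bounds the
    projection of the shifted line to \<beta>.\<close>
  obtain m :: nat where m: "real m * \<tau> > 2 * T + 4 * C" using reals_Archimedean3[OF \<alpha>(2)] by blast
  define w where "w i = zpow g (int (i * m))" for i :: nat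
  have w: "isometry (w i)" for i unfolding w_def by (rule isometry_zpow[OF ig])
  have winv: "inv_into UNIV (w i) (w j x) = zpow g (int (j * m) - int (i * m)) x" for i j x
  proof -
    have "w i (zpow g (int (j * m) - int (i * m)) x) = w j x"
      unfolding w_def by (subst zpow_add[OF ig, symmetric]) simp
    then show ?thesis using isometry_inv_simps(2)[OF w, of i] by metis
  qed
  interpret independent_lines ty I "\<lambda>i. w i \<circ> \<beta>" C "T + 20 * C" "\<alpha> 0"
  proof
    show "contracting_line C (w i \<circ> \<beta>)" for i
      using c(2) contracting_set_image[OF w, of C "range \<beta>"]
      by (auto simp: contracting_line_def geodesic_line_def isometry_dist[OF w] image_comp)
    show "\<bar>coord (w i \<circ> \<beta>) ((w j \<circ> \<beta>) s)\<bar> \<le> T + 20 * C" if "i \<noteq> j" for i j s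
    proof -
      define l where "l = int (j * m) - int (i * m)"
      have "l = (int j - int i) * int m" by (simp add: l_def left_diff_distrib)
      then have "\<bar>l\<bar> = \<bar>int j - int i\<bar> * int m" by (simp add: abs_mult)
      moreover have "1 * int m \<le> \<bar>int j - int i\<bar> * int m" using that by (intro mult_right_mono) auto
      ultimately have "int m \<le> \<bar>l\<bar>" by simp
      then have l: "\<bar>real_of_int l\<bar> \<ge> real m" by linarith
      let ?y = "zpow g l (\<beta> s)"
      have "w j (\<beta> s) = w i ?y"
        using winv[of i j "\<beta> s"] isometry_inv_simps(1)[OF w, of i "w j (\<beta> s)"] by (simp add: l_def)
      then have e: "coord (w i \<circ> \<beta>) ((w j \<circ> \<beta>) s) = coord \<beta> ?y" using coord_isometry[OF gb w] by simp
      have "coord \<alpha> ?y = coord \<alpha> (\<beta> s) + real_of_int l * \<tau>"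
        by (rule coord_translation[OF ga isometry_zpow[OF ig]])
          (rule zpow_translation[where \<gamma> = \<alpha>, OF ig \<alpha>(3)])
      moreover have "\<bar>real_of_int l * \<tau>\<bar> \<ge> real m * \<tau>"
        using l \<alpha>(2) by (simp add: abs_mult mult_right_mono)
      ultimately have "\<bar>coord \<alpha> ?y\<bar> \<ge> T + 4 * C" using T(1)[of s] m by linarith
      then show ?thesis unfolding e by (rule behrstock[OF c(1,2) T(1,2)])
    qed
  qed (use card T c in auto)
  obtain n\<^sub>0 :: nat where n0: "real n\<^sub>0 * \<sigma> > 2 * t" using reals_Archimedean3[OF \<beta>(2)] by blast
  show ?thesis
  proof (intro exI allI impI)
    fix n :: "nat \<Rightarrow> nat" assume n: "\<forall>i\<in>I. n\<^sub>0 \<le> n i"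
    show "schottky I (\<lambda>i. (zpow g (int (i * m)) \<circ> h \<circ> inv_into UNIV (zpow g (int (i * m)))) ^^ n i) A R contracting"
      unfolding w_def[symmetric]
    proof (rule schottky_powers[OF card(2) _ _ \<beta>(2)])
      show "isometry (w i \<circ> h \<circ> inv_into UNIV (w i))" for i
        by (intro isometry_comp w ih isometry_inv)
      show "(w i \<circ> h \<circ> inv_into UNIV (w i)) ((w i \<circ> \<beta>) s) = (w i \<circ> \<beta>) (s + \<sigma>)" for i s
        by (simp add: isometry_inv_simps[OF w] \<beta>(3))
      show "real (n i) * \<sigma> > 2 * t" if "i \<in> I" for i
      proof -
        have "real n\<^sub>0 * \<sigma> \<le> real (n i) * \<sigma>" using n that \<beta>(2) by (intro mult_right_mono) auto
        then show ?thesis using n0 by linarith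
      qed
    qed
  qed
qed

section \<open>Random walks\<close>

lemma measure_bind_pmf:
  "measure (bind_pmf p f) X = (\<integral>x. measure (f x) X \<partial>measure_pmf p)"
proof -
  have "ennreal (measure (bind_pmf p f) X) = (\<integral>\<^sup>+x. ennreal (measure (f x) X) \<partial>measure_pmf p)"
    by (simp flip: measure_pmf.emeasure_eq_measure)
  also have "\<dots> = ennreal (\<integral>x. measure (f x) X \<partial>measure_pmf p)"
    by (intro nn_integral_eq_integral measure_pmf.integrable_const_bound[where B = 1])
      (auto intro: measure_pmf.prob_le_1)
  finally show ?thesis by (subst (asm) ennreal_inj) (auto intro: integral_nonneg_AE)
qed

lemma pmf_mult_le_expectation:
  fixes r :: "'c \<Rightarrow> real"
  assumes r: "\<And>y. y \<in> set_pmf p \<Longrightarrow> 0 \<le> r y" "\<And>y. y \<in> set_pmf p \<Longrightarrow> r y \<le> B"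
    and x: "x \<in> set_pmf p"
  shows "pmf p x * r x \<le> (\<integral>y. r y \<partial>measure_pmf p)"
proof -
  have "(\<integral>y. r x * indicator {x} y \<partial>measure_pmf p) \<le> (\<integral>y. r y \<partial>measure_pmf p)"
  proof (rule integral_mono_AE)
    show "integrable (measure_pmf p) r"
      by (rule measure_pmf.integrable_const_bound[where B = B]) (use r in \<open>auto simp: AE_measure_pmf_iff\<close>)
    show "AE y in measure_pmf p. r x * indicator {x} y \<le> r y"
      using r by (auto simp: AE_measure_pmf_iff indicator_def)
    show "integrable (measure_pmf p) (\<lambda>y. r x * indicator {x} y)"
      by (rule measure_pmf.integrable_const_bound[where B = "\<bar>r x\<bar>"]) (auto simp: indicator_def)
  qed
  then show ?thesis by (simp add: pmf.rep_eq mult.commute)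
qed

context schottky
begin

lemma N_pos: "real (card I) > 0"
  using cardI by simp

lemma slots_avg_bounds:
  assumes "\<And>x. 0 \<le> \<phi> x" "\<And>x. \<phi> x \<le> 1" shows "0 \<le> slots_avg ws \<phi> y \<and> slots_avg ws \<phi> y \<le> 1"
proof (induction ws arbitrary: y)
  case (Cons w ws)
  have "(\<Sum>b\<in>I. \<Sum>a\<in>I. slots_avg ws \<phi> (y \<circ> F a \<circ> F b \<circ> w)) \<le> (\<Sum>b\<in>I. \<Sum>a\<in>I. 1)"
    using Cons by (intro sum_mono) auto
  then have "(\<Sum>b\<in>I. \<Sum>a\<in>I. slots_avg ws \<phi> (y \<circ> F a \<circ> F b \<circ> w)) \<le> (real (card I))\<^sup>2"
    by (simp add: power2_eq_square)
  moreover have "0 \<le> (\<Sum>b\<in>I. \<Sum>a\<in>I. slots_avg ws \<phi> (y \<circ> F a \<circ> F b \<circ> w))"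
    using Cons by (intro sum_nonneg) auto
  ultimately show ?case using N_pos by simp
qed (use assms in simp)

lemma slots_avg_append: "slots_avg (ws @ vs) \<phi> y = slots_avg ws (slots_avg vs \<phi>) y"
  by (induction ws arbitrary: y) simp_all

text \<open>A fixed suffix z is absorbed by the last word of ws, or by y if there is none, so bounds
  on slots hold uniformly in z.\<close>

lemma slots_avg_post:
  assumes "\<forall>w\<in>set ws. isometry w" "isometry y" "isometry z"
  obtains ws' y' where "\<forall>w\<in>set ws'. isometry w" "isometry y'" "length ws' = length ws"
    "\<And>\<phi>. slots_avg ws (\<lambda>x. \<phi> (x \<circ> z)) y = slots_avg ws' \<phi> y'"
proof (cases ws rule: rev_cases)
  case Nil
  then show ?thesis using that[of "[]" "y \<circ> z"] assms by (simp add: isometry_comp del: comp_apply)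
next
  case (snoc vs w)
  show ?thesis
  proof (rule that[of "vs @ [w \<circ> z]" y])
    show "slots_avg ws (\<lambda>x. \<phi> (x \<circ> z)) y = slots_avg (vs @ [w \<circ> z]) \<phi> y" for \<phi>
      by (simp add: snoc slots_avg_append comp_assoc del: comp_apply)
  qed (use assms snoc in \<open>auto simp: isometry_comp simp del: comp_apply\<close>)
qed

lemma integrable_bounded:
  "(\<And>x. 0 \<le> f x) \<Longrightarrow> (\<And>x. f x \<le> 1) \<Longrightarrow> integrable (measure_pmf p) (f :: _ \<Rightarrow> real)"
  by (rule measure_pmf.integrable_const_bound[where B = 1]) auto

lemma slots_avg_integral:
  assumes "\<And>g x. 0 \<le> \<phi> g x" "\<And>g x. \<phi> g x \<le> 1"
  shows "slots_avg ws (\<lambda>x. \<integral>g. \<phi> g x \<partial>measure_pmf p) y = (\<integral>g. slots_avg ws (\<phi> g) y \<partial>measure_pmf p)"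
proof (induction ws arbitrary: y)
  case (Cons w ws)
  have i: "integrable (measure_pmf p) (\<lambda>g. slots_avg ws (\<phi> g) z)" for z
    using slots_avg_bounds[of "\<phi> _"] assms by (intro integrable_bounded) auto
  then have "(\<integral>g. slots_avg (w # ws) (\<phi> g) y \<partial>measure_pmf p)
      = (\<Sum>b\<in>I. \<Sum>a\<in>I. \<integral>g. slots_avg ws (\<phi> g) (y \<circ> F a \<circ> F b \<circ> w) \<partial>measure_pmf p) / (card I)\<^sup>2"
    by (simp add: Bochner_Integration.integral_sum del: comp_apply)
  moreover have "slots_avg (w # ws) (\<lambda>x. \<integral>g. \<phi> g x \<partial>measure_pmf p) y
      = (\<Sum>b\<in>I. \<Sum>a\<in>I. \<integral>g. slots_avg ws (\<phi> g) (y \<circ> F a \<circ> F b \<circ> w) \<partial>measure_pmf p) / (card I)\<^sup>2"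
    using Cons by (simp del: comp_apply)
  ultimately show ?case by (simp only:)
qed simp

lemma slots_avg_sum: "slots_avg ws (\<lambda>u. \<Sum>i\<in>S. \<phi> i u) y = (\<Sum>i\<in>S. slots_avg ws (\<phi> i) y)"
proof (induction ws arbitrary: y)
  case (Cons w ws)
  then show ?case by (simp add: sum.swap[of _ S] del: comp_apply flip: sum_divide_distrib)
qed simp

lemma slots_avg_divide: "slots_avg ws (\<lambda>u. \<phi> u / d) y = slots_avg ws \<phi> y / d"
proof (induction ws arbitrary: y)
  case (Cons w ws)
  then show ?case by (simp add: mult.commute del: comp_apply flip: sum_divide_distrib)
qed simp

end

text \<open>\<open>V n\<close> is the law of the isometry after n steps: \<open>V_add\<close>
  expresses independent increments, and by \<open>V_slot\<close> each slot has positive probability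
  in a block of M steps.\<close>

locale schottky_walk = schottky I F A R good_map
  for I :: "nat set" and F :: "nat \<Rightarrow> 'a::metric_space \<Rightarrow> 'a" and A R and good_map +
  fixes V :: "nat \<Rightarrow> ('a \<Rightarrow> 'a) pmf" and M :: nat
  assumes M: "M > 0" and V_iso: "f \<in> set_pmf (V n) \<Longrightarrow> isometry f"
    and V_add: "V (m + n) = bind_pmf (V m) (\<lambda>f. map_pmf ((\<circ>) f) (V n))"
    and V_slot: "a \<in> I \<Longrightarrow> b \<in> I \<Longrightarrow> F a \<circ> F b \<in> set_pmf (V M)"
begin

definition fail_prob :: "nat \<Rightarrow> ('a \<Rightarrow> 'a) \<Rightarrow> real" where
  "fail_prob n u = measure (V n) {f. \<not> good_map (u \<circ> f)}"

lemma fail_prob_bounds: "0 \<le> fail_prob n u" "fail_prob n u \<le> 1"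
  by (simp_all add: fail_prob_def measure_pmf.prob_le_1)

lemma fail_prob_add: "fail_prob (m + n) u = (\<integral>f. fail_prob n (u \<circ> f) \<partial>measure_pmf (V m))"
  unfolding fail_prob_def V_add measure_bind_pmf by (simp add: vimage_def comp_assoc del: comp_apply)

lemma fail_prob_bad: "fail_prob n u = (\<integral>f. bad (u \<circ> f) \<partial>measure_pmf (V n))"
proof -
  have "bad (u \<circ> f) = indicator {f. \<not> good_map (u \<circ> f)} f" for f by (simp add: bad_def)
  then show ?thesis by (simp add: fail_prob_def)
qed

text \<open>The law \<open>V M\<close> dominates c times the uniform law of the slots. Different
  pairs (a, b) may give the same map, so the factor is c and not c times the number of
  pairs.\<close>

definition c :: real where
  "c = Min ((\<lambda>(a, b). pmf (V M) (F a \<circ> F b)) ` (I \<times> I))"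

lemma I_ne: "I \<noteq> {}"
  using cardI by auto

lemma c_le: "a \<in> I \<Longrightarrow> b \<in> I \<Longrightarrow> c \<le> pmf (V M) (F a \<circ> F b)"
  unfolding c_def using finI by (intro Min_le) auto

lemma c_bounds: "0 < c" "c \<le> 1"
proof -
  have "c \<in> (\<lambda>(a, b). pmf (V M) (F a \<circ> F b)) ` (I \<times> I)"
    unfolding c_def using finI I_ne by (intro Min_in) auto
  then obtain a b where "a \<in> I" "b \<in> I" "c = pmf (V M) (F a \<circ> F b)" by auto
  then show "0 < c" "c \<le> 1" using V_slot pmf_positive pmf_le_1 by metis+
qed

text \<open>With weight c the block is a uniform slot and the bound improves to 3/4 of \<kappa>;
  otherwise it stays \<kappa>. In total 3/4 c + (1 - c) = 1 - c/4.\<close>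

lemma block_step:
  assumes q: "\<And>f. isometry f \<Longrightarrow> 0 \<le> q f \<and> q f \<le> \<kappa>"
    and avg: "(\<Sum>b\<in>I. \<Sum>a\<in>I. q (F a \<circ> F b)) / (card I)\<^sup>2 \<le> 3 / 4 * \<kappa>"
  shows "(\<integral>f. q f \<partial>measure_pmf (V M)) \<le> \<kappa> * (1 - c / 4)"
proof -
  let ?E = "\<integral>f. \<kappa> - q f \<partial>measure_pmf (V M)"
  have "c * (\<kappa> - q (F a \<circ> F b)) \<le> ?E" if "a \<in> I" "b \<in> I" for a b
  proof -
    have "c * (\<kappa> - q (F a \<circ> F b)) \<le> pmf (V M) (F a \<circ> F b) * (\<kappa> - q (F a \<circ> F b))"
      using c_le[OF that] q[OF V_iso[OF V_slot[OF that]]] by (intro mult_right_mono) auto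
    also have "\<dots> \<le> ?E"
      by (rule pmf_mult_le_expectation[where B = \<kappa>]) (use q V_iso V_slot that in \<open>auto simp del: comp_apply\<close>)
    finally show ?thesis .
  qed
  then have "(\<Sum>b\<in>I. \<Sum>a\<in>I. c * (\<kappa> - q (F a \<circ> F b))) \<le> (\<Sum>b\<in>I. \<Sum>a\<in>I. ?E)"
    by (intro sum_mono) auto
  also have "\<dots> = (real (card I))\<^sup>2 * ?E" by (simp add: power2_eq_square)
  also have "(\<Sum>b\<in>I. \<Sum>a\<in>I. c * (\<kappa> - q (F a \<circ> F b)))
      = c * ((real (card I))\<^sup>2 * \<kappa> - (\<Sum>b\<in>I. \<Sum>a\<in>I. q (F a \<circ> F b)))"
    by (simp add: sum_subtractf power2_eq_square flip: sum_distrib_left)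
  finally have E: "c * ((real (card I))\<^sup>2 * \<kappa> - (\<Sum>b\<in>I. \<Sum>a\<in>I. q (F a \<circ> F b))) \<le> (real (card I))\<^sup>2 * ?E" .
  have N: "(real (card I))\<^sup>2 > 0" using N_pos by simp
  have "(\<Sum>b\<in>I. \<Sum>a\<in>I. q (F a \<circ> F b)) \<le> 3 / 4 * \<kappa> * (real (card I))\<^sup>2"
    using avg N by (simp add: divide_le_eq)
  then have "c * ((real (card I))\<^sup>2 * (\<kappa> / 4))
      \<le> c * ((real (card I))\<^sup>2 * \<kappa> - (\<Sum>b\<in>I. \<Sum>a\<in>I. q (F a \<circ> F b)))"
    using c_bounds by (intro mult_left_mono) auto
  with E have "(real (card I))\<^sup>2 * (c * \<kappa> / 4) \<le> (real (card I))\<^sup>2 * ?E"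
    by (simp add: mult_ac)
  then have "c * \<kappa> / 4 \<le> ?E" using mult_le_cancel_left_pos[OF N] by blast
  moreover have "?E = \<kappa> - (\<integral>f. q f \<partial>measure_pmf (V M))"
  proof -
    have "integrable (measure_pmf (V M)) q"
      by (rule measure_pmf.integrable_const_bound[where B = \<kappa>]) (use q V_iso in \<open>auto simp: AE_measure_pmf_iff\<close>)
    then show ?thesis by simp
  qed
  ultimately show ?thesis by (simp add: algebra_simps)
qed

text \<open>The induction over the k unread blocks is generalised over the slots ws already formed.
  A fixed block is absorbed as a suffix, and a uniform slot extends ws by the word
  \<open>id\<close>. The r leftover steps are absorbed in the base case.\<close>

lemma slots_avg_fail_prob:
  "\<forall>w\<in>set ws. isometry w \<Longrightarrow> isometry y \<Longrightarrow>
    slots_avg ws (fail_prob (M * k + r)) y \<le> 2 * (3 / 4) ^ length ws * (1 - c / 4) ^ k"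
proof (induction k arbitrary: ws y)
  case 0
  have "fail_prob r = (\<lambda>u. \<integral>f. bad (u \<circ> f) \<partial>measure_pmf (V r))" by (rule ext) (rule fail_prob_bad)
  then have "slots_avg ws (fail_prob r) y = (\<integral>f. slots_avg ws (\<lambda>u. bad (u \<circ> f)) y \<partial>measure_pmf (V r))"
    using slots_avg_integral[of "\<lambda>f u. bad (u \<circ> f)"] by (simp add: bad_def del: comp_apply)
  also have "\<dots> \<le> 2 * (3 / 4) ^ length ws"
  proof (rule measure_pmf.integral_le_const)
    show "integrable (measure_pmf (V r)) (\<lambda>f. slots_avg ws (\<lambda>u. bad (u \<circ> f)) y)"
      using slots_avg_bounds[of "\<lambda>u. bad (u \<circ> _)"] by (intro integrable_bounded) (auto simp: bad_def)
    show "AE f in measure_pmf (V r). slots_avg ws (\<lambda>u. bad (u \<circ> f)) y \<le> 2 * (3 / 4) ^ length ws"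
    proof (rule AE_pmfI)
      fix f assume "f \<in> set_pmf (V r)"
      then obtain ws' y' where e: "\<forall>w\<in>set ws'. isometry w" "isometry y'" "length ws' = length ws"
        "\<And>\<phi>. slots_avg ws (\<lambda>x. \<phi> (x \<circ> f)) y = slots_avg ws' \<phi> y'"
        using slots_avg_post[OF 0 V_iso] by metis
      show "slots_avg ws (\<lambda>u. bad (u \<circ> f)) y \<le> 2 * (3 / 4) ^ length ws"
        unfolding e(4) using slots_avg_bad[OF e(1,2)] e(3) by simp
    qed
  qed
  finally show ?case by simp
next
  case (Suc k)
  let ?H = "fail_prob (M * k + r)" and ?\<kappa> = "2 * (3 / 4) ^ length ws * (1 - c / 4) ^ k"
  have "fail_prob (M * Suc k + r) = fail_prob (M + (M * k + r))" by (simp add: algebra_simps)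
  also have "\<dots> = (\<lambda>u. \<integral>f. ?H (u \<circ> f) \<partial>measure_pmf (V M))" by (rule ext) (rule fail_prob_add)
  finally have "slots_avg ws (fail_prob (M * Suc k + r)) y = (\<integral>f. slots_avg ws (\<lambda>u. ?H (u \<circ> f)) y \<partial>measure_pmf (V M))"
    using slots_avg_integral[of "\<lambda>f u. ?H (u \<circ> f)"] by (simp add: fail_prob_bounds del: comp_apply)
  also have "\<dots> \<le> ?\<kappa> * (1 - c / 4)"
  proof (rule block_step)
    fix f :: "'a \<Rightarrow> 'a" assume f: "isometry f"
    obtain ws' y' where e: "\<forall>w\<in>set ws'. isometry w" "isometry y'" "length ws' = length ws"
      "\<And>\<phi>. slots_avg ws (\<lambda>x. \<phi> (x \<circ> f)) y = slots_avg ws' \<phi> y'"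
      using slots_avg_post[OF Suc.prems f] by metis
    show "0 \<le> slots_avg ws (\<lambda>u. ?H (u \<circ> f)) y \<and> slots_avg ws (\<lambda>u. ?H (u \<circ> f)) y \<le> ?\<kappa>"
      unfolding e(4) using Suc.IH[OF e(1,2)] e(3) slots_avg_bounds[of ?H ws' y'] fail_prob_bounds by simp
  next
    have "(\<Sum>b\<in>I. \<Sum>a\<in>I. slots_avg ws (\<lambda>u. ?H (u \<circ> (F a \<circ> F b))) y) / (card I)\<^sup>2 = slots_avg (ws @ [id]) ?H y"
      by (simp add: slots_avg_append slots_avg_sum slots_avg_divide comp_assoc del: comp_apply)
    also have "\<dots> \<le> 2 * (3 / 4) ^ length (ws @ [id]) * (1 - c / 4) ^ k"
      using Suc.prems by (intro Suc.IH) (auto simp: isometry_id)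
    finally show "(\<Sum>b\<in>I. \<Sum>a\<in>I. slots_avg ws (\<lambda>u. ?H (u \<circ> (F a \<circ> F b))) y) / (card I)\<^sup>2 \<le> 3 / 4 * ?\<kappa>"
      by (simp add: mult_ac)
  qed
  finally show ?case by (simp add: mult_ac)
qed

lemma exponential_bound:
  "\<exists>\<rho> K. 0 < \<rho> \<and> \<rho> < 1 \<and> 0 < K \<and> (\<forall>n. measure (V n) {f. \<not> good_map f} \<le> K * \<rho> ^ n)"
proof -
  define l where "l = 1 - c / 4"
  have l: "0 < l" "l < 1" using c_bounds by (simp_all add: l_def)
  define \<rho> where "\<rho> = root M l"
  have \<rho>: "0 < \<rho>" "\<rho> < 1" "\<rho> ^ M = l"
    using l M by (simp_all add: \<rho>_def real_root_pow_pos2)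
  have "measure (V n) {f. \<not> good_map f} \<le> (2 / l) * \<rho> ^ n" for n
  proof -
    have "measure (V n) {f. \<not> good_map f} = slots_avg [] (fail_prob (M * (n div M) + n mod M)) id"
      by (simp add: fail_prob_def)
    also have "\<dots> \<le> 2 * l ^ (n div M)"
      using slots_avg_fail_prob[of "[]" id "n div M" "n mod M"] by (simp add: isometry_id l_def)
    \<comment> \<open>Rounding n up to a full number of blocks costs the factor 1/l.\<close>
    also have "\<dots> = (2 / l) * \<rho> ^ (M * Suc (n div M))" using l by (simp only: power_mult \<rho>(3)) simp
    also have "\<dots> \<le> (2 / l) * \<rho> ^ n"
    proof (intro mult_left_mono power_decreasing)
      show "n \<le> M * Suc (n div M)" using M dividend_less_times_div[of M n] by simp
    qed (use l \<rho> in auto)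
    finally show ?thesis .
  qed
  then show ?thesis using \<rho> l by (intro exI[of _ \<rho>] exI[of _ "2 / l"]) auto
qed

end

section \<open>The law of the walk\<close>

definition step_law :: "'g measure \<Rightarrow> 'g pmf" where
  "step_law \<mu> = Abs_pmf (distr \<mu> (count_space UNIV) (\<lambda>x. x))"

primrec walk_law :: "('g, 'b) monoid_scheme \<Rightarrow> 'g measure \<Rightarrow> nat \<Rightarrow> 'g pmf" where
  "walk_law G \<mu> 0 = return_pmf \<one>\<^bsub>G\<^esub>"
| "walk_law G \<mu> (Suc n) = bind_pmf (step_law \<mu>) (\<lambda>g. map_pmf (\<lambda>x. x \<otimes>\<^bsub>G\<^esub> g) (walk_law G \<mu> n))"

locale group_walk = group G for G :: "('g, 'b) monoid_scheme" (structure) +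
  fixes \<mu> :: "'g measure"
  assumes countable_carrier: "countable (carrier G)" and prob: "prob_measure_on G \<mu>"
begin

sublocale prob_space \<mu>
  using prob by (simp add: prob_measure_on_def)

lemma sets_mu: "sets \<mu> = Pow (carrier G)"
  using prob by (simp add: prob_measure_on_def)

lemma space_mu: "space \<mu> = carrier G"
  using sets_eq_imp_space_eq[of \<mu> "count_space (carrier G)"] sets_mu by simp

lemma measurable_mu: "f \<in> measurable \<mu> N \<longleftrightarrow> f \<in> carrier G \<rightarrow> space N"
  unfolding measurable_def by (auto simp: space_mu sets_mu)

text \<open>A pmf must be concentrated on its atoms. The elements of mass zero are countably many,
  so together they form a null set.\<close>

lemma measure_step_law: "measure_pmf (step_law \<mu>) = distr \<mu> (count_space UNIV) (\<lambda>x. x)"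
  unfolding step_law_def
proof (rule Abs_pmf_inverse, intro CollectI conjI)
  have m: "(\<lambda>x. x) \<in> measurable \<mu> (count_space UNIV)" by (simp add: measurable_mu)
  show "prob_space (distr \<mu> (count_space UNIV) (\<lambda>x. x))" by (rule prob_space_distr[OF m])
  have eq: "measure (distr \<mu> (count_space UNIV) (\<lambda>x. x)) {x} = measure \<mu> {x}" if "x \<in> carrier G" for x
    using that by (simp add: measure_distr[OF m] space_mu)
  have "(\<Union>x\<in>{x\<in>carrier G. measure \<mu> {x} = 0}. {x}) \<in> null_sets \<mu>"
  proof (rule null_sets_UN')
    show "countable {x\<in>carrier G. measure \<mu> {x} = 0}" using countable_carrier by (rule countable_subset[rotated]) auto
  qed (auto simp: null_sets_def sets_mu emeasure_eq_measure)
  then have "AE x in \<mu>. measure \<mu> {x} \<noteq> 0"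
    by (rule AE_I') (auto simp: space_mu)
  then have "AE x in \<mu>. measure (distr \<mu> (count_space UNIV) (\<lambda>x. x)) {x} \<noteq> 0"
    by (rule AE_mp) (rule AE_I2, use eq in \<open>simp add: space_mu\<close>)
  then show "AE x in distr \<mu> (count_space UNIV) (\<lambda>x. x). measure (distr \<mu> (count_space UNIV) (\<lambda>x. x)) {x} \<noteq> 0"
    by (subst AE_distr_iff[OF m]) auto
qed simp

lemma set_step_law: "set_pmf (step_law \<mu>) = measure_support \<mu>"
proof -
  have m: "(\<lambda>x. x) \<in> measurable \<mu> (count_space UNIV)" by (simp add: measurable_mu)
  have "pmf (step_law \<mu>) x = measure \<mu> ({x} \<inter> carrier G)" for x
    by (simp add: pmf.rep_eq measure_step_law measure_distr[OF m] space_mu vimage_def Int_def conj_commute)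
  moreover have "measure \<mu> ({x} \<inter> carrier G) > 0 \<longleftrightarrow> x \<in> measure_support \<mu>" for x
    by (cases "x \<in> carrier G") (auto simp: measure_support_def space_mu)
  moreover have "x \<in> set_pmf p \<longleftrightarrow> pmf p x > 0" for x and p :: "'g pmf"
    using pmf_pos[of p x] by (auto simp: set_pmf_iff)
  ultimately show ?thesis by auto
qed

lemma support_carrier: "measure_support \<mu> \<subseteq> carrier G"
  by (auto simp: measure_support_def space_mu)

abbreviation "W \<equiv> walk_measure \<mu>"

lemma walk_upd: "n < i \<Longrightarrow> walk G n (fun_upd \<omega> i x) = walk G n \<omega>"
  by (induction n) auto

text \<open>The argument splits according to the value of the first n steps, which ranges over the
  countable carrier.\<close>

lemma measurable_walk_PiM:
  assumes "{1..n} \<subseteq> J"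
  shows "walk G n \<in> measurable (PiM J (\<lambda>_. \<mu>)) (count_space (carrier G))"
  using assms
proof (induction n)
  case (Suc n)
  have J: "Suc n \<in> J" using Suc.prems by auto
  have "(\<lambda>\<omega>. walk G n \<omega> \<otimes> \<omega> (Suc n)) \<in> measurable (PiM J (\<lambda>_. \<mu>)) (count_space (carrier G))"
  proof (rule measurable_compose_countable'[where f = "\<lambda>x \<omega>. x \<otimes> \<omega> (Suc n)" and g = "walk G n", OF _ _ countable_carrier])
    show "walk G n \<in> measurable (PiM J (\<lambda>_. \<mu>)) (count_space (carrier G))"
    proof (rule Suc.IH)
      show "{1..n} \<subseteq> J" by (rule order_trans[OF _ Suc.prems]) auto
    qed
    show "(\<lambda>\<omega>. x \<otimes> \<omega> (Suc n)) \<in> measurable (PiM J (\<lambda>_. \<mu>)) (count_space (carrier G))"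
      if "x \<in> carrier G" for x
      by (rule measurable_compose[OF measurable_component_singleton[OF J]])
        (use that in \<open>simp add: measurable_mu\<close>)
  qed
  moreover have "walk G (Suc n) = (\<lambda>\<omega>. walk G n \<omega> \<otimes> \<omega> (Suc n))" by (rule ext) simp
  ultimately show ?case by simp
next
  case 0
  have "walk G 0 = (\<lambda>\<omega>. \<one>)" by (rule ext) simp
  then show ?case by simp
qed

lemma sets_walk_PiM:
  assumes "{1..n} \<subseteq> J"
  shows "{\<omega> \<in> space (PiM J (\<lambda>_. \<mu>)). walk G n \<omega> \<in> B} \<in> sets (PiM J (\<lambda>_. \<mu>))"
proof -
  have "walk G n -` (B \<inter> carrier G) \<inter> space (PiM J (\<lambda>_. \<mu>)) \<in> sets (PiM J (\<lambda>_. \<mu>))"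
    by (rule measurable_sets[OF measurable_walk_PiM[OF assms]]) simp
  also have "walk G n -` (B \<inter> carrier G) \<inter> space (PiM J (\<lambda>_. \<mu>)) = {\<omega> \<in> space (PiM J (\<lambda>_. \<mu>)). walk G n \<omega> \<in> B}"
    using measurable_space[OF measurable_walk_PiM[OF assms]] by auto
  finally show ?thesis .
qed

lemma sets_walk: "{\<omega> \<in> space W. walk G n \<omega> \<in> B} \<in> sets W"
  unfolding walk_measure_def by (rule sets_walk_PiM) simp

lemma emeasure_split_coordinate:
  fixes i :: nat
  defines "P \<equiv> PiM (UNIV - {i}) (\<lambda>_. \<mu>)"
  assumes S: "{\<omega> \<in> space W. Q \<omega>} \<in> sets W"
  shows "emeasure W {\<omega> \<in> space W. Q \<omega>} = (\<integral>\<^sup>+x. emeasure P {X \<in> space P. Q (fun_upd X i x)} \<partial>\<mu>)"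
proof -
  interpret P: prob_space P unfolding P_def by (rule prob_space_PiM) (rule prob_space_axioms)
  let ?f = "\<lambda>(x, X). fun_upd X i x"
  have W: "W = PiM (insert i (UNIV - {i})) (\<lambda>_. \<mu>)" by (simp add: walk_measure_def insert_UNIV)
  have d: "distr (\<mu> \<Otimes>\<^sub>M P) W ?f = W"
    unfolding W P_def by (rule distr_pair_PiM_eq_PiM) (rule prob_space_axioms)+
  have f: "?f \<in> measurable (\<mu> \<Otimes>\<^sub>M P) W"
    unfolding W P_def split_def by (rule measurable_fun_upd[where J = "UNIV - {i}"]) auto
  have "emeasure W {\<omega> \<in> space W. Q \<omega>} = emeasure (\<mu> \<Otimes>\<^sub>M P) (?f -` {\<omega> \<in> space W. Q \<omega>} \<inter> space (\<mu> \<Otimes>\<^sub>M P))"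
    by (subst d[symmetric]) (rule emeasure_distr[OF f S])
  also have "\<dots> = (\<integral>\<^sup>+x. emeasure P (Pair x -` (?f -` {\<omega> \<in> space W. Q \<omega>} \<inter> space (\<mu> \<Otimes>\<^sub>M P))) \<partial>\<mu>)"
    by (rule P.emeasure_pair_measure_alt) (rule measurable_sets[OF f S])
  also have "\<dots> = (\<integral>\<^sup>+x. emeasure P {X \<in> space P. Q (fun_upd X i x)} \<partial>\<mu>)"
  proof (intro nn_integral_cong arg_cong2[where f = emeasure] refl)
    fix x assume "x \<in> space \<mu>"
    then show "Pair x -` (?f -` {\<omega> \<in> space W. Q \<omega>} \<inter> space (\<mu> \<Otimes>\<^sub>M P)) = {X \<in> space P. Q (fun_upd X i x)}"
      using measurable_space[OF f] by (auto simp: space_pair_measure)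
  qed
  finally show ?thesis .
qed

lemma emeasure_walk: "emeasure W {\<omega> \<in> space W. walk G n \<omega> \<in> B} = emeasure (measure_pmf (walk_law G \<mu> n)) B"
proof (induction n arbitrary: B)
  case 0
  interpret W: prob_space W unfolding walk_measure_def by (rule prob_space_PiM) (rule prob_space_axioms)
  show ?case by (auto simp: W.emeasure_space_1 indicator_def)
next
  case (Suc n)
  let ?P = "PiM (UNIV - {Suc n}) (\<lambda>_. \<mu>)"
  \<comment> \<open>The first n steps ignore coordinate n + 1, so removing this coordinate does not
    change their law.\<close>
  have *: "emeasure ?P {X \<in> space ?P. walk G n X \<in> B} = emeasure (measure_pmf (walk_law G \<mu> n)) B" for B
    unfolding Suc.IH[symmetric] emeasure_split_coordinate[OF sets_walk, where i = "Suc n"]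
    by (simp add: walk_upd emeasure_space_1)
  have "emeasure W {\<omega> \<in> space W. walk G (Suc n) \<omega> \<in> B}
      = (\<integral>\<^sup>+x. emeasure ?P {X \<in> space ?P. walk G n X \<in> {y. y \<otimes> x \<in> B}} \<partial>\<mu>)"
    unfolding emeasure_split_coordinate[OF sets_walk, where i = "Suc n"] by (simp add: walk_upd)
  also have "\<dots> = (\<integral>\<^sup>+x. emeasure (measure_pmf (walk_law G \<mu> n)) {y. y \<otimes> x \<in> B} \<partial>\<mu>)"
    unfolding * ..
  also have "\<dots> = (\<integral>\<^sup>+x. emeasure (measure_pmf (walk_law G \<mu> n)) {y. y \<otimes> x \<in> B} \<partial>measure_pmf (step_law \<mu>))"
    unfolding measure_step_law by (subst nn_integral_distr) (auto simp: measurable_mu)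
  also have "\<dots> = emeasure (measure_pmf (walk_law G \<mu> (Suc n))) B"
    by (simp add: vimage_def)
  finally show ?case .
qed

lemma set_walk_law: "set_pmf (walk_law G \<mu> n) \<subseteq> carrier G"
  by (induction n) (use support_carrier in \<open>auto simp: set_step_law\<close>)

lemma walk_law_add:
  "walk_law G \<mu> (m + n) = bind_pmf (walk_law G \<mu> m) (\<lambda>x. map_pmf (\<lambda>y. x \<otimes> y) (walk_law G \<mu> n))"
proof (induction n)
  case 0
  have "bind_pmf (walk_law G \<mu> m) (\<lambda>x. return_pmf (x \<otimes> \<one>)) = bind_pmf (walk_law G \<mu> m) return_pmf"
    using set_walk_law[of m] by (intro bind_pmf_cong refl) auto
  then show ?case by (simp add: bind_return_pmf')
next
  case (Suc n)
  have "walk_law G \<mu> (m + Suc n) = bind_pmf (step_law \<mu>) (\<lambda>g. bind_pmf (walk_law G \<mu> m)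
      (\<lambda>x. map_pmf (\<lambda>y. (x \<otimes> y) \<otimes> g) (walk_law G \<mu> n)))"
    by (simp add: Suc map_bind_pmf map_pmf_comp)
  also have "\<dots> = bind_pmf (walk_law G \<mu> m) (\<lambda>x. bind_pmf (step_law \<mu>)
      (\<lambda>g. map_pmf (\<lambda>y. (x \<otimes> y) \<otimes> g) (walk_law G \<mu> n)))"
    by (rule bind_commute_pmf)
  also have "\<dots> = bind_pmf (walk_law G \<mu> m) (\<lambda>x. bind_pmf (step_law \<mu>)
      (\<lambda>g. map_pmf (\<lambda>y. x \<otimes> (y \<otimes> g)) (walk_law G \<mu> n)))"
    using set_walk_law support_carrier set_step_law
    by (intro bind_pmf_cong map_pmf_cong refl m_assoc) auto
  also have "\<dots> = bind_pmf (walk_law G \<mu> m) (\<lambda>x. map_pmf (\<lambda>y. x \<otimes> y) (walk_law G \<mu> (Suc n)))"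
    by (simp add: map_bind_pmf map_pmf_comp)
  finally show ?case .
qed

lemma walk_law_mult:
  "x \<in> set_pmf (walk_law G \<mu> m) \<Longrightarrow> y \<in> set_pmf (walk_law G \<mu> n) \<Longrightarrow> x \<otimes> y \<in> set_pmf (walk_law G \<mu> (m + n))"
  unfolding walk_law_add by auto

lemma walk_law_pow:
  assumes "x \<in> set_pmf (walk_law G \<mu> k)" shows "x [^] (n::nat) \<in> set_pmf (walk_law G \<mu> (n * k))"
proof (induction n)
  case (Suc n)
  then show ?case using walk_law_mult[OF Suc assms] by (simp add: add.commute)
qed simp

lemma semigroup_generated_reached:
  "x \<in> semigroup_generated G (measure_support \<mu>) \<Longrightarrow> \<exists>k>0. x \<in> set_pmf (walk_law G \<mu> k)"
proof (induction rule: semigroup_generated.induct)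
  case (base s)
  then have "s \<in> set_pmf (walk_law G \<mu> (Suc 0))"
    using support_carrier by (auto simp: set_step_law intro!: bexI[of _ s])
  then show ?case by blast
next
  case (mult a b)
  then obtain j k where "j > 0" "k > 0" "a \<in> set_pmf (walk_law G \<mu> j)" "b \<in> set_pmf (walk_law G \<mu> k)" by blast
  then show ?case using walk_law_mult[of a j b k] by (intro exI[of _ "j + k"]) auto
qed

end

section \<open>From group elements to isometries\<close>

locale isometric_group_action = group G for G :: "('g, 'b) monoid_scheme" (structure) +
  fixes \<phi> :: "'g \<Rightarrow> 'x::metric_space \<Rightarrow> 'x"
  assumes action: "isometric_action G \<phi>"
begin

lemma act_isometry: "x \<in> carrier G \<Longrightarrow> isometry (\<phi> x)"
  using action by (simp add: isometric_action_def)

lemma act_mult: "x \<in> carrier G \<Longrightarrow> y \<in> carrier G \<Longrightarrow> \<phi> (x \<otimes> y) = \<phi> x \<circ> \<phi> y"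
  using action group_action.composition_rule[of G UNIV \<phi>] by (auto simp: isometric_action_def)

lemma act_one: "\<phi> \<one> = id"
  using action group_action.id_eq_one[of G UNIV \<phi>] by (auto simp: isometric_action_def restrict_def id_def)

lemma act_inv: assumes "x \<in> carrier G" shows "\<phi> (inv x) = inv_into UNIV (\<phi> x)"
proof
  fix y
  have "\<phi> (inv x) (\<phi> x (inv_into UNIV (\<phi> x) y)) = inv_into UNIV (\<phi> x) y"
    using act_mult[of "inv x" x] assms by (simp add: act_one fun_eq_iff)
  then show "\<phi> (inv x) y = inv_into UNIV (\<phi> x) y"
    by (simp add: isometry_inv_simps[OF act_isometry[OF assms]])
qed

lemma act_pow: "x \<in> carrier G \<Longrightarrow> \<phi> (x [^] (n::nat)) = \<phi> x ^^ n"
  by (induction n) (auto simp: act_one act_mult funpow_swap1 fun_eq_iff)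

lemma act_int_pow:
  assumes x: "x \<in> carrier G" shows "\<phi> (x [^] (k::int)) = zpow (\<phi> x) k"
proof (induction k rule: int_induct[where k = 0])
  case base then show ?case by (simp add: act_one fun_eq_iff)
next
  case (step1 i)
  have "x [^] (i + 1) = x [^] i \<otimes> x" using int_pow_mult[OF x, of i 1] x by (simp add: int_pow_1)
  then show ?case using step1 x zpow_add[OF act_isometry[OF x], of i 1]
    by (simp add: act_mult fun_eq_iff act_isometry)
next
  case (step2 i)
  have "x [^] i = x [^] (i - 1) \<otimes> x" using int_pow_mult[OF x, of "i - 1" 1] x by (simp add: int_pow_1)
  then have "\<phi> (x [^] i) = \<phi> (x [^] (i - 1)) \<circ> \<phi> x" using x act_mult[of "x [^] (i - 1)" x] by simp
  then have *: "zpow (\<phi> x) i y = \<phi> (x [^] (i - 1)) (\<phi> x y)" for y unfolding step2(2)[symmetric] by simp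
  show ?case
  proof
    fix z
    obtain y where "z = \<phi> x y" by (metis isometry_inv_simps(1)[OF act_isometry[OF x]])
    then show "\<phi> (x [^] (i - 1)) z = zpow (\<phi> x) (i - 1) z"
      using *[of y] zpow_add[OF act_isometry[OF x], of "i - 1" 1 y] by (simp add: act_isometry x)
  qed
qed

end

text \<open>The preimage of the compact interval [0, K] under a proper map is compact, hence finite
  in a discrete space.\<close>

lemma independent_elements_finite:
  assumes "independent_elements G \<phi> g h"
  shows "finite {(m::int, n::int). dist (\<phi> (g [^]\<^bsub>G\<^esub> m) x) (\<phi> (h [^]\<^bsub>G\<^esub> n) x) \<le> K}"
proof -
  let ?f = "\<lambda>(m, n). dist (\<phi> (g [^]\<^bsub>G\<^esub> m) x) (\<phi> (h [^]\<^bsub>G\<^esub> n) x)"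
  have "proper_map (discrete_topology (UNIV :: (int \<times> int) set)) (top_of_set {0..}) ?f"
    using assms by (simp add: independent_elements_def)
  moreover have "compactin (top_of_set {0..}) {0..K}" by (simp add: compactin_subtopology)
  ultimately have "compactin (discrete_topology UNIV) {p \<in> topspace (discrete_topology (UNIV :: (int \<times> int) set)). ?f p \<in> {0..K}}"
    by (rule compactin_proper_map_preimage)
  then show ?thesis by (simp add: compactin_discrete_topology split_def)
qed

lemma exponential_contraction:
  fixes G :: "('g, 'b) monoid_scheme"
    and \<mu> :: "'g measure"
    and \<phi> :: "'g \<Rightarrow> 'x::complete_space \<Rightarrow> 'x"
  assumes "group G" and "countable (carrier G)"
    and "prob_measure_on G \<mu>" and "admissible G \<mu>"
    and "cat0_space TYPE('x)"
    and "isometric_action G \<phi>"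
    and gh: "g \<in> carrier G" "h \<in> carrier G" "contracting (\<phi> g)" "contracting (\<phi> h)" "independent_elements G \<phi> g h"
  shows "\<exists>\<rho> K. 0 < \<rho> \<and> \<rho> < 1 \<and> 0 < K \<and> (\<forall>n. measure (walk_measure \<mu>)
    {\<omega> \<in> space (walk_measure \<mu>). \<not> contracting (\<phi> (walk G n \<omega>))} \<le> K * \<rho> ^ n)"
proof -
  interpret group_walk G \<mu> using assms by (simp add: group_walk_def group_walk_axioms_def)
  interpret isometric_group_action G \<phi> using assms by (simp add: isometric_group_action_def isometric_group_action_axioms_def)
  interpret cat0 "TYPE('x)" using assms by unfold_locales
  define I :: "nat set" where "I = {..<32}"
  have fI: "finite I" "32 \<le> card I" by (simp_all add: I_def)
  have fin: "finite {(m, n). dist (zpow (\<phi> g) m x) (zpow (\<phi> h) n x) \<le> K}" for x K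
    using independent_elements_finite[OF gh(5), of x K] gh by (simp add: act_int_pow)
  obtain m n\<^sub>0 A R where sch: "\<forall>n. (\<forall>i\<in>I. n\<^sub>0 \<le> n i) \<longrightarrow> schottky I
      (\<lambda>i. (zpow (\<phi> g) (int (i * m)) \<circ> \<phi> h \<circ> inv_into UNIV (zpow (\<phi> g) (int (i * m)))) ^^ n i) A R contracting"
    using schottky_exists[OF gh(3,4) fin fI] by blast
  define e where "e i = g [^]\<^bsub>G\<^esub> int (i * m) \<otimes>\<^bsub>G\<^esub> h \<otimes>\<^bsub>G\<^esub> inv\<^bsub>G\<^esub> (g [^]\<^bsub>G\<^esub> int (i * m))" for i
  have e: "e i \<in> carrier G" for i using gh by (simp add: e_def)
  have act_e: "\<phi> (e i) = zpow (\<phi> g) (int (i * m)) \<circ> \<phi> h \<circ> inv_into UNIV (zpow (\<phi> g) (int (i * m)))" for i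
    using gh by (simp add: e_def act_mult act_inv act_int_pow del: of_nat_mult)
  have "\<exists>k>0. e i \<in> set_pmf (walk_law G \<mu> k)" for i
    using semigroup_generated_reached[of "e i"] e assms(4) by (simp add: admissible_def)
  then obtain k where k: "\<And>i. k i > 0" "\<And>i. e i \<in> set_pmf (walk_law G \<mu> (k i))" by metis
  \<comment> \<open>The time \<open>k i\<close> at which \<open>e i\<close> is reached depends on i.
    As \<open>k i\<close> divides P, the power \<open>n i\<close> of \<open>e i\<close> is reached
    at the common time M, and the factor \<open>n\<^sub>0 + 1\<close> makes \<open>n i\<close> at
    least \<open>n\<^sub>0\<close>.\<close>
  define P where "P = (\<Prod>i\<in>I. k i)"
  define M where "M = (n\<^sub>0 + 1) * P"
  define n where "n i = (n\<^sub>0 + 1) * (P div k i)" for i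
  have dvd: "k i dvd P" if "i \<in> I" for i unfolding P_def using that by (intro dvd_prodI) (auto simp: I_def)
  have P: "P > 0" using k by (simp add: P_def I_def prod_pos)
  have nk: "n i * k i = M" if "i \<in> I" for i by (simp only: n_def M_def mult.assoc dvd_div_mult_self[OF dvd[OF that]])
  have n: "n i \<ge> n\<^sub>0" if "i \<in> I" for i
  proof -
    have "P div k i \<ge> 1" using dvd[OF that] P k[of i] by (simp add: Suc_le_eq div_greater_zero_iff dvd_imp_le)
    then have "(n\<^sub>0 + 1) * 1 \<le> n i" unfolding n_def by (intro mult_le_mono2)
    then show ?thesis by simp
  qed
  have slot: "e i [^]\<^bsub>G\<^esub> n i \<in> set_pmf (walk_law G \<mu> M)" if "i \<in> I" for i
    using walk_law_pow[OF k(2), of i "n i"] nk[OF that] by simp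
  define F where "F i = \<phi> (e i) ^^ n i" for i
  define V where "V j = map_pmf \<phi> (walk_law G \<mu> j)" for j
  have F: "\<phi> (e i [^]\<^bsub>G\<^esub> n i) = F i" for i by (simp add: F_def act_pow e)
  interpret schottky I F A R contracting using sch n by (simp add: F_def[abs_def] act_e)
  \<comment> \<open>A slot consists of two letters of M steps each.\<close>
  interpret schottky_walk I F A R contracting V "M + M"
  proof
    show "0 < M + M" using P by (simp add: M_def)
    show "isometry f" if "f \<in> set_pmf (V j)" for f j
      using that set_walk_law act_isometry by (auto simp: V_def)
    show "V (i + j) = bind_pmf (V i) (\<lambda>f. map_pmf ((\<circ>) f) (V j))" for i j
    proof -
      have "V (i + j) = bind_pmf (walk_law G \<mu> i) (\<lambda>x. map_pmf (\<lambda>y. \<phi> (x \<otimes>\<^bsub>G\<^esub> y)) (walk_law G \<mu> j))"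
        by (simp add: V_def walk_law_add map_bind_pmf map_pmf_comp)
      also have "\<dots> = bind_pmf (walk_law G \<mu> i) (\<lambda>x. map_pmf (\<lambda>y. \<phi> x \<circ> \<phi> y) (walk_law G \<mu> j))"
        using set_walk_law by (intro bind_pmf_cong map_pmf_cong refl act_mult) auto
      also have "\<dots> = bind_pmf (V i) (\<lambda>f. map_pmf ((\<circ>) f) (V j))"
        by (simp add: V_def bind_map_pmf map_pmf_comp)
      finally show ?thesis .
    qed
    show "F a \<circ> F b \<in> set_pmf (V (M + M))" if "a \<in> I" "b \<in> I" for a b
    proof -
      have "F a \<circ> F b = \<phi> (e a [^]\<^bsub>G\<^esub> n a \<otimes>\<^bsub>G\<^esub> e b [^]\<^bsub>G\<^esub> n b)" by (simp add: act_mult e F)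
      then show ?thesis using walk_law_mult[OF slot slot, OF that] by (simp add: V_def)
    qed
  qed
  have "measure (walk_measure \<mu>) {\<omega> \<in> space (walk_measure \<mu>). \<not> contracting (\<phi> (walk G j \<omega>))}
      = measure (V j) {f. \<not> contracting f}" for j
    using emeasure_walk[of j "{x. \<not> contracting (\<phi> x)}"] by (simp add: V_def measure_def vimage_def)
  then show ?thesis using exponential_bound by simp
qed

theorem mainTheorem4:
  fixes G :: "('g, 'b) monoid_scheme"
    and \<mu> :: "'g measure"
    and \<phi> :: "'g \<Rightarrow> 'x::complete_space \<Rightarrow> 'x"
  assumes "group G" and "countable (carrier G)"
    and "prob_measure_on G \<mu>" and "admissible G \<mu>"
    and "separable_space (euclidean :: 'x topology)"
    and "cat0_space TYPE('x)"
    and "isometric_action G \<phi>"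
    and "\<exists>g\<in>carrier G. \<exists>h\<in>carrier G.
           contracting (\<phi> g) \<and> contracting (\<phi> h) \<and> independent_elements G \<phi> g h"
  shows "((\<lambda>n. measure (walk_measure \<mu>)
              {\<omega> \<in> space (walk_measure \<mu>). contracting (\<phi> (walk G n \<omega>))}) \<longlonglongrightarrow> 1) \<and>
    (finite (measure_support \<mu>) \<longrightarrow>
       (\<exists>c<1. \<exists>K>0. \<forall>n. measure (walk_measure \<mu>)
          {\<omega> \<in> space (walk_measure \<mu>). \<not> contracting (\<phi> (walk G n \<omega>))} \<le> K * c ^ n))"
proof -
  interpret group_walk G \<mu> using assms by (simp add: group_walk_def group_walk_axioms_def)
  interpret W: prob_space W unfolding walk_measure_def by (rule prob_space_PiM) (rule prob_space_axioms)
  let ?bad = "\<lambda>n. measure W {\<omega> \<in> space W. \<not> contracting (\<phi> (walk G n \<omega>))}"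
  obtain g h where gh: "g \<in> carrier G" "h \<in> carrier G" "contracting (\<phi> g)" "contracting (\<phi> h)"
    "independent_elements G \<phi> g h" using assms(8) by blast
  obtain \<rho> K where \<rho>: "0 < \<rho>" "\<rho> < 1" "0 < K" "\<And>n. ?bad n \<le> K * \<rho> ^ n"
    using exponential_contraction[OF assms(1-4,6,7) gh] by blast
  have "measure W {\<omega> \<in> space W. contracting (\<phi> (walk G n \<omega>))} = 1 - ?bad n" for n
  proof -
    have "space W - {\<omega> \<in> space W. walk G n \<omega> \<in> {x. \<not> contracting (\<phi> x)}}
        = {\<omega> \<in> space W. contracting (\<phi> (walk G n \<omega>))}" by auto
    then show ?thesis using W.prob_compl[OF sets_walk[of n "{x. \<not> contracting (\<phi> x)}"]] by simp
  qed
  moreover have "?bad \<longlonglongrightarrow> 0"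
  proof (rule tendsto_sandwich[OF _ _ tendsto_const])
    have "(\<lambda>n. \<rho> ^ n) \<longlonglongrightarrow> 0" using \<rho> by (intro LIMSEQ_realpow_zero) auto
    then show "(\<lambda>n. K * \<rho> ^ n) \<longlonglongrightarrow> 0" by (rule tendsto_mult_right_zero)
  qed (use \<rho> in auto)
  then have "(\<lambda>n. 1 - ?bad n) \<longlonglongrightarrow> 1 - 0" by (intro tendsto_intros)
  ultimately show ?thesis using \<rho> by auto
qed

end
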